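(* Assume that there is an $\alpha(m,n)$-approximation algorithm $\mathcal{A}$ for Red-Blue Set Cover, where $\alpha$ is a non-decreasing function of $m$ and $n$. Then there exists an $O(\log^2 k)\cdot\alpha(m,n)$-approximation algorithm for Min $k$-Union.
   Context: Min $k$-Union: given a ground set $X$ of size $n$, a family $\mathcal{S}$ of $m$ sets $S_1,\dots,S_m\subseteq X$ and an integer $k\geq 1$, choose $k$ sets $S_{i_1},\dots,S_{i_k}$ minimizing $|\bigcup_{t=1}^k S_{i_t}|$. Red-Blue Set Cover: given disjoint sets $R$ of $n$ red elements and $B$ of blue elements and $m$ sets over $R\cup B$, choose a sub-collection whose union contains $B$ while minimizing the number of red elements in its union. An $\alpha(m,n)$-approximation algorithm for Red-Blue Set Cover (with $m$ sets and $n$ red elements) runs in polynomial time and returns a feasible solution of cost at most $\alpha(m,n)$ times the optimum; in the conclusion, $m=|\mathcal{S}|$ and $n=|X|$. *)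

theory Defs
  imports Complex_Main "HOL-Library.Landau_Symbols" "HOL-Computational_Algebra.Polynomial"
begin

text \<open>
  Model of computation: deterministic programs over binary trees, i.e. the one-variable WHILE
  language over trees (Jones, Computability and Complexity from a Programming Perspective), in
  point-free form. Every program maps the current tree to a new tree. The empty tree
  \<open>Leaf\<close> is false, every other tree is true.

  The time of a run charges for each value its full number of nodes whenever it is
  produced or copied. Hence a run of time \<open>t\<close> only ever handles trees with at most
  \<open>t\<close> nodes (besides its input), so that the model and multi-tape Turing machines
  simulate each other with polynomial overhead.
\<close>

datatype tree = Leaf | Node tree tree

fun nodes :: "tree \<Rightarrow> nat" where
  "nodes Leaf = 1"
| "nodes (Node a b) = 1 + nodes a + nodes b"

fun left :: "tree \<Rightarrow> tree" where
  "left Leaf = Leaf"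
| "left (Node a b) = a"

fun right :: "tree \<Rightarrow> tree" where
  "right Leaf = Leaf"
| "right (Node a b) = b"

datatype prog =
    Id
  | Empty
  | Lft
  | Rgt
  | Fork prog prog
  | Seq prog prog
  | Cond prog prog prog
  | While prog prog

text \<open>\<open>run p x t y\<close>: started on \<open>x\<close>, the program \<open>p\<close> halts with result \<open>y\<close> after time \<open>t\<close>.\<close>

inductive run :: "prog \<Rightarrow> tree \<Rightarrow> nat \<Rightarrow> tree \<Rightarrow> bool" where
  Id: "run Id x (nodes x) x"
| Empty: "run Empty x 1 Leaf"
| Lft: "run Lft x (nodes (left x)) (left x)"
| Rgt: "run Rgt x (nodes (right x)) (right x)"
| Fork: "run p x s a \<Longrightarrow> run q x t b \<Longrightarrow> run (Fork p q) x (1 + s + t) (Node a b)"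
| Seq: "run p x s y \<Longrightarrow> run q y t z \<Longrightarrow> run (Seq p q) x (s + t) z"
| Cond_True: "run c x s b \<Longrightarrow> b \<noteq> Leaf \<Longrightarrow> run p x t y \<Longrightarrow> run (Cond c p q) x (s + t) y"
| Cond_False: "run c x s Leaf \<Longrightarrow> run q x t y \<Longrightarrow> run (Cond c p q) x (s + t) y"
| While_True: "run c x s b \<Longrightarrow> b \<noteq> Leaf \<Longrightarrow> run p x t y \<Longrightarrow> run (While c p) y u z
    \<Longrightarrow> run (While c p) x (s + t + u) z"
| While_False: "run c x s Leaf \<Longrightarrow> run (While c p) x (s + nodes x) x"

lemma nodes_le_time: "run p x t y \<Longrightarrow> nodes y \<le> t"
  by (induction rule: run.induct) auto

inductive_cases run_elims:
  "run Id x t y" "run Empty x t y" "run Lft x t y" "run Rgt x t y" "run (Fork p q) x t y"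
  "run (Seq p q) x t y" "run (Cond c p q) x t y" "run (While c p) x t y"

lemma run_deterministic: "run p x t y \<Longrightarrow> run p x t' y' \<Longrightarrow> t = t' \<and> y = y'"
proof (induction arbitrary: t' y' rule: run.induct)
  case (Id x)
  then show ?case by (rule run_elims(1)) simp
next
  case (Empty x)
  then show ?case by (rule run_elims(2)) simp
next
  case (Lft x)
  then show ?case by (rule run_elims(3)) simp
next
  case (Rgt x)
  then show ?case by (rule run_elims(4)) simp
next
  case (Fork p x s a q t b)
  from Fork.prems show ?case by (rule run_elims(5)) (metis Fork.IH add_Suc plus_1_eq_Suc)
next
  case (Seq p x s y q t z)
  from Seq.prems show ?case by (rule run_elims(6)) (metis Seq.IH)
next
  case (Cond_True c x s b p t y q)
  from Cond_True.prems show ?case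
    by (rule run_elims(7)) (metis Cond_True.IH Cond_True.hyps(2))+
next
  case (Cond_False c x s q t y p)
  from Cond_False.prems show ?case
    by (rule run_elims(7)) (metis Cond_False.IH)+
next
  case (While_True c x s b p t y u z)
  from While_True.prems show ?case
    by (rule run_elims(8)) (metis While_True.IH While_True.hyps(2))+
next
  case (While_False c x s p)
  from While_False.prems show ?case
    by (rule run_elims(8)) (metis While_False.IH)+
qed

fun encode_list :: "('a \<Rightarrow> tree) \<Rightarrow> 'a list \<Rightarrow> tree" where
  "encode_list f [] = Leaf"
| "encode_list f (x # xs) = Node (f x) (encode_list f xs)"

definition encode_bool :: "bool \<Rightarrow> tree" where
  "encode_bool b = (if b then Node Leaf Leaf else Leaf)"

text \<open>Numbers are written in unary; they only occur as sizes of explicitly given sets and as the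
  parameter \<open>k\<close>, which is at most the number of sets in every feasible instance.\<close>

definition encode_nat :: "nat \<Rightarrow> tree" where
  "encode_nat n = encode_list (\<lambda>_. Leaf) [0..<n]"

definition encode_subset :: "nat \<Rightarrow> nat set \<Rightarrow> tree" where
  "encode_subset n A = encode_list (\<lambda>j. encode_bool (j \<in> A)) [0..<n]"

record ('i, 's) min_problem =
  instances :: "'i set"
  feasible :: "'i \<Rightarrow> 's set"
  cost :: "'i \<Rightarrow> 's \<Rightarrow> nat"
  encode_instance :: "'i \<Rightarrow> tree"
  encode_solution :: "'i \<Rightarrow> 's \<Rightarrow> tree"

definition opt :: "('i, 's) min_problem \<Rightarrow> 'i \<Rightarrow> nat" where
  "opt P x = Min (cost P x ` feasible P x)"

text \<open>Nothing is required on instances without a feasible solution.\<close>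

definition approx_algorithm ::
    "('i, 's) min_problem \<Rightarrow> ('i \<Rightarrow> real) \<Rightarrow> prog \<Rightarrow> bool" where
  "approx_algorithm P \<rho> A \<longleftrightarrow>
     (\<exists>q :: nat poly. \<forall>x\<in>instances P. feasible P x \<noteq> {} \<longrightarrow>
        (\<exists>t s. run A (encode_instance P x) t (encode_solution P x s) \<and>
               t \<le> poly q (nodes (encode_instance P x)) \<and>
               s \<in> feasible P x \<and>
               real (cost P x s) \<le> \<rho> x * real (opt P x)))"

text \<open>In both problems the sets form an indexed family (repetitions are allowed), and a solution is
  a set of indices. The ground set of Min k-Union is \<open>{..<ground}\<close>.\<close>

record ku_instance =
  ground :: nat
  ku_sets :: "nat set list"
  param :: nat

definition min_k_union :: "(ku_instance, nat set) min_problem" where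
  "min_k_union = \<lparr>
     instances = {x. (\<forall>S\<in>set (ku_sets x). S \<subseteq> {..<ground x}) \<and> 1 \<le> param x},
     feasible = (\<lambda>x. {I. I \<subseteq> {..<length (ku_sets x)} \<and> card I = param x}),
     cost = (\<lambda>x I. card (\<Union>i\<in>I. ku_sets x ! i)),
     encode_instance = (\<lambda>x. Node (encode_nat (ground x)) (Node (encode_nat (param x))
       (encode_list (encode_subset (ground x)) (ku_sets x)))),
     encode_solution = (\<lambda>x. encode_subset (length (ku_sets x)))\<rparr>"

text \<open>Red elements are \<open>Inl r\<close> with \<open>r < red\<close>, blue elements are \<open>Inr b\<close> with \<open>b < blue\<close>.\<close>

record rb_instance =
  red :: nat
  blue :: nat
  rb_sets :: "(nat + nat) set list"

definition red_blue_set_cover :: "(rb_instance, nat set) min_problem" where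
  "red_blue_set_cover = \<lparr>
     instances = {x. \<forall>S\<in>set (rb_sets x). S \<subseteq> {..<red x} <+> {..<blue x}},
     feasible = (\<lambda>x. {I. I \<subseteq> {..<length (rb_sets x)} \<and>
       Inr ` {..<blue x} \<subseteq> (\<Union>i\<in>I. rb_sets x ! i)}),
     cost = (\<lambda>x I. card ((\<Union>i\<in>I. rb_sets x ! i) \<inter> Inl ` {..<red x})),
     encode_instance = (\<lambda>x. Node (encode_nat (red x)) (Node (encode_nat (blue x))
       (encode_list (\<lambda>S. Node (encode_subset (red x) (Inl -` S)) (encode_subset (blue x) (Inr -` S)))
         (rb_sets x)))),
     encode_solution = (\<lambda>x. encode_subset (length (rb_sets x)))\<rparr>"

end

theory Submission
  imports Defs "HOL-Analysis.L2_Norm" "HOL-Number_Theory.Cong"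
begin

text \<open>
  Suppose \<open>r\<close> sets are still missing. Give every set a few blue elements out of \<open>\<Theta>(r)\<close> many, such that
  no set has more than \<open>O(log k)\<close> of them and such that \<open>r\<close> unknown sets of an optimal solution have
  all of them. Then a cover contains \<open>\<Omega>(r / log k)\<close> new sets and costs at most \<open>\<alpha>\<close> times the optimum,
  so that \<open>O(log\<^sup>2 k)\<close> rounds suffice.

  A random assignment of blue elements does this with high probability. Here polynomially many
  assignments are tried instead, and in each round the cheapest cover is kept: multiply-shift hashing
  maps the \<open>r\<close> sets onto a constant fraction of the torus \<open>\<int>\<^sub>N \<times> \<int>\<^sub>N\<close> with \<open>r \<le> N\<^sup>2 < 4 r\<close>, and the
  blue element of a point \<open>p\<close> is given to all sets whose hash value lies on the walk from \<open>p\<close> along a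
  common word of length \<open>O(log k)\<close> over five affine maps. These maps make the torus an expander of
  constant degree, hence some word leads from every point into the image of the \<open>r\<close> sets, and
  there are only polynomially many words.
\<close>

section \<open>Functions computable in polynomial time\<close>

text \<open>The optimum is unknown and programs are deterministic, so no single assignment can be
  certified as good. This does no harm, because the two requirements are separate: every cover of
  every candidate instance contains many new sets, by the bound on blue elements per set alone,
  whereas a low cost is needed for just one candidate, and covers can be compared by cost. Hashing
  by itself is only guaranteed to reach a constant fraction of the points; prolonging it by a walk
  repairs this, at the price of one logarithm in the number of blue elements per set. The other
  logarithm comes from the geometric decay of the number of missing sets. Selected sets stay in the
  instance with their red elements but without blue ones, so that every call has the original number
  of sets and of red elements, and its factor is exactly \<alpha>(m,n). All of this has to be a
  concrete program; since numbers are unary, loops over their ranges are polynomial.\<close>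

definition run_le :: "prog \<Rightarrow> tree \<Rightarrow> nat \<Rightarrow> tree \<Rightarrow> bool" where
  "run_le p x T y \<longleftrightarrow> (\<exists>t\<le>T. run p x t y)"

lemma run_le_mono: "run_le p x T y \<Longrightarrow> T \<le> T' \<Longrightarrow> run_le p x T' y"
  unfolding run_le_def by (meson le_trans)

lemma nodes_le_run_le: "run_le p x T y \<Longrightarrow> nodes y \<le> T"
  unfolding run_le_def using nodes_le_time by (meson le_trans)

lemma run_le_Id: "run_le Id x (nodes x) x"
  unfolding run_le_def using run.Id by blast

lemma run_le_Empty: "run_le Empty x 1 Leaf"
  unfolding run_le_def using run.Empty by blast

lemma run_le_Lft: "run_le Lft (Node a b) (nodes a) a"
  unfolding run_le_def using run.Lft[of "Node a b"] by auto

lemma run_le_Rgt: "run_le Rgt (Node a b) (nodes b) b"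
  unfolding run_le_def using run.Rgt[of "Node a b"] by auto

lemma run_le_Fork:
  "run_le p x S a \<Longrightarrow> run_le q x T b \<Longrightarrow> run_le (Fork p q) x (1 + S + T) (Node a b)"
  unfolding run_le_def using run.Fork by (meson add_le_mono order_refl)

lemma run_le_Seq: "run_le p x S y \<Longrightarrow> run_le q y T z \<Longrightarrow> run_le (Seq p q) x (S + T) z"
  unfolding run_le_def using run.Seq by (meson add_le_mono)

lemma run_le_Cond_True:
  "run_le c x S b \<Longrightarrow> b \<noteq> Leaf \<Longrightarrow> run_le p x T y \<Longrightarrow> run_le (Cond c p q) x (S + T) y"
  unfolding run_le_def using run.Cond_True by (meson add_le_mono)

lemma run_le_Cond_False:
  "run_le c x S Leaf \<Longrightarrow> run_le q x T y \<Longrightarrow> run_le (Cond c p q) x (S + T) y"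
  unfolding run_le_def using run.Cond_False by (meson add_le_mono)

lemma run_le_While_True:
  "run_le c x S b \<Longrightarrow> b \<noteq> Leaf \<Longrightarrow> run_le p x T y \<Longrightarrow> run_le (While c p) y U z
    \<Longrightarrow> run_le (While c p) x (S + T + U) z"
  unfolding run_le_def using run.While_True by (meson add_le_mono)

lemma run_le_While_False: "run_le c x S Leaf \<Longrightarrow> run_le (While c p) x (S + nodes x) x"
  unfolding run_le_def using run.While_False by (meson add_le_mono order_refl)

section \<open>Encodings of data as trees\<close>

class enc =
  fixes enc :: "'a \<Rightarrow> tree"

instantiation unit :: enc
begin
definition enc_unit :: "unit \<Rightarrow> tree" where "enc_unit u = Leaf"
instance ..
end

instantiation bool :: enc
begin
definition enc_bool :: "bool \<Rightarrow> tree" where "enc_bool = encode_bool"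
instance ..
end

instantiation nat :: enc
begin
definition enc_nat :: "nat \<Rightarrow> tree" where "enc_nat = encode_nat"
instance ..
end

instantiation prod :: (enc, enc) enc
begin
definition enc_prod :: "'a \<times> 'b \<Rightarrow> tree" where "enc_prod p = Node (enc (fst p)) (enc (snd p))"
instance ..
end

instantiation list :: (enc) enc
begin
definition enc_list :: "'a list \<Rightarrow> tree" where "enc_list = encode_list enc"
instance ..
end

lemma enc_Pair [simp]: "enc (a, b) = Node (enc a) (enc b)"
  by (simp add: enc_prod_def)

lemma enc_Nil [simp]: "enc [] = Leaf"
  and enc_Cons [simp]: "enc (x # xs) = Node (enc x) (enc xs)"
  by (simp_all add: enc_list_def)

lemma enc_bool_eq_Leaf [simp]: "enc b = Leaf \<longleftrightarrow> \<not> b"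
  and enc_True: "enc True = Node Leaf Leaf"
  and enc_False: "enc False = Leaf"
  by (auto simp: enc_bool_def encode_bool_def)

lemma encode_list_map: "encode_list f (map g xs) = encode_list (\<lambda>x. f (g x)) xs"
  by (induction xs) auto

text \<open>A unary number is literally a list of units, so a number can drive a loop over a list
  without any conversion; \<open>polytime_units\<close> rests on this.\<close>

lemma enc_nat_replicate: "enc n = enc (replicate n ())"
proof -
  have "encode_list (\<lambda>_. Leaf) xs = enc (replicate (length xs) ())" for xs :: "nat list"
    by (induction xs) (auto simp: enc_unit_def)
  then show ?thesis by (simp add: enc_nat_def encode_nat_def)
qed

lemma enc_0 [simp]: "enc (0 :: nat) = Leaf"
  and enc_Suc [simp]: "enc (Suc n) = Node Leaf (enc n)"
  by (simp_all add: enc_nat_replicate enc_unit_def)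

abbreviation esize :: "'a::enc \<Rightarrow> nat" where
  "esize x \<equiv> nodes (enc x)"

lemma nodes_pos: "0 < nodes t"
  by (induction t) auto

lemma esize_nat: "esize (n::nat) = 2 * n + 1"
  by (induction n) auto

lemma esize_bool: "esize (b::bool) \<le> 3"
  by (cases b) (auto simp: enc_bool_def encode_bool_def)

lemma esize_list: "esize xs = 1 + (\<Sum>x\<leftarrow>xs. 1 + esize x)"
  by (induction xs) auto

lemma length_le_esize: "length xs \<le> esize xs"
  by (induction xs) auto

lemma esize_append_le: "esize ys \<le> esize (xs @ ys)" "esize xs \<le> esize (xs @ ys)"
  by (simp_all add: esize_list)

lemma esize_rev: "esize (rev xs) = esize xs"
  by (simp add: esize_list rev_map[symmetric])

lemma esize_list_le:
  assumes "\<And>x. x \<in> set xs \<Longrightarrow> esize x \<le> K"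
  shows "esize xs \<le> 1 + length xs * (1 + K)"
  using assms
proof (induction xs)
  case (Cons y ys)
  have "esize y \<le> K" "esize ys \<le> 1 + length ys * (1 + K)"
    using Cons by simp_all
  then show ?case by simp
qed simp

lemma esize_mem_le: "x \<in> set xs \<Longrightarrow> esize x \<le> esize xs"
  by (induction xs) auto

text \<open>A single exponent suffices: every tree has a node, so the base is at least 2, and
  constants, sums and products can all be absorbed into \<open>c\<close>.\<close>

definition poly_bounded :: "('a::enc \<Rightarrow> nat) \<Rightarrow> bool" where
  "poly_bounded s \<longleftrightarrow> (\<exists>c. \<forall>x. s x \<le> (esize x + 1) ^ c)"

lemma poly_bounded_mono: "poly_bounded s \<Longrightarrow> (\<And>x. r x \<le> s x) \<Longrightarrow> poly_bounded r"
  unfolding poly_bounded_def by (meson le_trans)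

lemma poly_bounded_const: "poly_bounded (\<lambda>x. c)"
proof -
  have "c \<le> (esize x + 1) ^ c" for x :: 'a
  proof -
    have "c \<le> 2 ^ c" by (simp add: less_imp_le)
    also have "(2::nat) ^ c \<le> (esize x + 1) ^ c"
      using nodes_pos[of "enc x"] by (intro power_mono) auto
    finally show ?thesis .
  qed
  then show ?thesis unfolding poly_bounded_def by blast
qed

lemma poly_bounded_esize_self: "poly_bounded esize"
  unfolding poly_bounded_def by (rule exI[of _ 1]) auto

lemma poly_bounded_mult:
  assumes "poly_bounded r" "poly_bounded s"
  shows "poly_bounded (\<lambda>x. r x * s x)"
proof -
  from assms obtain a b where "\<And>x. r x \<le> (esize x + 1) ^ a" "\<And>x. s x \<le> (esize x + 1) ^ b"
    unfolding poly_bounded_def by blast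
  then have "r x * s x \<le> (esize x + 1) ^ (a + b)" for x
    by (simp add: power_add mult_mono)
  then show ?thesis unfolding poly_bounded_def by blast
qed

lemma poly_bounded_add:
  assumes "poly_bounded r" "poly_bounded s"
  shows "poly_bounded (\<lambda>x. r x + s x)"
proof -
  have "r x + s x \<le> (r x + 1) * (s x + 1)" for x
    by simp
  moreover have "poly_bounded (\<lambda>x. r x + 1)" if r: "poly_bounded r" for r :: "'a \<Rightarrow> nat"
  proof -
    from r obtain a where a: "\<And>x. r x \<le> (esize x + 1) ^ a"
      unfolding poly_bounded_def by blast
    have "r x + 1 \<le> (esize x + 1) ^ Suc a" for x
    proof -
      have "r x + 1 \<le> 2 * (esize x + 1) ^ a"
        using a[of x] one_le_power[of "esize x + 1" a] by linarith
      also have "\<dots> \<le> (esize x + 1) * (esize x + 1) ^ a"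
        using nodes_pos[of "enc x"] by (intro mult_right_mono) auto
      finally show ?thesis by simp
    qed
    then show ?thesis unfolding poly_bounded_def by blast
  qed
  ultimately show ?thesis
    using poly_bounded_mono[OF poly_bounded_mult[of "\<lambda>x. r x + 1" "\<lambda>x. s x + 1"], of "\<lambda>x. r x + s x"] assms by blast
qed

lemma poly_bounded_power: "poly_bounded s \<Longrightarrow> poly_bounded (\<lambda>x. s x ^ c)"
  by (induction c) (auto intro: poly_bounded_const poly_bounded_mult)

text \<open>The type class fixes one tree per value. Computability thereby becomes a predicate on
  ordinary HOL functions, and introduction rules can follow their syntax.\<close>

definition polytime :: "('a::enc \<Rightarrow> 'b::enc) \<Rightarrow> bool" where
  "polytime f \<longleftrightarrow> (\<exists>p T. poly_bounded T \<and> (\<forall>x. run_le p (enc x) (T x) (enc (f x))))"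

lemma polytimeI: "poly_bounded T \<Longrightarrow> (\<And>x. run_le p (enc x) (T x) (enc (f x))) \<Longrightarrow> polytime f"
  unfolding polytime_def by blast

lemma polytimeE:
  assumes "polytime f"
  obtains T p where "poly_bounded T" "\<And>x. run_le p (enc x) (T x) (enc (f x))"
  using assms unfolding polytime_def by blast

text \<open>Producing a value costs its number of nodes, so the running time also bounds the output.
  This is what makes polynomial bounds compose.\<close>

lemma poly_bounded_esize: "polytime f \<Longrightarrow> poly_bounded (\<lambda>x. esize (f x))"
  by (erule polytimeE) (meson nodes_le_run_le poly_bounded_mono)

lemma poly_bounded_comp:
  assumes "poly_bounded s" "polytime f"
  shows "poly_bounded (\<lambda>x. s (f x))"
proof -
  from assms(1) obtain c where "\<And>x. s x \<le> (esize x + 1) ^ c" unfolding poly_bounded_def by blast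
  moreover have "poly_bounded (\<lambda>x. (esize (f x) + 1) ^ c)"
    by (intro poly_bounded_power poly_bounded_add poly_bounded_const poly_bounded_esize assms)
  ultimately show ?thesis using poly_bounded_mono by meson
qed

lemma polytime_comp:
  assumes "polytime f" "polytime g"
  shows "polytime (\<lambda>x. g (f x))"
proof -
  obtain S p where p: "poly_bounded S" "\<And>x. run_le p (enc x) (S x) (enc (f x))"
    using assms(1) by (rule polytimeE) (rule that)
  obtain T q where q: "poly_bounded T" "\<And>x. run_le q (enc x) (T x) (enc (g x))"
    using assms(2) by (rule polytimeE) (rule that)
  show ?thesis
    by (rule polytimeI[where p = "Seq p q" and T = "\<lambda>x. S x + T (f x)"])
      (auto intro!: poly_bounded_add poly_bounded_comp[OF q(1) assms(1)] p q run_le_Seq)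
qed

named_theorems polytime_intros

lemma polytime_id [polytime_intros]: "polytime (\<lambda>x. x)"
  by (rule polytimeI[where p = Id and T = esize]) (auto intro: poly_bounded_esize_self run_le_Id)

lemma polytime_const [polytime_intros]: "polytime (\<lambda>x. c)"
proof -
  have "\<exists>p T. \<forall>x. run_le p x T t" for t
  proof (induction t)
    case Leaf
    then show ?case using run_le_Empty by blast
  next
    case (Node a b)
    then show ?case using run_le_Fork by meson
  qed
  then obtain T p where "\<And>x. run_le p x T (enc c)" by blast
  then show ?thesis by (intro polytimeI[where p = p and T = "\<lambda>_. T"] poly_bounded_const)
qed

lemma polytime_Pair [polytime_intros]:
  assumes "polytime f" "polytime g"
  shows "polytime (\<lambda>x. (f x, g x))"
proof -
  obtain S p where p: "poly_bounded S" "\<And>x. run_le p (enc x) (S x) (enc (f x))"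
    using assms(1) by (rule polytimeE) (rule that)
  obtain T q where q: "poly_bounded T" "\<And>x. run_le q (enc x) (T x) (enc (g x))"
    using assms(2) by (rule polytimeE) (rule that)
  show ?thesis
    by (rule polytimeI[where p = "Fork p q" and T = "\<lambda>x. 1 + S x + T x"])
      (auto simp only: enc_Pair intro!: poly_bounded_add poly_bounded_const p q run_le_Fork)
qed

lemma polytime_fst [polytime_intros]: "polytime f \<Longrightarrow> polytime (\<lambda>x. fst (f x))"
proof (erule polytime_comp)
  show "polytime (fst :: 'b \<times> 'c \<Rightarrow> 'b)"
  proof (rule polytimeI[where p = Lft and T = esize])
    show "run_le Lft (enc p) (esize p) (enc (fst p))" for p :: "'b \<times> 'c"
      by (cases p) (auto intro: run_le_mono[OF run_le_Lft])
  qed (rule poly_bounded_esize_self)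
qed

lemma polytime_snd [polytime_intros]: "polytime f \<Longrightarrow> polytime (\<lambda>x. snd (f x))"
proof (erule polytime_comp)
  show "polytime (snd :: 'b \<times> 'c \<Rightarrow> 'c)"
  proof (rule polytimeI[where p = Rgt and T = esize])
    show "run_le Rgt (enc p) (esize p) (enc (snd p))" for p :: "'b \<times> 'c"
      by (cases p) (auto intro: run_le_mono[OF run_le_Rgt])
  qed (rule poly_bounded_esize_self)
qed

text \<open>The then-branch has to behave only where the test succeeds. This admits programs that
  are wrong or diverge elsewhere: taking the head of a list, and above all the given approximation
  algorithm. Any tree other than \<open>Leaf\<close> counts as true, so lists and numbers can be
  tested directly.\<close>

lemma polytime_If_partial:
  fixes d :: "'a::enc \<Rightarrow> 'c::enc"
  assumes d: "polytime d" "\<And>x. b x \<longleftrightarrow> enc (d x) \<noteq> Leaf" and g: "polytime g"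
    and f: "poly_bounded S" "\<And>x. b x \<Longrightarrow> run_le p (enc x) (S x) (enc (f x))"
  shows "polytime (\<lambda>x. if b x then f x else g x)"
proof -
  obtain R r where r: "poly_bounded R" "\<And>x. run_le r (enc x) (R x) (enc (d x))"
    using d(1) by (rule polytimeE) (rule that)
  obtain T q where q: "poly_bounded T" "\<And>x. run_le q (enc x) (T x) (enc (g x))"
    using g by (rule polytimeE) (rule that)
  show ?thesis
  proof (rule polytimeI)
    show "poly_bounded (\<lambda>x. R x + (S x + T x))"
      by (intro poly_bounded_add r q f)
    show "run_le (Cond r p q) (enc x) (R x + (S x + T x)) (enc (if b x then f x else g x))" for x
    proof (cases "b x")
      case True
      then have "run_le (Cond r p q) (enc x) (R x + S x) (enc (f x))"
        using d(2) by (intro run_le_Cond_True[OF r(2) _ f(2)]) simp_all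
      then have "run_le (Cond r p q) (enc x) (R x + (S x + T x)) (enc (f x))"
        by (rule run_le_mono) simp
      then show ?thesis
        using True by simp
    next
      case False
      then have "enc (d x) = Leaf"
        using d(2) by blast
      then have "run_le (Cond r p q) (enc x) (R x + T x) (enc (g x))"
        using r(2)[of x] by (intro run_le_Cond_False[OF _ q(2)]) simp
      then have "run_le (Cond r p q) (enc x) (R x + (S x + T x)) (enc (g x))"
        by (rule run_le_mono) simp
      then show ?thesis
        using False by simp
    qed
  qed
qed

lemma polytime_If:
  fixes d :: "'a::enc \<Rightarrow> 'c::enc"
  assumes "polytime d" "\<And>x. b x \<longleftrightarrow> enc (d x) \<noteq> Leaf" "polytime f" "polytime g"
  shows "polytime (\<lambda>x. if b x then f x else g x)"
proof -
  obtain S p where "poly_bounded S" "\<And>x. run_le p (enc x) (S x) (enc (f x))"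
    using assms(3) by (rule polytimeE) (rule that)
  with assms(1,2,4) show ?thesis
    by (intro polytime_If_partial)
qed

lemma polytime_if [polytime_intros]:
  assumes "polytime b" "polytime f" "polytime g"
  shows "polytime (\<lambda>x. if b x then f x else g x)"
proof (rule polytime_If[OF assms(1) _ assms(2,3)])
  show "b x \<longleftrightarrow> enc (b x) \<noteq> Leaf" for x
    by simp
qed

lemma polytime_not [polytime_intros]: "polytime b \<Longrightarrow> polytime (\<lambda>x. \<not> b x)"
proof -
  assume "polytime b"
  then have "polytime (\<lambda>x. if b x then False else True)"
    by (rule polytime_if[OF _ polytime_const polytime_const])
  also have "(\<lambda>x. if b x then False else True) = (\<lambda>x. \<not> b x)"
    by auto
  finally show ?thesis .
qed

lemma polytime_conj [polytime_intros]: "polytime b \<Longrightarrow> polytime c \<Longrightarrow> polytime (\<lambda>x. b x \<and> c x)"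
proof -
  assume "polytime b" "polytime c"
  then have "polytime (\<lambda>x. if b x then c x else False)"
    by (rule polytime_if[OF _ _ polytime_const])
  also have "(\<lambda>x. if b x then c x else False) = (\<lambda>x. b x \<and> c x)"
    by auto
  finally show ?thesis .
qed

lemma polytime_disj [polytime_intros]: "polytime b \<Longrightarrow> polytime c \<Longrightarrow> polytime (\<lambda>x. b x \<or> c x)"
  using polytime_not[OF polytime_conj[OF polytime_not polytime_not], of b c] by simp

lemma polytime_Cons [polytime_intros]:
  assumes "polytime f" "polytime g"
  shows "polytime (\<lambda>x. f x # g x)"
proof -
  obtain T p where "poly_bounded T" "\<And>x. run_le p (enc x) (T x) (enc (f x, g x))"
    using polytime_Pair[OF assms] by (rule polytimeE) (rule that)
  then show ?thesis by (intro polytimeI[of T p]) auto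
qed

lemma polytime_Suc [polytime_intros]:
  assumes "polytime f"
  shows "polytime (\<lambda>x. Suc (f x))"
proof -
  obtain T p where "poly_bounded T" "\<And>x. run_le p (enc x) (T x) (enc ((), f x))"
    using polytime_Pair[OF polytime_const[of "()"] assms] by (rule polytimeE) (rule that)
  then show ?thesis by (intro polytimeI[of T p]) (auto simp: enc_unit_def)
qed

lemma polytime_tl [polytime_intros]: "polytime f \<Longrightarrow> polytime (\<lambda>x. tl (f x))"
proof (erule polytime_comp)
  have "run Rgt (enc xs) (esize (tl xs)) (enc (tl xs))" for xs :: "'b list"
    using run.Rgt[of "enc xs"] by (cases xs) auto
  moreover have "esize (tl xs) \<le> esize xs" for xs :: "'b list"
    by (cases xs) auto
  ultimately show "polytime (tl :: 'b list \<Rightarrow> _)"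
    by (intro polytimeI[where p = Rgt and T = esize] poly_bounded_esize_self) (auto simp: run_le_def)
qed

lemma polytime_diff_1 [polytime_intros]:
  assumes "polytime f"
  shows "polytime (\<lambda>x. f x - (1::nat))"
proof -
  have "run Rgt (enc n) (esize (n - 1)) (enc (n - 1))" for n :: nat
    using run.Rgt[of "enc n"] by (cases n) auto
  moreover have "esize (n - 1) \<le> esize n" for n :: nat
    by (simp add: esize_nat)
  ultimately have "polytime (\<lambda>n::nat. n - 1)"
    by (intro polytimeI[where p = Rgt and T = esize] poly_bounded_esize_self) (unfold run_le_def, blast)
  with assms show ?thesis
    by (rule polytime_comp)
qed

text \<open>\<open>Lft\<close> returns \<open>Leaf\<close> on the empty list, which need not be the
  code of \<open>hd []\<close>; hence the guard with an explicit default.\<close>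

lemma polytime_hd_default:
  assumes f: "polytime f" and g: "polytime g"
  shows "polytime (\<lambda>x. if f x \<noteq> [] then hd (f x) else g x)"
proof -
  obtain S p where p: "poly_bounded S" "\<And>x. run_le p (enc x) (S x) (enc (f x))"
    using f by (rule polytimeE) (rule that)
  show ?thesis
  proof (rule polytime_If_partial[OF f _ g])
    show "f x \<noteq> [] \<longleftrightarrow> enc (f x) \<noteq> Leaf" for x
      by (cases "f x") auto
    show "poly_bounded (\<lambda>x. S x + esize (f x))"
      by (intro poly_bounded_add p poly_bounded_esize f)
    fix x
    assume "f x \<noteq> []"
    then obtain y ys where f_x: "f x = y # ys"
      by (cases "f x") auto
    have "run_le (Seq p Lft) (enc x) (S x + esize y) (enc y)"
      using p(2)[of x] by (rule run_le_Seq) (simp add: f_x run_le_Lft)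
    then have "run_le (Seq p Lft) (enc x) (S x + esize (f x)) (enc y)"
      by (rule run_le_mono) (simp add: f_x)
    then show "run_le (Seq p Lft) (enc x) (S x + esize (f x)) (enc (hd (f x)))"
      by (simp only: f_x list.sel)
  qed
qed

section \<open>Iteration\<close>

text \<open>The loop state is a triple: the fixed parameter, the accumulator, and the rest of the
  list, which is also the loop test. Each round copies its parts into an argument for
  \<open>p\<close> and drops the head. With \<open>S\<close> bounding every state that occurs, a
  round costs a linear term in \<open>S\<close> plus one call of \<open>p\<close>.\<close>

lemma run_le_foldl:
  assumes f: "\<And>x a y. run_le p (enc (x, a, y)) ((esize (x, a, y) + 1) ^ c) (enc (f x a y))"
    and S: "\<And>ys zs. xs = ys @ zs \<Longrightarrow> esize (x, foldl (f x) a ys, zs) \<le> S"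
  shows "run_le (While (Seq Rgt Rgt) (Fork Lft (Fork
      (Seq (Fork Lft (Fork (Seq Rgt Lft) (Seq Rgt (Seq Rgt Lft)))) p) (Seq Rgt (Seq Rgt Rgt)))))
    (enc (x, a, xs)) ((length xs + 1) * (20 * S + 20 + (S + 1) ^ c)) (enc (x, foldl (f x) a xs, ([] :: 'b::enc list)))"
    (is "run_le (While ?c ?b) _ (_ * ?K) _")
  using S
proof (induction xs arbitrary: a)
  case Nil
  have "run_le ?c (enc (x, a, [] :: 'b list)) (nodes (Node (enc a) Leaf) + 1) Leaf"
    using run_le_Seq[OF run_le_Rgt run_le_Rgt, of "enc x" "enc a" Leaf] by simp
  from run_le_While_False[OF this, of ?b] show ?case
    using Nil[of "[]" "[]"] by (auto elim!: run_le_mono)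
next
  case (Cons y ys)
  have le: "esize (x, a, y # ys) \<le> S"
    using Cons.prems[of "[]" "y # ys"] by simp
  have c: "run_le ?c (enc (x, a, y # ys)) (2 * S) (enc (y # ys))"
    using run_le_Seq[OF run_le_Rgt run_le_Rgt, of "enc x" "enc a" "enc (y # ys)"] le
    by (auto elim!: run_le_mono)
  have i: "run_le (Fork Lft (Fork (Seq Rgt Lft) (Seq Rgt (Seq Rgt Lft)))) (enc (x, a, y # ys))
      (1 + nodes (enc x) + (1 + (nodes (enc (a, y # ys)) + nodes (enc a))
         + (nodes (enc (a, y # ys)) + (nodes (enc (y # ys)) + nodes (enc y))))) (enc (x, a, y))"
    unfolding enc_Pair enc_Cons
    by (intro run_le_Fork run_le_Seq run_le_Lft) (rule run_le_Rgt run_le_Lft)+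
  have f': "run_le p (enc (x, a, y)) ((S + 1) ^ c) (enc (f x a y))"
    using le by (intro run_le_mono[OF f] power_mono) auto
  have t: "run_le (Seq Rgt (Seq Rgt Rgt)) (enc (x, a, y # ys))
      (nodes (enc (a, y # ys)) + (nodes (enc (y # ys)) + nodes (enc ys))) (enc ys)"
    unfolding enc_Pair enc_Cons
    by (intro run_le_Seq) (rule run_le_Rgt)+
  have b: "run_le ?b (enc (x, a, y # ys)) (10 * S + 10 + (S + 1) ^ c) (enc (x, f x a y, ys))"
  proof -
    have "run_le Lft (enc (x, a, y # ys)) (nodes (enc x)) (enc x)"
      unfolding enc_Pair by (rule run_le_Lft)
    from run_le_Fork[OF this run_le_Fork[OF run_le_Seq[OF i f'] t]] le show ?thesis
      unfolding enc_Pair[symmetric] by (auto elim!: run_le_mono)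
  qed
  have w: "run_le (While ?c ?b) (enc (x, f x a y, ys)) ((length ys + 1) * ?K)
      (enc (x, foldl (f x) (f x a y) ys, [] :: 'b list))"
  proof (rule Cons.IH)
    fix us vs
    assume "ys = us @ vs"
    then show "esize (x, foldl (f x) (f x a y) us, vs) \<le> S"
      using Cons.prems[of "y # us" vs] by simp
  qed
  have "run_le (While ?c ?b) (enc (x, a, y # ys))
      (2 * S + (10 * S + 10 + (S + 1) ^ c) + (length ys + 1) * ?K)
      (enc (x, foldl (f x) a (y # ys), [] :: 'b list))"
    using run_le_While_True[OF c _ b w] by simp
  moreover have "2 * S + (10 * S + 10 + (S + 1) ^ c) + (length ys + 1) * ?K
      \<le> (length (y # ys) + 1) * ?K"
  proof -
    have "2 * S + (10 * S + 10 + (S + 1) ^ c) \<le> ?K"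
      by simp
    then have "2 * S + (10 * S + 10 + (S + 1) ^ c) + (length ys + 1) * ?K \<le> ?K + (length ys + 1) * ?K"
      by (rule add_right_mono)
    also have "\<dots> = (length (y # ys) + 1) * ?K"
      by (simp only: list.size(4) mult_Suc[symmetric] add_Suc add_0 Suc_eq_plus1)
    finally show ?thesis .
  qed
  ultimately show ?case
    by (rule run_le_mono)
qed

text \<open>A polynomial-time step does not make a loop polynomial: a step that doubles its
  accumulator grows it exponentially. Hence the bound \<open>B\<close> on the accumulator after
  every prefix of the list; each later use has to supply one.\<close>

lemma polytime_foldl:
  fixes f :: "'a::enc \<Rightarrow> 'c::enc \<Rightarrow> 'b::enc \<Rightarrow> 'c"
  assumes g: "polytime g" and h: "polytime h"
    and f: "polytime (\<lambda>p. f (fst p) (fst (snd p)) (snd (snd p)))"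
    and B: "poly_bounded B" "\<And>x ys zs. h x = ys @ zs \<Longrightarrow> esize (foldl (f x) (g x) ys) \<le> B x"
  shows "polytime (\<lambda>x. foldl (f x) (g x) (h x))"
proof -
  obtain T p where p: "poly_bounded T"
      "\<And>q. run_le p (enc q) (T q) (enc (f (fst q) (fst (snd q)) (snd (snd q))))"
    using f by (rule polytimeE) (rule that)
  obtain c where c: "\<And>q. T q \<le> (esize q + 1) ^ c"
    using p(1) unfolding poly_bounded_def by blast
  have p': "run_le p (enc (x, a, y)) ((esize (x, a, y) + 1) ^ c) (enc (f x a y))" for x a y
    using run_le_mono[OF p(2) c, of "(x, a, y)"] by simp
  obtain R r where r: "poly_bounded R" "\<And>x. run_le r (enc x) (R x) (enc (x, g x, h x))"
    using polytime_Pair[OF polytime_id polytime_Pair[OF g h]] by (rule polytimeE) (rule that)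
  define S where "S x = 2 + esize x + B x + esize (h x)" for x
  have S: "poly_bounded S"
    unfolding S_def by (intro poly_bounded_add poly_bounded_const poly_bounded_esize_self B poly_bounded_esize h)
  define K where "K x = 20 * S x + 20 + (S x + 1) ^ c" for x
  have K: "poly_bounded K"
    unfolding K_def by (intro poly_bounded_add poly_bounded_mult poly_bounded_power poly_bounded_const S)
  define loop where "loop = While (Seq Rgt Rgt) (Fork Lft (Fork
      (Seq (Fork Lft (Fork (Seq Rgt Lft) (Seq Rgt (Seq Rgt Lft)))) p) (Seq Rgt (Seq Rgt Rgt))))"
  show ?thesis
  proof (rule polytimeI)
    show "poly_bounded (\<lambda>x. R x + ((esize (h x) + 1) * K x + (S x + S x)))"
      by (intro poly_bounded_add poly_bounded_mult poly_bounded_const K r S poly_bounded_esize h)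
    fix x
    have "run_le loop (enc (x, g x, h x)) ((length (h x) + 1) * K x)
        (enc (x, foldl (f x) (g x) (h x), [] :: 'b list))"
      unfolding loop_def K_def
    proof (rule run_le_foldl[OF p'])
      fix ys zs
      assume "h x = ys @ zs"
      then show "esize (x, foldl (f x) (g x) ys, zs) \<le> S x"
        using B(2)[of x ys zs] esize_append_le(1)[of zs ys] unfolding S_def by simp
    qed
    then have l: "run_le loop (enc (x, g x, h x)) ((esize (h x) + 1) * K x)
        (enc (x, foldl (f x) (g x) (h x), [] :: 'b list))"
      using length_le_esize[of "h x"] by (auto elim!: run_le_mono intro!: mult_right_mono)
    have S': "esize (foldl (f x) (g x) (h x)) + 2 \<le> S x"
      using B(2)[of x "h x" "[]"] unfolding S_def by simp
    have e: "run_le (Seq Rgt Lft) (enc (x, foldl (f x) (g x) (h x), [] :: 'b list)) (S x + S x)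
        (enc (foldl (f x) (g x) (h x)))"
      unfolding enc_Pair
      by (rule run_le_Seq[OF run_le_mono[OF run_le_Rgt] run_le_mono[OF run_le_Lft]])
        (use S' in auto)
    show "run_le (Seq r (Seq loop (Seq Rgt Lft))) (enc x)
        (R x + ((esize (h x) + 1) * K x + (S x + S x))) (enc (foldl (f x) (g x) (h x)))"
      using run_le_Seq[OF r(2) run_le_Seq[OF l e]] .
  qed
qed

lemma polytime_units: "polytime f \<Longrightarrow> polytime (\<lambda>x. replicate (f x) ())"
proof (erule polytimeE)
  fix T p
  assume "poly_bounded T" "\<And>x. run_le p (enc x) (T x) (enc (f x))"
  then show ?thesis by (intro polytimeI[of T p]) (simp_all add: enc_nat_replicate)
qed

lemma polytime_length [polytime_intros]: "polytime f \<Longrightarrow> polytime (\<lambda>x. length (f x))"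
proof -
  assume f: "polytime f"
  have len: "foldl (\<lambda>a _. Suc a) n xs = n + length xs" for n and xs :: "'b list"
    by (induction xs arbitrary: n) auto
  have "polytime (\<lambda>x. foldl (\<lambda>a _. Suc a) 0 (f x))"
  proof (rule polytime_foldl[where B = "\<lambda>x. 2 * esize (f x) + 1"])
    fix x ys zs
    assume "f x = ys @ zs"
    then show "esize (foldl (\<lambda>a _. Suc a) 0 ys) \<le> 2 * esize (f x) + 1"
      using length_le_esize[of "f x"] by (simp add: len esize_nat)
  qed (rule polytime_intros f poly_bounded_add poly_bounded_mult poly_bounded_const poly_bounded_esize)+
  then show ?thesis by (simp add: len)
qed

lemma foldl_funpow: "foldl (\<lambda>a _. f a) a xs = (f ^^ length xs) a"
  by (induction xs arbitrary: a) (auto simp: funpow_swap1)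

lemma polytime_funpow:
  fixes f :: "'a::enc \<Rightarrow> 'c::enc \<Rightarrow> 'c"
  assumes g: "polytime g" and n: "polytime n"
    and f: "polytime (\<lambda>p. f (fst p) (snd p))"
    and B: "poly_bounded B" "\<And>x i. i \<le> n x \<Longrightarrow> esize ((f x ^^ i) (g x)) \<le> B x"
  shows "polytime (\<lambda>x. (f x ^^ n x) (g x))"
proof -
  have "polytime (\<lambda>x. foldl (\<lambda>a _. f x a) (g x) (replicate (n x) ()))"
  proof (rule polytime_foldl[OF g polytime_units[OF n] _ B(1)])
    have "polytime (\<lambda>q :: 'a \<times> 'c \<times> unit. (fst q, fst (snd q)))"
      by (intro polytime_intros)
    from polytime_comp[OF this f] show "polytime (\<lambda>q :: 'a \<times> 'c \<times> unit. f (fst q) (fst (snd q)))"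
      by simp
    fix x ys zs
    assume "replicate (n x) () = ys @ zs"
    from arg_cong[OF this, of length] show "esize (foldl (\<lambda>a _. f x a) (g x) ys) \<le> B x"
      by (auto simp: foldl_funpow intro: B)
  qed
  then show ?thesis by (simp add: foldl_funpow)
qed

lemma polytime_nonempty: "polytime f \<Longrightarrow> polytime (\<lambda>x. f x \<noteq> [])"
proof -
  assume "polytime f"
  then have "polytime (\<lambda>x. if f x \<noteq> [] then True else False)"
    by (rule polytime_If[OF _ _ polytime_const polytime_const]) (metis enc_Cons enc_Nil list.exhaust tree.distinct(1))
  also have "(\<lambda>x. if f x \<noteq> [] then True else False) = (\<lambda>x. f x \<noteq> [])"
    by auto
  finally show ?thesis .
qed

lemma polytime_eq_0 [polytime_intros]:
  assumes "polytime f"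
  shows "polytime (\<lambda>x. f x = (0::nat))"
proof -
  have "f x \<noteq> 0 \<longleftrightarrow> enc (f x) \<noteq> Leaf" for x
    by (cases "f x") auto
  then have "polytime (\<lambda>x. if f x \<noteq> 0 then False else True)"
    by (intro polytime_If[OF assms _ polytime_const polytime_const]) blast
  also have "(\<lambda>x. if f x \<noteq> 0 then False else True) = (\<lambda>x. f x = 0)"
    by auto
  finally show ?thesis .
qed

section \<open>Arithmetic on unary numbers\<close>

lemma polytime_add [polytime_intros]:
  assumes f: "polytime f" and g: "polytime g"
  shows "polytime (\<lambda>x. f x + (g x :: nat))"
proof -
  have eq: "(Suc ^^ n) m = m + n" for n m
    by (induction n) auto
  have "polytime (\<lambda>x. (Suc ^^ g x) (f x))"
  proof (rule polytime_funpow[where B = "\<lambda>x. esize (f x) + esize (g x)"])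
    show "i \<le> g x \<Longrightarrow> esize ((Suc ^^ i) (f x)) \<le> esize (f x) + esize (g x)" for x i
      by (simp add: eq esize_nat)
  qed (rule f g polytime_intros poly_bounded_add poly_bounded_esize)+
  then show ?thesis unfolding eq .
qed

lemma polytime_mult [polytime_intros]:
  assumes f: "polytime f" and g: "polytime g"
  shows "polytime (\<lambda>x. f x * (g x :: nat))"
proof -
  have eq: "((\<lambda>z. z + m) ^^ n) 0 = m * n" for n m :: nat
    by (induction n) auto
  have "polytime (\<lambda>x. ((\<lambda>z. z + f x) ^^ g x) 0)"
  proof (rule polytime_funpow[where B = "\<lambda>x. 2 * (esize (f x) * esize (g x)) + 1"])
    fix x i
    assume "i \<le> g x"
    then have "f x * i \<le> esize (f x) * esize (g x)"
      by (intro mult_le_mono) (simp_all add: esize_nat)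
    then show "esize (((\<lambda>z. z + f x) ^^ i) 0) \<le> 2 * (esize (f x) * esize (g x)) + 1"
      unfolding eq by (simp only: esize_nat)
  qed (rule f g polytime_intros polytime_comp[OF _ f] poly_bounded_add poly_bounded_mult poly_bounded_const poly_bounded_esize)+
  then show ?thesis by (simp add: eq)
qed

lemma polytime_diff [polytime_intros]:
  assumes f: "polytime f" and g: "polytime g"
  shows "polytime (\<lambda>x. f x - (g x :: nat))"
proof -
  have eq: "((\<lambda>z. z - 1) ^^ n) m = m - n" for n m :: nat
    by (induction n) auto
  have "polytime (\<lambda>x. ((\<lambda>z. z - 1) ^^ g x) (f x))"
  proof (rule polytime_funpow[where B = "\<lambda>x. esize (f x)"])
    show "i \<le> g x \<Longrightarrow> esize (((\<lambda>z. z - 1) ^^ i) (f x)) \<le> esize (f x)" for x i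
      unfolding eq by (simp add: esize_nat)
  qed (rule f g polytime_diff_1 polytime_snd polytime_id poly_bounded_esize)+
  then show ?thesis unfolding eq .
qed

lemma polytime_le [polytime_intros]:
  assumes "polytime f" "polytime g"
  shows "polytime (\<lambda>x. f x \<le> (g x :: nat))"
proof -
  have "polytime (\<lambda>x. f x - g x = 0)"
    by (intro polytime_intros assms)
  then show ?thesis by simp
qed

lemma polytime_less [polytime_intros]:
  assumes "polytime f" "polytime g"
  shows "polytime (\<lambda>x. f x < (g x :: nat))"
proof -
  have "polytime (\<lambda>x. \<not> g x \<le> f x)"
    by (intro polytime_intros assms)
  then show ?thesis by (simp add: not_le)
qed

lemma polytime_eq_nat [polytime_intros]:
  assumes "polytime f" "polytime g"
  shows "polytime (\<lambda>x. f x = (g x :: nat))"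
proof -
  have "polytime (\<lambda>x. f x \<le> g x \<and> g x \<le> f x)"
    by (intro polytime_intros assms)
  then show ?thesis by (simp add: eq_iff)
qed

section \<open>Lists, ranges and indexing\<close>

lemma polytime_rev [polytime_intros]:
  assumes f: "polytime f"
  shows "polytime (\<lambda>x. rev (f x))"
proof -
  have eq: "foldl (\<lambda>a y. y # a) bs xs = rev xs @ bs" for xs bs :: "'b list"
    by (induction xs arbitrary: bs) auto
  have "polytime (\<lambda>x. foldl (\<lambda>a y. y # a) [] (f x))"
  proof (rule polytime_foldl[where B = "\<lambda>x. esize (f x)"])
    fix x ys zs
    assume "f x = ys @ zs"
    then show "esize (foldl (\<lambda>a y. y # a) [] ys) \<le> esize (f x)"
      using esize_append_le(2)[of ys zs] by (simp add: eq esize_rev)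
  qed (rule f polytime_const polytime_Cons polytime_fst polytime_snd polytime_id poly_bounded_esize)+
  then show ?thesis by (simp add: eq)
qed

lemma polytime_append [polytime_intros]:
  assumes f: "polytime f" and g: "polytime g"
  shows "polytime (\<lambda>x. f x @ g x)"
proof -
  have eq: "foldl (\<lambda>a y. y # a) bs xs = rev xs @ bs" for xs bs :: "'b list"
    by (induction xs arbitrary: bs) auto
  have "polytime (\<lambda>x. foldl (\<lambda>a y. y # a) (g x) (rev (f x)))"
  proof (rule polytime_foldl[where B = "\<lambda>x. esize (f x) + esize (g x)"])
    fix x ys zs
    assume "rev (f x) = ys @ zs"
    then have "f x = rev zs @ rev ys"
      by (metis rev_append rev_rev_ident)
    then show "esize (foldl (\<lambda>a y. y # a) (g x) ys) \<le> esize (f x) + esize (g x)"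
      by (simp add: eq esize_list)
  qed (rule f g polytime_rev polytime_Cons polytime_fst polytime_snd polytime_id poly_bounded_add poly_bounded_esize)+
  then show ?thesis by (simp add: eq)
qed

lemma polytime_map [polytime_intros]:
  fixes f :: "'a::enc \<Rightarrow> 'b::enc \<Rightarrow> 'c::enc"
  assumes f: "polytime (\<lambda>p. f (fst p) (snd p))" and g: "polytime g"
  shows "polytime (\<lambda>x. map (\<lambda>y. f x y) (g x))"
proof -
  obtain c where c: "\<And>p. esize (f (fst p) (snd p)) \<le> (esize p + 1) ^ c"
    using poly_bounded_esize[OF f] unfolding poly_bounded_def by blast
  have eq: "foldl (\<lambda>a y. f x y # a) bs ys = rev (map (f x) ys) @ bs" for x ys bs
    by (induction ys arbitrary: bs) auto
  have f': "polytime (\<lambda>q :: 'a \<times> 'c list \<times> 'b. f (fst q) (snd (snd q)))"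
  proof -
    have "polytime (\<lambda>q :: 'a \<times> 'c list \<times> 'b. (fst q, snd (snd q)))"
      by (intro polytime_intros)
    from polytime_comp[OF this f] show "polytime (\<lambda>q :: 'a \<times> 'c list \<times> 'b. f (fst q) (snd (snd q)))"
      by simp
  qed
  define K where "K x = (esize x + esize (g x) + 2) ^ c" for x
  have K: "poly_bounded K"
    unfolding K_def by (intro poly_bounded_power poly_bounded_add poly_bounded_const poly_bounded_esize_self poly_bounded_esize g)
  have "polytime (\<lambda>x. foldl (\<lambda>a y. f x y # a) [] (g x))"
  proof (rule polytime_foldl[where B = "\<lambda>x. 1 + esize (g x) * (1 + K x)"])
    fix x ys zs
    assume gx: "g x = ys @ zs"
    have "esize (f x y) \<le> K x" if "y \<in> set ys" for y
    proof -
      have "esize y \<le> esize (g x)"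
        using that gx by (intro esize_mem_le) auto
      then show ?thesis
        using c[of "(x, y)"] unfolding K_def
        by (simp add: order_trans power_mono)
    qed
    then have "esize (map (f x) ys) \<le> 1 + length (map (f x) ys) * (1 + K x)"
      by (intro esize_list_le) auto
    also have "\<dots> \<le> 1 + esize (g x) * (1 + K x)"
      using gx length_le_esize[of "g x"] by (intro add_left_mono mult_right_mono) auto
    finally show "esize (foldl (\<lambda>a y. f x y # a) [] ys) \<le> 1 + esize (g x) * (1 + K x)"
      by (simp add: eq esize_rev)
  next
    show "polytime (\<lambda>p :: 'a \<times> 'c list \<times> 'b. f (fst p) (snd (snd p)) # fst (snd p))"
      by (intro polytime_Cons f' polytime_fst polytime_snd polytime_id)
  qed (rule g polytime_const poly_bounded_add poly_bounded_mult poly_bounded_esize poly_bounded_const K)+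
  then have "polytime (\<lambda>x. rev (foldl (\<lambda>a y. f x y # a) [] (g x)))"
    by (rule polytime_rev)
  then show ?thesis by (simp add: eq rev_map)
qed

lemma polytime_concat [polytime_intros]:
  assumes f: "polytime f"
  shows "polytime (\<lambda>x. concat (f x))"
proof -
  have eq: "foldl (\<lambda>a ys. a @ ys) bs xss = bs @ concat xss" for xss :: "'b list list" and bs
    by (induction xss arbitrary: bs) auto
  have le: "esize (concat xss) \<le> esize xss" for xss :: "'b list list"
    by (induction xss) (auto simp: esize_list)
  have "polytime (\<lambda>x. foldl (\<lambda>a ys. a @ ys) [] (f x))"
  proof (rule polytime_foldl[where B = "\<lambda>x. esize (f x)"])
    fix x ys zs
    assume "f x = ys @ zs"
    then show "esize (foldl (\<lambda>a ys. a @ ys) [] ys) \<le> esize (f x)"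
      using esize_append_le(2)[of ys zs] le[of ys] by (simp add: eq)
  qed (rule f polytime_append polytime_const polytime_fst polytime_snd polytime_id poly_bounded_esize)+
  then show ?thesis by (simp add: eq)
qed

lemma polytime_filter [polytime_intros]:
  assumes P: "polytime (\<lambda>p. P (fst p) (snd p))" and g: "polytime g"
  shows "polytime (\<lambda>x. filter (\<lambda>y. P x y) (g x))"
proof -
  have eq: "concat (map (\<lambda>y. if Q y then [y] else []) ys) = filter Q ys" for Q :: "'b \<Rightarrow> bool" and ys
    by (induction ys) auto
  have "polytime (\<lambda>x. concat (map (\<lambda>y. if P x y then [y] else []) (g x)))"
    by (intro polytime_concat polytime_map g polytime_if P polytime_Cons polytime_const polytime_snd polytime_id)
  then show ?thesis unfolding eq .
qed

lemma polytime_bex [polytime_intros]: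
  assumes "polytime (\<lambda>p. P (fst p) (snd p))" "polytime g"
  shows "polytime (\<lambda>x. \<exists>y\<in>set (g x). P x y)"
proof -
  have "polytime (\<lambda>x. filter (\<lambda>y. P x y) (g x) \<noteq> [])"
    by (intro polytime_nonempty polytime_filter assms)
  then show ?thesis by (simp add: filter_empty_conv)
qed

lemma polytime_ball [polytime_intros]:
  assumes "polytime (\<lambda>p. P (fst p) (snd p))" "polytime g"
  shows "polytime (\<lambda>x. \<forall>y\<in>set (g x). P x y)"
proof -
  have "polytime (\<lambda>x. \<not> (\<exists>y\<in>set (g x). \<not> P x y))"
    by (intro polytime_bex polytime_not assms)
  then show ?thesis by simp
qed

lemma polytime_upt [polytime_intros]:
  assumes f: "polytime f"
  shows "polytime (\<lambda>x. [0..<f x])"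
proof -
  define s where "s = (\<lambda>p :: nat \<times> nat list. (fst p - 1, (fst p - 1) # snd p))"
  have eq: "(s ^^ i) (n, []) = (n - i, [n - i..<n])" if "i \<le> n" for i n
    using that
  proof (induction i)
    case (Suc i)
    then have "[n - Suc i..<n] = (n - Suc i) # [n - i..<n]"
      by (metis Suc_diff_Suc Suc_le_lessD diff_less_Suc upt_conv_Cons less_le_trans zero_less_Suc diff_less order_less_le_trans not_less_eq)
    with Suc show ?case by (simp add: s_def)
  qed simp
  have s: "polytime (\<lambda>p :: 'a \<times> nat \<times> nat list. s (snd p))"
    unfolding s_def by (intro polytime_intros)
  have "polytime (\<lambda>x. (s ^^ f x) (f x, []))"
  proof (rule polytime_funpow[where B = "\<lambda>x. 2 + esize (f x) + esize (f x) * (1 + esize (f x))"])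
    fix x i
    assume i: "i \<le> f x"
    have "esize [f x - i..<f x] \<le> 1 + length [f x - i..<f x] * (1 + esize (f x))"
      by (intro esize_list_le) (auto simp: esize_nat)
    also have "\<dots> \<le> 1 + esize (f x) * (1 + esize (f x))"
      using i by (intro add_left_mono mult_right_mono) (auto simp: esize_nat)
    finally show "esize ((s ^^ i) (f x, [])) \<le> 2 + esize (f x) + esize (f x) * (1 + esize (f x))"
      using i by (simp add: eq esize_nat)
  qed (rule f s polytime_Pair polytime_const poly_bounded_add poly_bounded_mult poly_bounded_const poly_bounded_esize)+
  then have "polytime (\<lambda>x. snd ((s ^^ f x) (f x, [])))"
    by (rule polytime_snd)
  then show ?thesis by (simp add: eq)
qed

text \<open>Counting up \<open>f x\<close> times and restarting at \<open>g x\<close>. For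
  \<open>g x = 0\<close> the restart never happens, in accordance with
  \<open>f x mod 0 = f x\<close>.\<close>

lemma polytime_mod [polytime_intros]:
  assumes f: "polytime f" and g: "polytime g"
  shows "polytime (\<lambda>x. f x mod (g x :: nat))"
proof -
  have eq: "((\<lambda>r. if Suc r = n then 0 else Suc r) ^^ i) 0 = i mod n" for n i :: nat
  proof (induction i)
    case (Suc i)
    then show ?case by (simp add: mod_Suc)
  qed simp
  have "polytime (\<lambda>x. ((\<lambda>r. if Suc r = g x then 0 else Suc r) ^^ f x) 0)"
  proof (rule polytime_funpow[where B = "\<lambda>x. esize (f x)"])
    show "i \<le> f x \<Longrightarrow> esize (((\<lambda>r. if Suc r = g x then 0 else Suc r) ^^ i) 0) \<le> esize (f x)" for x i
      unfolding eq by (simp add: esize_nat le_trans[OF mod_less_eq_dividend])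
  next
    show "polytime (\<lambda>p. if Suc (snd p) = g (fst p) then 0 else Suc (snd p))"
      by (intro polytime_intros polytime_comp[OF _ g])
  qed (rule f polytime_const poly_bounded_esize)+
  then show ?thesis unfolding eq .
qed

text \<open>For a nonzero divisor, the quotient is the number of its positive multiples up to the
  dividend, so a filter replaces repeated subtraction.\<close>

lemma polytime_div [polytime_intros]:
  assumes f: "polytime f" and g: "polytime g"
  shows "polytime (\<lambda>x. f x div (g x :: nat))"
proof -
  have eq: "(if n = 0 then 0 else length (filter (\<lambda>z. Suc z * n \<le> m) [0..<m])) = m div n" for m n :: nat
  proof (cases "n = 0")
    case False
    have "z < m div n \<longleftrightarrow> Suc z * n \<le> m" for z
      using False by (simp add: less_eq_div_iff_mult_less_eq flip: Suc_le_eq)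
    moreover have "m div n \<le> m"
      by simp
    ultimately have "{z. z < m \<and> Suc z * n \<le> m} = {..<m div n}"
      by (metis (no_types, lifting) Collect_cong lessThan_def order_less_le_trans)
    moreover have "length (filter (\<lambda>z. Suc z * n \<le> m) [0..<m]) = card {z. z < m \<and> Suc z * n \<le> m}"
      by (auto simp: length_filter_conv_card intro!: arg_cong[where f = card])
    ultimately show ?thesis
      using False by simp
  qed simp
  have "polytime (\<lambda>x. if g x = 0 then 0 else length (filter (\<lambda>z. Suc z * g x \<le> f x) [0..<f x]))"
    by (intro polytime_intros f g polytime_comp[OF _ f] polytime_comp[OF _ g])
  then show ?thesis unfolding eq .
qed

text \<open>Access with a default value has a specified result outside the list and can be computed
  by repeated \<open>tl\<close> without side conditions. The algorithm therefore never uses plain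
  indexing.\<close>

lemma polytime_nth_default [polytime_intros]:
  assumes d: "polytime d" and f: "polytime f" and g: "polytime g"
  shows "polytime (\<lambda>x. nth_default (d x) (f x) (g x))"
proof -
  have eq: "(if (tl ^^ i) xs \<noteq> [] then hd ((tl ^^ i) xs) else e) = nth_default e xs i" for e xs i
  proof -
    have "(tl ^^ i) xs = drop i xs"
      by (induction i) (auto simp: drop_Suc tl_drop)
    then show ?thesis by (auto simp: nth_default_def hd_drop_conv_nth)
  qed
  have "polytime (\<lambda>x. (tl ^^ g x) (f x))"
  proof (rule polytime_funpow[where B = "\<lambda>x. esize (f x)"])
    have "esize ((tl ^^ i) ys) \<le> esize ys" for i and ys :: "'b list"
    proof (induction i)
      case (Suc i)
      have "esize (tl zs) \<le> esize zs" for zs :: "'b list"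
        by (cases zs) auto
      then show ?case using Suc by (auto intro: le_trans)
    qed simp
    then show "esize ((tl ^^ i) (f x)) \<le> esize (f x)" for x i .
  qed (rule f g polytime_tl polytime_snd polytime_id poly_bounded_esize)+
  from polytime_hd_default[OF this d] show ?thesis
    unfolding eq .
qed

lemma polytime_product [polytime_intros]:
  assumes f: "polytime f" and g: "polytime g"
  shows "polytime (\<lambda>x. List.product (f x) (g x))"
proof -
  have eq: "concat (map (\<lambda>x. map (\<lambda>y. (x, y)) ys) xs) = List.product xs ys" for xs :: "'b list" and ys :: "'c list"
    by (induction xs) auto
  have "polytime (\<lambda>x. concat (map (\<lambda>a. map (\<lambda>b. (a, b)) (g x)) (f x)))"
    by (intro polytime_intros f polytime_comp[OF _ g])
  then show ?thesis unfolding eq .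
qed

section \<open>Expansion of the torus\<close>

definition unity_root :: "nat \<Rightarrow> int \<Rightarrow> complex" where
  "unity_root N k = cis (2 * pi * of_int k / of_nat N)"

lemma unity_root_add: "unity_root N (k + l) = unity_root N k * unity_root N l"
  by (simp add: unity_root_def cis_mult ring_distribs add_divide_distrib)

lemma unity_root_0 [simp]: "unity_root N 0 = 1"
  by (simp add: unity_root_def)

lemma cnj_unity_root: "cnj (unity_root N k) = unity_root N (- k)"
  by (simp add: unity_root_def cis_cnj)

lemma unity_root_multiple:
  assumes "0 < N"
  shows "unity_root N (int N * k) = 1"
proof -
  have "2 * pi * of_int (int N * k) / of_nat N = 2 * pi * of_int k"
    using assms by simp
  then show ?thesis
    by (simp add: unity_root_def cis_multiple_2pi)
qed

lemma unity_root_cong: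
  assumes "0 < N" "k mod int N = l mod int N"
  shows "unity_root N k = unity_root N l"
proof -
  have "k = l + int N * (k div int N - l div int N)"
    using assms(2) by (metis add_diff_cancel_left' add_diff_eq diff_add_cancel mult_div_mod_eq right_diff_distrib)
  then show ?thesis
    by (metis assms(1) mult.right_neutral unity_root_add unity_root_multiple)
qed

lemma unity_root_neq_1:
  assumes "d \<noteq> 0" "\<bar>d\<bar> < int N"
  shows "unity_root N d \<noteq> 1"
proof
  assume "unity_root N d = 1"
  then have "cos (2 * pi * of_int d / of_nat N) = 1"
    by (metis unity_root_def cis.simps(1) one_complex.simps(1))
  then obtain n :: int where "2 * pi * of_int d / of_nat N = of_int n * 2 * pi"
    by (auto simp: cos_one_2pi_int)
  then have "of_int d = of_int n * real N"
    using assms by (simp add: field_simps)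
  then have d: "d = n * int N"
    by (metis of_int_eq_iff of_int_mult of_int_of_nat_eq)
  then have "n \<noteq> 0" using assms by auto
  then have "int N \<le> \<bar>n\<bar> * int N"
    by (intro mult_le_cancel_right1[THEN iffD2]) auto
  then show False
    using assms d by (simp add: abs_mult)
qed

text \<open>Multiplying the sum by \<open>unity_root N d\<close> shifts its window by one, and the
  entering term equals the leaving one by periodicity. So the sum is annihilated by
  \<open>unity_root N d - 1\<close>, which is nonzero for nonzero \<open>d\<close>. The window
  starts anywhere because the frequencies are later centred at 0.\<close>

lemma sum_unity_root:
  assumes "\<bar>d\<bar> < int N"
  shows "(\<Sum>a\<in>{lo..<lo + int N}. unity_root N (a * d)) = (if d = 0 then of_nat N else 0)"
proof (cases "d = 0")
  case False
  let ?S = "\<Sum>a\<in>{lo..<lo + int N}. unity_root N (a * d)"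
  have N: "0 < N" using assms by auto
  have "unity_root N d * ?S = (\<Sum>a\<in>{lo..<lo + int N}. unity_root N ((a + 1) * d))"
    by (simp add: sum_distrib_left unity_root_add[symmetric] ring_distribs add.commute)
  also have "\<dots> = (\<Sum>a\<in>{lo + 1..<lo + int N + 1}. unity_root N (a * d))"
    by (rule sum.reindex_bij_witness[of _ "\<lambda>a. a - 1" "\<lambda>a. a + 1"]) auto
  also have "{lo + 1..<lo + int N + 1} = insert (lo + int N) ({lo..<lo + int N} - {lo})"
    using N by auto
  also have "(\<Sum>a\<in>\<dots>. unity_root N (a * d))
      = unity_root N ((lo + int N) * d) + (?S - unity_root N (lo * d))"
    using N by (simp add: sum_diff1)
  also have "unity_root N ((lo + int N) * d) = unity_root N (lo * d)"
    using N by (intro unity_root_cong) (auto simp: ring_distribs)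
  finally have "(unity_root N d - 1) * ?S = 0"
    by (simp add: ring_distribs)
  then show ?thesis
    using unity_root_neq_1[OF False assms] False by simp
qed simp

lemma parseval:
  fixes g :: "nat \<Rightarrow> complex"
  shows "(\<Sum>a\<in>{lo..<lo + int N}. (cmod (\<Sum>x<N. g x * unity_root N (a * int x)))\<^sup>2)
    = real N * (\<Sum>x<N. (cmod (g x))\<^sup>2)"
proof -
  have "(\<Sum>a\<in>{lo..<lo + int N}. complex_of_real ((cmod (\<Sum>x<N. g x * unity_root N (a * int x)))\<^sup>2))
      = (\<Sum>a\<in>{lo..<lo + int N}. \<Sum>x<N. \<Sum>y<N. g x * cnj (g y) * unity_root N (a * (int x - int y)))"
    by (simp add: complex_norm_square sum_product cnj_unity_root mult_ac unity_root_add[symmetric]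
        right_diff_distrib flip: of_real_power)
  also have "\<dots> = (\<Sum>x<N. \<Sum>y<N. g x * cnj (g y) * (\<Sum>a\<in>{lo..<lo + int N}. unity_root N (a * (int x - int y))))"
    by (subst sum.swap, rule sum.cong[OF refl], subst sum.swap) (simp add: sum_distrib_left)
  also have "\<dots> = (\<Sum>x<N. \<Sum>y<N. if x = y then of_nat N * (g x * cnj (g y)) else 0)"
    by (intro sum.cong refl) (subst sum_unity_root, auto)
  also have "\<dots> = (\<Sum>x<N. of_nat N * (g x * cnj (g x)))"
    by (intro sum.cong refl) (simp add: sum.delta)
  also have "\<dots> = complex_of_real (real N * (\<Sum>x<N. (cmod (g x))\<^sup>2))"
    by (simp add: complex_norm_square sum_distrib_left flip: of_real_power)
  finally show ?thesis
    by (simp only: of_real_sum[symmetric] of_real_eq_iff)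
qed

definition dft :: "nat \<Rightarrow> (nat \<Rightarrow> nat \<Rightarrow> real) \<Rightarrow> int \<Rightarrow> int \<Rightarrow> complex" where
  "dft N f a b = (\<Sum>x<N. \<Sum>y<N. of_real (f x y) * unity_root N (a * int x + b * int y))"

lemma dft_diff: "dft N (\<lambda>x y. f x y - g x y) a b = dft N f a b - dft N g a b"
  by (simp add: dft_def left_diff_distrib sum_subtractf)

text \<open>One application of the one-dimensional identity per coordinate.\<close>

lemma parseval_dft:
  "(\<Sum>a\<in>{lo..<lo + int N}. \<Sum>b\<in>{lo..<lo + int N}. (cmod (dft N f a b))\<^sup>2)
    = (real N)\<^sup>2 * (\<Sum>x<N. \<Sum>y<N. (f x y)\<^sup>2)"
proof -
  have "(\<Sum>b\<in>{lo..<lo + int N}. \<Sum>a\<in>{lo..<lo + int N}. (cmod (dft N f a b))\<^sup>2)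
    = (\<Sum>b\<in>{lo..<lo + int N}. \<Sum>a\<in>{lo..<lo + int N}.
        (cmod (\<Sum>x<N. (\<Sum>y<N. of_real (f x y) * unity_root N (b * int y)) * unity_root N (a * int x)))\<^sup>2)"
    by (simp add: dft_def unity_root_add sum_distrib_left mult_ac)
  also have "\<dots> = real N * (\<Sum>b\<in>{lo..<lo + int N}. \<Sum>x<N.
        (cmod (\<Sum>y<N. of_real (f x y) * unity_root N (b * int y)))\<^sup>2)"
    by (simp add: parseval sum_distrib_left)
  also have "\<dots> = real N * (\<Sum>x<N. \<Sum>b\<in>{lo..<lo + int N}.
        (cmod (\<Sum>y<N. of_real (f x y) * unity_root N (b * int y)))\<^sup>2)"
    by (subst sum.swap) (rule refl)
  also have "\<dots> = real N * (\<Sum>x<N. real N * (\<Sum>y<N. (cmod (of_real (f x y)))\<^sup>2))"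
    by (simp only: parseval)
  also have "\<dots> = (real N)\<^sup>2 * (\<Sum>x<N. \<Sum>y<N. (f x y)\<^sup>2)"
    by (simp add: sum_distrib_left power2_eq_square mult_ac)
  finally show ?thesis by (subst sum.swap)
qed

lemma inj_on_mod_shift: "inj_on (\<lambda>x. (x + s) mod N) {..<N}" for N s :: nat
proof (rule inj_onI)
  fix x y
  assume *: "x \<in> {..<N}" "y \<in> {..<N}" "(x + s) mod N = (y + s) mod N"
  then have "(int x + int s) mod int N = (int y + int s) mod int N"
    by (metis of_nat_add of_nat_mod)
  then have "(int x + int s - int s) mod int N = (int y + int s - int s) mod int N"
    by (metis mod_diff_left_eq)
  then show "x = y" using * by simp
qed

lemma sum_mod_shift:
  fixes N s :: nat
  shows "(\<Sum>x<N. \<phi> ((x + s) mod N)) = (\<Sum>x<N. \<phi> x)"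
proof (cases "N = 0")
  case False
  then have "(\<lambda>x. (x + s) mod N) ` {..<N} \<subseteq> {..<N}"
    by auto
  then have "(\<lambda>x. (x + s) mod N) ` {..<N} = {..<N}"
    by (intro endo_inj_surj inj_on_mod_shift) auto
  then show ?thesis
    using sum.reindex[OF inj_on_mod_shift, of \<phi> s N] by simp
qed simp

lemma sum_mod_shift_unity_root:
  fixes h :: "nat \<Rightarrow> complex"
  shows "(\<Sum>x<N. h ((x + s) mod N) * unity_root N (a * int x))
    = unity_root N (- (a * int s)) * (\<Sum>x<N. h x * unity_root N (a * int x))"
proof (cases "N = 0")
  case False
  have "unity_root N (a * int x) = unity_root N (a * int ((x + s) mod N) - a * int s)" for x
  proof (rule unity_root_cong)
    have "(a * int ((x + s) mod N)) mod int N = (a * (int x + int s)) mod int N"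
      by (metis mod_mult_right_eq of_nat_add zmod_int)
    then have "(a * int ((x + s) mod N) - a * int s) mod int N = (a * (int x + int s) - a * int s) mod int N"
      by (metis mod_diff_left_eq)
    then show "(a * int x) mod int N = (a * int ((x + s) mod N) - a * int s) mod int N"
      by (simp add: ring_distribs)
  qed (use False in simp)
  then have "(\<Sum>x<N. h ((x + s) mod N) * unity_root N (a * int x))
      = (\<Sum>x<N. h ((x + s) mod N) * unity_root N (a * int ((x + s) mod N) - a * int s))"
    by simp
  also have "\<dots> = (\<Sum>x<N. h x * unity_root N (a * int x - a * int s))"
    by (rule sum_mod_shift)
  also have "\<dots> = unity_root N (- (a * int s)) * (\<Sum>x<N. h x * unity_root N (a * int x))"
    unfolding diff_conv_add_uminus unity_root_add by (simp add: sum_distrib_left mult_ac)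
  finally show ?thesis .
qed simp

lemma dft_swap: "dft N f a b = dft N (\<lambda>x y. f y x) b a"
  unfolding dft_def by (subst sum.swap) (simp add: add.commute)

lemma dft_row:
  "dft N f a b = (\<Sum>y<N. (\<Sum>x<N. of_real (f x y) * unity_root N (a * int x)) * unity_root N (b * int y))"
  unfolding dft_def by (subst sum.swap) (simp add: unity_root_add sum_distrib_left mult_ac)

text \<open>For fixed \<open>y\<close> the shear is a translation by \<open>y\<close>, whose phase
  merges with the second frequency. A shear of the torus is thus a shear of the frequencies. The
  result \<open>b - a\<close> is not reduced modulo \<open>N\<close>: \<open>dft\<close> is defined
  at all integer frequencies.\<close>

lemma dft_shear1: "dft N (\<lambda>x y. f ((x + y) mod N) y) a b = dft N f a (b - a)"
proof -
  have "unity_root N ((b - a) * int y) = unity_root N (- (a * int y)) * unity_root N (b * int y)" for y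
    by (simp add: unity_root_add[symmetric] ring_distribs)
  then show ?thesis
    unfolding dft_row[of N _ a] sum_mod_shift_unity_root[where h = "\<lambda>x. complex_of_real (f x _)"]
    by (simp add: mult_ac)
qed

lemma dft_shear2: "dft N (\<lambda>x y. f x ((x + y) mod N)) a b = dft N f (a - b) b"
  using dft_shear1[of N "\<lambda>x y. f y x" b a]
  by (simp add: dft_swap[of N f] dft_swap[of N "\<lambda>x y. f x ((x + y) mod N)"] add.commute)

lemma dft_translate1: "dft N (\<lambda>x y. f (Suc x mod N) y) a b = unity_root N (- a) * dft N f a b"
  unfolding dft_row[of N _ a]
  using sum_mod_shift_unity_root[where h = "\<lambda>x. complex_of_real (f x _)" and s = 1]
  by (simp add: sum_distrib_left mult_ac)

lemma dft_translate2: "dft N (\<lambda>x y. f x (Suc y mod N)) a b = unity_root N (- b) * dft N f a b"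
  using dft_translate1[of N "\<lambda>x y. f y x" b a]
  by (simp add: dft_swap[of N f] dft_swap[of N "\<lambda>x y. f x (Suc y mod N)"])

text \<open>If \<open>m\<close> were almost invariant under both shears, then the part of \<open>m\<close> in the first and third
  quadrants would be copied to two disjoint parts of these quadrants, so it is small; the inverse
  shears do the same for the other two quadrants, and the axes are moved into the quadrants.\<close>

lemma shear_mass_bound:
  fixes m :: "int \<times> int \<Rightarrow> real" and \<epsilon> \<eta> :: real
  assumes \<Omega>: "finite \<Omega>" "\<And>a b. 2 * \<bar>a\<bar> < n \<Longrightarrow> 2 * \<bar>b\<bar> < n \<Longrightarrow> (a, b) \<in> \<Omega>"
    and m: "\<And>p. 0 \<le> m p" "m (0, 0) = 0"
    and e1: "(\<Sum>(a, b)\<in>\<Omega>. \<bar>m (a, b - a) - m (a, b)\<bar>) \<le> \<epsilon>"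
    and e2: "(\<Sum>(a, b)\<in>\<Omega>. \<bar>m (a - b, b) - m (a, b)\<bar>) \<le> \<epsilon>"
    and out: "(\<Sum>p\<in>{(a, b)\<in>\<Omega>. n \<le> 4 * \<bar>a\<bar> \<or> n \<le> 4 * \<bar>b\<bar>}. m p) \<le> \<eta>"
  shows "(\<Sum>p\<in>\<Omega>. m p) \<le> 10 * \<epsilon> + 7 * \<eta>"
proof -
  define O' where "O' = {(a, b)\<in>\<Omega>. n \<le> 4 * \<bar>a\<bar> \<or> n \<le> 4 * \<bar>b\<bar>}"
  define B where "B = {(a, b)\<in>\<Omega>. 4 * \<bar>a\<bar> < n \<and> 4 * \<bar>b\<bar> < n}"
  define P where "P = {(a, b)\<in>\<Omega>. 0 < a * b}"
  define Q where "Q = {(a, b)\<in>\<Omega>. a * b < 0}"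
  define X where "X = {(a, b)\<in>\<Omega>. a \<noteq> 0 \<and> b = 0}"
  define Y where "Y = {(a, b)\<in>\<Omega>. a = 0 \<and> b \<noteq> 0}"
  have fin [simp]: "finite S" if "S \<subseteq> \<Omega>" for S
    using that \<Omega>(1) by (rule finite_subset)
  have sub: "O' \<subseteq> \<Omega>" "B \<subseteq> \<Omega>" "P \<subseteq> \<Omega>" "Q \<subseteq> \<Omega>" "X \<subseteq> \<Omega>" "Y \<subseteq> \<Omega>"
    by (auto simp: O'_def B_def P_def Q_def X_def Y_def)
  have mono: "sum m S \<le> sum m T" if "S \<subseteq> T" "T \<subseteq> \<Omega>" for S T
    using that m(1) by (intro sum_mono2) auto
  \<comment> \<open>Outside \<open>B\<close> some coordinate is at least \<open>n / 4\<close> in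
    absolute value, and such points carry mass at most \<eta>.\<close>
  have split: "sum m S \<le> sum m (S \<inter> B) + \<eta>" if "S \<subseteq> \<Omega>" for S
  proof -
    have "sum m S \<le> sum m (S \<inter> B \<union> O')"
      using that sub by (intro mono) (auto simp: O'_def B_def)
    also have "\<dots> \<le> sum m (S \<inter> B) + sum m O'"
      using that sub m(1) by (subst sum.union_inter[symmetric]) (auto intro!: sum_nonneg simp: le_infI1)
    finally show ?thesis
      using out unfolding O'_def by simp
  qed
  define tf ti sf si where "tf = (\<lambda>(a, b). (a, a + b :: int))" and "ti = (\<lambda>(a, b). (a, b - a :: int))"
    and "sf = (\<lambda>(a, b). (a + b, b :: int))" and "si = (\<lambda>(a, b). (a - b, b :: int))"
  \<comment> \<open>Comparing masses along a map costs at most the total change \<epsilon>. Here the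
    change is known for the inverse \<open>u'\<close>, so the set is pushed forward by
    \<open>u\<close>; in \<open>pull\<close> the map itself is the controlled one.\<close>
  have move: "sum m S \<le> sum m (u ` S) + \<epsilon>"
    if "u ` S \<subseteq> \<Omega>" "\<And>p. u' (u p) = p" "(\<Sum>p\<in>\<Omega>. \<bar>m (u' p) - m p\<bar>) \<le> \<epsilon>" for S u u'
  proof -
    have "inj_on u S" using that(2) by (metis inj_onI)
    then have "sum m S = (\<Sum>q\<in>u ` S. m (u' q))"
      by (simp add: sum.reindex that(2))
    also have "\<dots> \<le> (\<Sum>q\<in>u ` S. m q + \<bar>m (u' q) - m q\<bar>)"
      by (intro sum_mono) auto
    also have "\<dots> \<le> sum m (u ` S) + (\<Sum>q\<in>\<Omega>. \<bar>m (u' q) - m q\<bar>)"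
      using that(1) \<Omega>(1) by (auto simp: sum.distrib intro!: sum_mono2)
    finally show ?thesis using that(3) by simp
  qed
  have pull: "sum m S \<le> sum m (u' ` S) + \<epsilon>"
    if "S \<subseteq> \<Omega>" "inj u'" "(\<Sum>p\<in>\<Omega>. \<bar>m (u' p) - m p\<bar>) \<le> \<epsilon>" for S u'
  proof -
    have "sum m S \<le> (\<Sum>p\<in>S. m (u' p) + \<bar>m (u' p) - m p\<bar>)"
      by (intro sum_mono) auto
    also have "\<dots> \<le> (\<Sum>p\<in>S. m (u' p)) + (\<Sum>q\<in>\<Omega>. \<bar>m (u' q) - m q\<bar>)"
      using that(1) \<Omega>(1) by (auto simp: sum.distrib intro!: sum_mono2)
    also have "(\<Sum>p\<in>S. m (u' p)) = sum m (u' ` S)"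
      using that(2) by (simp add: sum.reindex inj_on_subset)
    finally show ?thesis using that(3) by simp
  qed
  have e: "(\<Sum>p\<in>\<Omega>. \<bar>m (ti p) - m p\<bar>) \<le> \<epsilon>" "(\<Sum>p\<in>\<Omega>. \<bar>m (si p) - m p\<bar>) \<le> \<epsilon>"
    using e1 e2 by (simp_all add: ti_def si_def case_prod_unfold)
  have inv: "ti (tf p) = p" "si (sf p) = p" for p
    by (auto simp: tf_def ti_def sf_def si_def split: prod.splits)
  have inj: "inj ti" "inj si"
    by (auto simp: inj_def ti_def si_def)
  \<comment> \<open>For coordinates of equal sign, replacing one of them by the sum makes it the
    larger in absolute value, so the two images are disjoint subsets of \<open>P\<close>; in
    \<open>B\<close> the sums stay below \<open>n / 2\<close>, hence in \<Omega>. So twice the mass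
    of \<open>P \<inter> B\<close> is at most that of \<open>P\<close> plus
    \<open>2 * \<epsilon>\<close>, and \<open>split\<close> absorbs one copy.\<close>
  have PB: "sum m (P \<inter> B) \<le> 2 * \<epsilon> + \<eta>"
  proof -
    have img: "tf ` (P \<inter> B) \<subseteq> P" "sf ` (P \<inter> B) \<subseteq> P"
      by (auto simp: P_def B_def tf_def sf_def zero_less_mult_iff intro!: \<Omega>(2))
    have disj: "tf ` (P \<inter> B) \<inter> sf ` (P \<inter> B) = {}"
      by (auto simp: P_def B_def tf_def sf_def zero_less_mult_iff)
    have "sum m (P \<inter> B) + sum m (P \<inter> B) \<le> sum m (tf ` (P \<inter> B)) + sum m (sf ` (P \<inter> B)) + 2 * \<epsilon>"
      using move[OF order_trans[OF img(1) sub(3)] inv(1) e(1)]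
        move[OF order_trans[OF img(2) sub(3)] inv(2) e(2)] by linarith
    also have "sum m (tf ` (P \<inter> B)) + sum m (sf ` (P \<inter> B)) = sum m (tf ` (P \<inter> B) \<union> sf ` (P \<inter> B))"
      using img sub disj by (intro sum.union_disjoint[symmetric]) auto
    also have "\<dots> \<le> sum m P"
      using img sub by (intro mono) auto
    finally show ?thesis
      using split[OF sub(3)] by simp
  qed
  \<comment> \<open>For opposite signs it is the differences that grow in absolute value, so the
    inverse shears take over.\<close>
  have QB: "sum m (Q \<inter> B) \<le> 2 * \<epsilon> + \<eta>"
  proof -
    have img: "ti ` (Q \<inter> B) \<subseteq> Q" "si ` (Q \<inter> B) \<subseteq> Q"
      by (auto simp: Q_def B_def ti_def si_def mult_less_0_iff intro!: \<Omega>(2))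
    have disj: "ti ` (Q \<inter> B) \<inter> si ` (Q \<inter> B) = {}"
      by (auto simp: Q_def B_def ti_def si_def mult_less_0_iff)
    have "sum m (Q \<inter> B) + sum m (Q \<inter> B) \<le> sum m (ti ` (Q \<inter> B)) + sum m (si ` (Q \<inter> B)) + 2 * \<epsilon>"
      using pull[of "Q \<inter> B", OF le_infI1[OF sub(4)] inj(1) e(1)]
        pull[of "Q \<inter> B", OF le_infI1[OF sub(4)] inj(2) e(2)] by linarith
    also have "sum m (ti ` (Q \<inter> B)) + sum m (si ` (Q \<inter> B)) = sum m (ti ` (Q \<inter> B) \<union> si ` (Q \<inter> B))"
      using img sub disj by (intro sum.union_disjoint[symmetric]) auto
    also have "\<dots> \<le> sum m Q"
      using img sub by (intro mono) auto
    finally show ?thesis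
      using split[OF sub(4)] by simp
  qed
  have P: "sum m P \<le> 2 * \<epsilon> + 2 * \<eta>"
    using split[OF sub(3)] PB by simp
  \<comment> \<open>A shear turns \<open>(a, 0)\<close> into \<open>(a, a)\<close>, which lies in
    \<open>P\<close>; the other shear does the same for \<open>(0, b)\<close>.\<close>
  have XB: "sum m (X \<inter> B) \<le> 3 * \<epsilon> + 2 * \<eta>"
  proof -
    have img: "tf ` (X \<inter> B) \<subseteq> P"
      by (auto simp: P_def X_def B_def tf_def zero_less_mult_iff intro!: \<Omega>(2))
    show ?thesis
      using move[OF order_trans[OF img sub(3)] inv(1) e(1)] mono[OF img sub(3)] P by linarith
  qed
  have YB: "sum m (Y \<inter> B) \<le> 3 * \<epsilon> + 2 * \<eta>"
  proof -
    have img: "sf ` (Y \<inter> B) \<subseteq> P"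
      by (auto simp: P_def Y_def B_def sf_def zero_less_mult_iff intro!: \<Omega>(2))
    show ?thesis
      using move[OF order_trans[OF img sub(3)] inv(2) e(2)] mono[OF img sub(3)] P by linarith
  qed
  have union: "sum m (S \<union> T) \<le> sum m S + sum m T" if "S \<subseteq> \<Omega>" "T \<subseteq> \<Omega>" for S T
    using that sum.union_inter[of S T m] sum_nonneg[of "S \<inter> T" m] m(1) by simp
  \<comment> \<open>\<open>P\<close> and \<open>Q\<close> contribute
    \<open>2 * \<epsilon> + \<eta>\<close> each, the axes \<open>3 * \<epsilon> + 2 * \<eta>\<close>
    each, and the points outside \<open>B\<close> one more \<eta>; the origin has no mass.\<close>
  have "sum m \<Omega> \<le> sum m (\<Omega> \<inter> B) + \<eta>"
    by (rule split) simp
  also have "sum m (\<Omega> \<inter> B) = sum m (\<Omega> \<inter> B - {(0, 0)})"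
    using \<Omega>(1) m(2) by (intro sum.mono_neutral_right) auto
  also have "\<dots> \<le> sum m ((P \<inter> B) \<union> ((Q \<inter> B) \<union> ((X \<inter> B) \<union> (Y \<inter> B))))"
    using sub by (intro mono) (auto simp: P_def Q_def X_def Y_def mult_less_0_iff zero_less_mult_iff)
  also have "\<dots> \<le> sum m (P \<inter> B) + (sum m (Q \<inter> B) + (sum m (X \<inter> B) + sum m (Y \<inter> B)))"
    using sub by (intro order_trans[OF union] add_left_mono order_refl) auto
  finally show ?thesis
    using PB QB XB YB by simp
qed

section \<open>The generators and their spectral gap\<close>

definition torus :: "nat \<Rightarrow> (nat \<times> nat) set" where
  "torus N = {..<N} \<times> {..<N}"

text \<open>Two shears and two unit translations, as in expanders of Margulis type. Generator 0 is
  the identity, which makes the walk lazy: knowing that some other map moves a function far then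
  yields a contraction.\<close>

definition gen :: "nat \<Rightarrow> nat \<Rightarrow> nat \<times> nat \<Rightarrow> nat \<times> nat" where
  "gen N g p = (if g = 0 \<or> N = 0 then p
     else if g = 1 then ((fst p + snd p) mod N, snd p)
     else if g = 2 then (fst p, (fst p + snd p) mod N)
     else if g = 3 then (Suc (fst p) mod N, snd p)
     else (fst p, Suc (snd p) mod N))"

lemma finite_torus [simp]: "finite (torus N)"
  and card_torus: "card (torus N) = N\<^sup>2"
  by (simp_all add: torus_def power2_eq_square)

lemma sum_torus: "(\<Sum>p\<in>torus N. f p) = (\<Sum>x<N. \<Sum>y<N. f (x, y))"
  by (simp add: torus_def sum.cartesian_product)

text \<open>The difference of squares is the product of the difference \<open>d\<close> and the sum
  \<open>s\<close> of the moduli, split by the arithmetic-geometric mean inequality. The weight 25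
  balances the two parts in \<open>torus_gap\<close>, where each contributes
  \<open>W / 25\<close>.\<close>

lemma norm_square_diff_le:
  fixes z w :: complex
  shows "\<bar>(cmod z)\<^sup>2 - (cmod w)\<^sup>2\<bar> \<le> 25 * (cmod (z - w))\<^sup>2 + ((cmod z)\<^sup>2 + (cmod w)\<^sup>2) / 50"
proof -
  define d s where "d = \<bar>cmod z - cmod w\<bar>" and "s = cmod z + cmod w"
  have "\<bar>(cmod z)\<^sup>2 - (cmod w)\<^sup>2\<bar> = d * s"
    unfolding d_def s_def power2_eq_square square_diff_square_factored
    by (simp add: abs_mult mult.commute)
  moreover have "0 \<le> (5 * d - s / 10)\<^sup>2"
    by simp
  then have "d * s \<le> 25 * d\<^sup>2 + s\<^sup>2 / 100"
    by (simp add: power2_eq_square algebra_simps)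
  moreover have "d\<^sup>2 \<le> (cmod (z - w))\<^sup>2"
    unfolding d_def by (intro power_mono norm_triangle_ineq3) auto
  moreover have "s\<^sup>2 \<le> 2 * ((cmod z)\<^sup>2 + (cmod w)\<^sup>2)"
    using sum_squares_ge_zero[of "cmod z - cmod w" 0]
    unfolding s_def by (simp add: power2_eq_square algebra_simps)
  ultimately show ?thesis
    by argo
qed

text \<open>The squared distance is \<open>2 - 2 * cos t\<close>, and the angle of a frequency
  between \<open>N / 4\<close> and \<open>N / 2\<close> lies between \<open>pi / 2\<close> and
  \<open>pi\<close>, where the cosine is not positive.\<close>

lemma norm_unity_root_minus_1:
  assumes "int N \<le> 4 * \<bar>a\<bar>" "2 * \<bar>a\<bar> \<le> int N" "0 < N"
  shows "2 \<le> (cmod (unity_root N (- a) - 1))\<^sup>2"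
proof -
  define t where "t = 2 * pi * \<bar>of_int a\<bar> / real N"
  have "real N \<le> 4 * \<bar>of_int a\<bar>" "2 * \<bar>of_int a\<bar> \<le> real N"
    using assms by linarith+
  then have "pi / 2 \<le> t" "t \<le> pi"
    using assms(3) by (simp_all add: t_def field_simps)
  then have "0 \<le> cos (pi - t)"
    by (intro cos_ge_zero) auto
  then have "cos t \<le> 0"
    by simp
  moreover have "cos (2 * pi * of_int (- a) / real N) = cos t"
    by (cases "0 \<le> a") (simp_all add: t_def)
  moreover have "(cmod (cis u - 1))\<^sup>2 = 2 - 2 * cos u" for u
    using sin_cos_squared_add[of u] by (simp add: cmod_power2 power2_diff)
  ultimately show ?thesis
    by (simp add: unity_root_def)
qed

text \<open>A Poincare inequality, i.e. a spectral gap: a function of mean zero is moved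
  substantially by some generator. Otherwise its spectral mass, which vanishes at the origin, would
  be almost invariant under both shears and almost free of high frequencies, since translations
  multiply these by phases far from 1; \<open>shear_mass_bound\<close> excludes that.\<close>

lemma torus_gap:
  fixes f :: "nat \<times> nat \<Rightarrow> real"
  assumes f: "(\<Sum>p\<in>torus N. f p) = 0"
  shows "\<exists>g\<in>{1, 2, 3, 4}. (\<Sum>p\<in>torus N. (f p)\<^sup>2) \<le> 625 * (\<Sum>p\<in>torus N. (f (gen N g p) - f p)\<^sup>2)"
proof (rule ccontr)
  assume "\<not> ?thesis"
  then have contra: "625 * (\<Sum>p\<in>torus N. (f (gen N g p) - f p)\<^sup>2) < (\<Sum>p\<in>torus N. (f p)\<^sup>2)"
    if "g \<in> {1, 2, 3, 4}" for g
    using that by (meson not_le)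
  define E where "E = (\<Sum>p\<in>torus N. (f p)\<^sup>2)"
  have "0 < N"
    using contra[of 1] by (cases "N = 0") (auto simp: torus_def)
  define h where "h x y = f (x, y)" for x y
  define F where "F = dft N h"
  \<comment> \<open>Frequencies are centred at 0, so that they have absolute value at most
    \<open>N / 2\<close> and their size is meaningful.\<close>
  define I where "I = {- int (N div 2)..<- int (N div 2) + int N}"
  define m where "m p = (cmod (F (fst p) (snd p)))\<^sup>2" for p
  define W where "W = (real N)\<^sup>2 * E"
  have pars: "(\<Sum>p\<in>I \<times> I. (cmod (dft N u (fst p) (snd p)))\<^sup>2) = (real N)\<^sup>2 * (\<Sum>x<N. \<Sum>y<N. (u x y)\<^sup>2)" for u
  proof -
    have "(\<Sum>p\<in>I \<times> I. (cmod (dft N u (fst p) (snd p)))\<^sup>2) = (\<Sum>a\<in>I. \<Sum>b\<in>I. (cmod (dft N u a b))\<^sup>2)"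
      by (simp add: sum.cartesian_product case_prod_unfold)
    then show ?thesis
      unfolding I_def parseval_dft .
  qed
  have mW: "(\<Sum>p\<in>I \<times> I. m p) = W"
    unfolding m_def F_def pars W_def E_def sum_torus h_def ..
  have diff: "(\<Sum>p\<in>I \<times> I. (cmod (dft N (\<lambda>x y. f (gen N g (x, y))) (fst p) (snd p) - F (fst p) (snd p)))\<^sup>2) \<le> W / 625"
    if "g \<in> {1, 2, 3, 4}" for g
  proof -
    have "(\<Sum>p\<in>I \<times> I. (cmod (dft N (\<lambda>x y. f (gen N g (x, y))) (fst p) (snd p) - F (fst p) (snd p)))\<^sup>2)
        = (real N)\<^sup>2 * (\<Sum>p\<in>torus N. (f (gen N g p) - f p)\<^sup>2)"
      unfolding F_def dft_diff[symmetric] pars sum_torus h_def ..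
    also have "\<dots> \<le> (real N)\<^sup>2 * (E / 625)"
      using contra[OF that] unfolding E_def by (intro mult_left_mono) auto
    finally show ?thesis by (simp add: W_def)
  qed
  have gens: "dft N (\<lambda>x y. f (gen N 1 (x, y))) a b = F a (b - a)"
    "dft N (\<lambda>x y. f (gen N 2 (x, y))) a b = F (a - b) b"
    "dft N (\<lambda>x y. f (gen N 3 (x, y))) a b = unity_root N (- a) * F a b"
    "dft N (\<lambda>x y. f (gen N 4 (x, y))) a b = unity_root N (- b) * F a b" for a b
    using \<open>0 < N\<close> dft_shear1[of N h a b] dft_shear2[of N h a b] dft_translate1[of N h a b]
      dft_translate2[of N h a b]
    by (simp_all add: gen_def F_def h_def)
  have shear: "(\<Sum>p\<in>I \<times> I. \<bar>(cmod (dft N (\<lambda>x y. f (gen N g (x, y))) (fst p) (snd p)))\<^sup>2 - m p\<bar>) \<le> 8 / 100 * W"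
    if g: "g = 1 \<or> g = 2" for g
  proof -
    let ?G = "\<lambda>p. dft N (\<lambda>x y. f (gen N g (x, y))) (fst p) (snd p)"
    have shift: "(\<Sum>x<N. \<phi> ((x + s) mod N)) = (\<Sum>x<N. \<phi> x)" for \<phi> :: "nat \<Rightarrow> real" and s
      by (rule sum_mod_shift)
    have "(\<Sum>x<N. \<Sum>y<N. (f (gen N g (x, y)))\<^sup>2) = (\<Sum>x<N. \<Sum>y<N. (f (x, y))\<^sup>2)"
      using g
    proof
      assume "g = 1"
      have "(\<Sum>y<N. \<Sum>x<N. (f ((x + y) mod N, y))\<^sup>2) = (\<Sum>y<N. \<Sum>x<N. (f (x, y))\<^sup>2)"
        by (intro sum.cong refl shift[of "\<lambda>x. (f (x, _))\<^sup>2"])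
      then have "(\<Sum>x<N. \<Sum>y<N. (f ((x + y) mod N, y))\<^sup>2) = (\<Sum>x<N. \<Sum>y<N. (f (x, y))\<^sup>2)"
        by (subst sum.swap, subst (2) sum.swap)
      then show ?thesis
        using \<open>g = 1\<close> \<open>0 < N\<close> by (simp add: gen_def)
    next
      assume "g = 2"
      have "(\<Sum>x<N. \<Sum>y<N. (f (x, (y + x) mod N))\<^sup>2) = (\<Sum>x<N. \<Sum>y<N. (f (x, y))\<^sup>2)"
        by (intro sum.cong refl shift[of "\<lambda>y. (f (_, y))\<^sup>2"])
      then show ?thesis
        using \<open>g = 2\<close> \<open>0 < N\<close> by (simp add: gen_def add.commute)
    qed
    then have "(\<Sum>p\<in>I \<times> I. (cmod (?G p))\<^sup>2) = W"
      unfolding pars W_def E_def sum_torus by simp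
    moreover have "(\<Sum>p\<in>I \<times> I. \<bar>(cmod (?G p))\<^sup>2 - m p\<bar>)
        \<le> (\<Sum>p\<in>I \<times> I. 25 * (cmod (?G p - F (fst p) (snd p)))\<^sup>2 + ((cmod (?G p))\<^sup>2 + m p) / 50)"
      unfolding m_def by (intro sum_mono norm_square_diff_le)
    moreover have "\<dots> = 25 * (\<Sum>p\<in>I \<times> I. (cmod (?G p - F (fst p) (snd p)))\<^sup>2)
        + ((\<Sum>p\<in>I \<times> I. (cmod (?G p))\<^sup>2) + (\<Sum>p\<in>I \<times> I. m p)) / 50"
      by (simp add: sum.distrib flip: sum_distrib_left sum_divide_distrib)
    moreover have "(\<Sum>p\<in>I \<times> I. (cmod (?G p - F (fst p) (snd p)))\<^sup>2) \<le> W / 625"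
      using g by (intro diff) auto
    ultimately show ?thesis
      using mW by argo
  qed
  \<comment> \<open>The right-hand side is about \<open>0.81 * W\<close>, which contradicts
    \<open>0 < W\<close>; this is where 625 is large enough.\<close>
  have "(\<Sum>p\<in>I \<times> I. m p) \<le> 10 * (8 / 100 * W) + 7 * (W / 625)"
  proof (rule shear_mass_bound[where n = "int N"])
    show "(a, b) \<in> I \<times> I" if "2 * \<bar>a\<bar> < int N" "2 * \<bar>b\<bar> < int N" for a b
      using that unfolding I_def by auto
    show "0 \<le> m p" for p
      by (simp add: m_def)
    have "F 0 0 = of_real (\<Sum>p\<in>torus N. f p)"
      by (simp add: F_def dft_def h_def sum_torus)
    then show "m (0, 0) = 0"
      by (simp add: m_def f)
    show "(\<Sum>(a, b)\<in>I \<times> I. \<bar>m (a, b - a) - m (a, b)\<bar>) \<le> 8 / 100 * W"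
      using shear[of 1, unfolded gens] by (simp add: m_def case_prod_unfold)
    show "(\<Sum>(a, b)\<in>I \<times> I. \<bar>m (a - b, b) - m (a, b)\<bar>) \<le> 8 / 100 * W"
      using shear[of 2, unfolded gens] by (simp add: m_def case_prod_unfold)
    let ?d = "\<lambda>g p. (cmod (dft N (\<lambda>x y. f (gen N g (x, y))) (fst p) (snd p) - F (fst p) (snd p)))\<^sup>2"
    have far: "2 * m p \<le> (cmod (unity_root N (- c) * F (fst p) (snd p) - F (fst p) (snd p)))\<^sup>2"
      if "int N \<le> 4 * \<bar>c\<bar>" "c \<in> I" for c p
    proof -
      have "2 \<le> (cmod (unity_root N (- c) - 1))\<^sup>2"
        using that \<open>0 < N\<close> by (intro norm_unity_root_minus_1) (auto simp: I_def)
      then have "2 * m p \<le> (cmod (unity_root N (- c) - 1))\<^sup>2 * m p"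
        by (intro mult_right_mono) (auto simp: m_def)
      also have "\<dots> = (cmod ((unity_root N (- c) - 1) * F (fst p) (snd p)))\<^sup>2"
        by (simp add: m_def norm_mult power_mult_distrib)
      finally show ?thesis by (simp add: left_diff_distrib)
    qed
    let ?O = "{(a, b)\<in>I \<times> I. int N \<le> 4 * \<bar>a\<bar> \<or> int N \<le> 4 * \<bar>b\<bar>}"
    \<comment> \<open>A frequency that is high in one coordinate is displaced, in square, by at
      least \<open>2 * m p\<close> under the translation in that coordinate; averaging over both
      translations avoids deciding which one.\<close>
    have "(\<Sum>p\<in>?O. m p) \<le> (\<Sum>p\<in>?O. (?d 3 p + ?d 4 p) / 2)"
    proof (rule sum_mono)
      fix p
      assume "p \<in> ?O"
      then consider "int N \<le> 4 * \<bar>fst p\<bar>" "fst p \<in> I" | "int N \<le> 4 * \<bar>snd p\<bar>" "snd p \<in> I"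
        by auto
      then show "m p \<le> (?d 3 p + ?d 4 p) / 2"
        by cases (use far[of "fst p" p] far[of "snd p" p] in \<open>simp_all add: gens add_increasing add_increasing2\<close>)
    qed
    also have "\<dots> \<le> (\<Sum>p\<in>I \<times> I. (?d 3 p + ?d 4 p) / 2)"
      by (intro sum_mono2) (auto simp: I_def)
    also have "\<dots> = ((\<Sum>p\<in>I \<times> I. ?d 3 p) + (\<Sum>p\<in>I \<times> I. ?d 4 p)) / 2"
      by (simp add: sum.distrib add_divide_distrib sum_divide_distrib)
    also have "\<dots> \<le> W / 625"
      using diff[of 3] diff[of 4] by simp
    finally show "(\<Sum>p\<in>?O. m p) \<le> W / 625" .
  qed (simp add: I_def)
  then have "W \<le> 0"
    using mW by argo
  moreover have "0 < E"
    using contra[of 1] sum_nonneg[of "torus N" "\<lambda>p. (f (gen N 1 p) - f p)\<^sup>2"] unfolding E_def by simp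
  ultimately show False
    using \<open>0 < N\<close> by (simp add: W_def mult_le_0_iff)
qed

section \<open>Random walks on the torus\<close>

lemma bij_betw_gen: "bij_betw (gen N g) (torus N) (torus N)"
proof -
  have shift: "x = y" if "(x + s) mod N = (y + s) mod N" "x < N" "y < N" for x y s :: nat
    using inj_onD[OF inj_on_mod_shift that(1)] that(2,3) by simp
  have "inj_on (gen N g) (torus N)"
  proof (rule inj_onI)
    fix p q
    assume *: "p \<in> torus N" "q \<in> torus N" "gen N g p = gen N g q"
    obtain x y x' y' where pq: "p = (x, y)" "q = (x', y')"
      by (cases p, cases q)
    show "p = q"
      using * shift[of x y x'] shift[of y x y'] shift[of x 1 x'] shift[of y 1 y']
      unfolding pq by (auto simp: gen_def torus_def add.commute split: if_splits)
  qed
  moreover have "gen N g ` torus N \<subseteq> torus N"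
    by (auto simp: gen_def torus_def)
  ultimately show ?thesis
    by (simp add: bij_betw_def endo_inj_surj)
qed

lemma gen_in_torus: "p \<in> torus N \<Longrightarrow> gen N g p \<in> torus N"
  using bij_betw_gen bij_betwE by blast

lemma sum_gen: "(\<Sum>p\<in>torus N. f (gen N g p)) = (\<Sum>p\<in>torus N. f p)"
  using sum.reindex_bij_betw[OF bij_betw_gen] .

lemma L2_set_gen: "L2_set (\<lambda>p. f (gen N g p)) (torus N) = L2_set f (torus N)"
  unfolding L2_set_def using sum_gen[of "\<lambda>p. (f p)\<^sup>2"] by simp

lemma L2_set_sum_le: "finite G \<Longrightarrow> L2_set (\<lambda>p. \<Sum>g\<in>G. f g p) V \<le> (\<Sum>g\<in>G. L2_set (f g) V)"
proof (induction G rule: finite_induct)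
  case empty
  then show ?case by (simp add: L2_set_def)
next
  case (insert a G)
  then show ?case
    using L2_set_triangle_ineq[of "f a" "\<lambda>p. \<Sum>g\<in>G. f g p" V] by simp
qed

lemma power2_L2_set: "(L2_set f V)\<^sup>2 = (\<Sum>p\<in>V. (f p)\<^sup>2)"
  by (simp add: L2_set_def sum_nonneg)

lemma Cauchy_Schwarz_sum: "(\<Sum>i\<in>A. f i * g i)\<^sup>2 \<le> (\<Sum>i\<in>A. (f i)\<^sup>2) * (\<Sum>i\<in>A. (g i)\<^sup>2)" for f g :: "'a \<Rightarrow> real"
proof -
  have "\<bar>\<Sum>i\<in>A. f i * g i\<bar> \<le> (\<Sum>i\<in>A. \<bar>f i\<bar> * \<bar>g i\<bar>)"
    unfolding abs_mult[symmetric] by (rule sum_abs)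
  also have "\<dots> \<le> L2_set f A * L2_set g A"
    by (rule L2_set_mult_ineq)
  finally have "\<bar>\<Sum>i\<in>A. f i * g i\<bar>\<^sup>2 \<le> (L2_set f A * L2_set g A)\<^sup>2"
    by (intro power_mono) auto
  then show ?thesis
    by (simp add: power_mult_distrib power2_L2_set)
qed

text \<open>A function supported on \<open>M\<close> is far from constant: by Cauchy-Schwarz its
  mean accounts for at most 11/12 of its energy \<open>E\<close>, so some generator moves it by at
  least \<open>E / 7500\<close> in squared norm, where 7500 = 12 * 625. By the parallelogram law,
  adding the moved function to \<open>f\<close> multiplies the norm by at most
  \<open>2 - 1 / 30000\<close> instead of 2, as 4 / 30000 = 1 / 7500. The other three generators are
  bounded by the triangle inequality.\<close>

lemma walk_contraction:
  fixes f :: "nat \<times> nat \<Rightarrow> real"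
  assumes M: "M \<subseteq> torus N" "12 * card M \<le> 11 * N\<^sup>2" and f: "\<And>p. p \<notin> M \<Longrightarrow> f p = 0"
  shows "L2_set (\<lambda>p. \<Sum>g<5. f (gen N g p)) (torus N) \<le> (5 - 1 / 30000) * L2_set f (torus N)"
proof (cases "N = 0")
  case False
  let ?V = "torus N"
  let ?L = "L2_set f ?V"
  define E where "E = (\<Sum>p\<in>?V. (f p)\<^sup>2)"
  define s where "s = (\<Sum>p\<in>?V. f p)"
  define c where "c = s / (real N)\<^sup>2"
  have s: "s = (\<Sum>p\<in>M. f p * 1)"
    using M(1) f unfolding s_def by (simp add: sum.mono_neutral_right)
  have "s\<^sup>2 \<le> (\<Sum>p\<in>M. (f p)\<^sup>2) * (\<Sum>p\<in>M. 1\<^sup>2)"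
    unfolding s by (rule Cauchy_Schwarz_sum)
  also have "(\<Sum>p\<in>M. (f p)\<^sup>2) = E"
    using M(1) f unfolding E_def by (intro sum.mono_neutral_left) auto
  also have "E * (\<Sum>p\<in>M. 1\<^sup>2) \<le> E * (11 / 12 * (real N)\<^sup>2)"
  proof (rule mult_left_mono)
    have "real (12 * card M) \<le> real (11 * N\<^sup>2)"
      using M(2) by (rule of_nat_mono)
    then show "(\<Sum>p\<in>M. 1\<^sup>2) \<le> 11 / 12 * (real N)\<^sup>2"
      by simp
  qed (simp add: E_def sum_nonneg)
  finally have s2: "s\<^sup>2 / (real N)\<^sup>2 \<le> 11 / 12 * E"
    using False by (simp add: field_simps)
  have "(\<Sum>p\<in>?V. f p - c) = 0"
    using False by (simp add: sum_subtractf card_torus c_def s_def)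
  from torus_gap[OF this] obtain g where g: "g \<in> {1, 2, 3, 4}"
    "(\<Sum>p\<in>?V. (f p - c)\<^sup>2) \<le> 625 * (\<Sum>p\<in>?V. (f (gen N g p) - f p)\<^sup>2)"
    by auto
  have "(\<Sum>p\<in>?V. (f p - c)\<^sup>2) = (\<Sum>p\<in>?V. (f p)\<^sup>2 + c\<^sup>2 - 2 * c * f p)"
    by (intro sum.cong) (auto simp: power2_diff)
  also have "\<dots> = E + (real N)\<^sup>2 * c\<^sup>2 - 2 * c * s"
    by (simp add: sum_subtractf sum.distrib E_def s_def sum_distrib_left card_torus)
  also have "\<dots> = E - s\<^sup>2 / (real N)\<^sup>2"
    using False by (simp add: c_def power2_eq_square)
  finally have gap: "E / 7500 \<le> (\<Sum>p\<in>?V. (f (gen N g p) - f p)\<^sup>2)"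
    using g(2) s2 by simp
  have "(L2_set (\<lambda>p. f p + f (gen N g p)) ?V)\<^sup>2
      = (\<Sum>p\<in>?V. 2 * (f p)\<^sup>2 + 2 * (f (gen N g p))\<^sup>2 - (f (gen N g p) - f p)\<^sup>2)"
    unfolding power2_L2_set by (intro sum.cong) (auto simp: power2_eq_square algebra_simps)
  also have "\<dots> = 4 * E - (\<Sum>p\<in>?V. (f (gen N g p) - f p)\<^sup>2)"
    using sum_gen[of "\<lambda>p. (f p)\<^sup>2"]
    by (simp add: sum_subtractf sum.distrib E_def flip: sum_distrib_left)
  also have "\<dots> \<le> (2 - 1 / 30000)\<^sup>2 * E"
    using gap sum_nonneg[of ?V "\<lambda>p. (f p)\<^sup>2"] by (simp add: E_def power2_eq_square)
  also have "\<dots> = ((2 - 1 / 30000) * ?L)\<^sup>2"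
    by (simp only: power_mult_distrib power2_L2_set E_def)
  finally have pair: "L2_set (\<lambda>p. f p + f (gen N g p)) ?V \<le> (2 - 1 / 30000) * ?L"
    by (rule power2_le_imp_le) (simp add: L2_set_nonneg)
  have "(\<lambda>p. \<Sum>g<5. f (gen N g p)) = (\<lambda>p. (f p + f (gen N g p)) + (\<Sum>g'\<in>{..<5} - {0, g}. f (gen N g' p)))"
  proof
    fix p
    have "{..<5} = insert 0 (insert g ({..<5} - {0, g}))"
      using g(1) by auto
    then have "(\<Sum>g<5. f (gen N g p)) = (\<Sum>g'\<in>insert 0 (insert g ({..<5} - {0, g})). f (gen N g' p))"
      by (rule arg_cong)
    also have "\<dots> = f (gen N 0 p) + (f (gen N g p) + (\<Sum>g'\<in>{..<5} - {0, g}. f (gen N g' p)))"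
      using g(1) by (subst sum.insert, simp, force)+ simp
    finally show "(\<Sum>g<5. f (gen N g p)) = (f p + f (gen N g p)) + (\<Sum>g'\<in>{..<5} - {0, g}. f (gen N g' p))"
      by (simp add: gen_def)
  qed
  then have "L2_set (\<lambda>p. \<Sum>g<5. f (gen N g p)) ?V
      \<le> L2_set (\<lambda>p. f p + f (gen N g p)) ?V + L2_set (\<lambda>p. \<Sum>g'\<in>{..<5} - {0, g}. f (gen N g' p)) ?V"
    using L2_set_triangle_ineq by simp
  also have "\<dots> \<le> (2 - 1 / 30000) * ?L + (\<Sum>g'\<in>{..<5} - {0, g}. ?L)"
    using pair L2_set_sum_le[of "{..<5} - {0, g}" "\<lambda>g' p. f (gen N g' p)" ?V]
    by (simp add: L2_set_gen)
  also have "(\<Sum>g'\<in>{..<5} - {0, g}. ?L) = 3 * ?L"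
    using g(1) by (auto simp: card_Diff_subset)
  finally show ?thesis
    by (simp add: algebra_simps)
qed (simp add: torus_def L2_set_def)

section \<open>Counting the walks confined to a set\<close>

fun visits :: "nat \<Rightarrow> nat list \<Rightarrow> nat \<times> nat \<Rightarrow> (nat \<times> nat) list" where
  "visits N [] p = [p]"
| "visits N (g # w) p = p # visits N w (gen N g p)"

definition extend :: "nat list list \<Rightarrow> nat list list" where
  "extend ws = concat (map (\<lambda>w. map (\<lambda>g. g # w) [0..<5]) ws)"

definition words :: "nat \<Rightarrow> nat list list" where
  "words d = (extend ^^ d) [[]]"

lemma length_concat_const: "(\<And>x. x \<in> set xs \<Longrightarrow> length (f x) = c) \<Longrightarrow> length (concat (map f xs)) = c * length xs"
  by (induction xs) auto

lemma words_0: "words 0 = [[]]"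
  and words_Suc: "words (Suc d) = extend (words d)"
  by (simp_all add: words_def)

lemma length_words: "length (words d) = 5 ^ d"
  by (induction d) (auto simp: words_0 words_Suc extend_def length_concat_const)

lemma words_length: "w \<in> set (words d) \<Longrightarrow> length w = d"
  by (induction d arbitrary: w) (auto simp: words_0 words_Suc extend_def)

text \<open>This counts the words of length \<open>d\<close> whose walk from \<open>p\<close> never
  leaves \<open>M\<close>, see \<open>stay_eq\<close>. The recursion displays the count as
  repeatedly summing over the generators and cutting off outside \<open>M\<close>, so that
  \<open>walk_contraction\<close> applies at every step.\<close>

fun stay :: "nat \<Rightarrow> (nat \<times> nat) set \<Rightarrow> nat \<Rightarrow> nat \<times> nat \<Rightarrow> real" where
  "stay N M 0 p = of_bool (p \<in> M)"
| "stay N M (Suc d) p = (if p \<in> M then \<Sum>g<5. stay N M d (gen N g p) else 0)"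

lemma stay_eq: "stay N M d p = (\<Sum>w\<leftarrow>words d. of_bool (set (visits N w p) \<subseteq> M))"
proof (induction d arbitrary: p)
  case (Suc d)
  have swap: "(\<Sum>w\<leftarrow>extend ws. \<phi> w) = (\<Sum>g<5. \<Sum>w\<leftarrow>ws. \<phi> (g # w))" for \<phi> :: "nat list \<Rightarrow> real" and ws
    by (induction ws) (auto simp: extend_def sum.distrib interv_sum_list_conv_sum_set_nat comp_def atLeast0LessThan)
  show ?case
    by (cases "p \<in> M") (simp_all add: words_Suc swap Suc)
qed (simp add: words_0)

lemma stay_nonneg: "0 \<le> stay N M d p"
  by (induction d arbitrary: p) (simp_all add: sum_nonneg del: split_paired_All)

lemma L2_set_stay:
  assumes "M \<subseteq> torus N" "12 * card M \<le> 11 * N\<^sup>2"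
  shows "L2_set (stay N M d) (torus N) \<le> (5 - 1 / 30000) ^ d * real N"
proof (induction d)
  case 0
  have "(\<Sum>p\<in>torus N. (stay N M 0 p)\<^sup>2) \<le> (\<Sum>p\<in>torus N. 1)"
    by (intro sum_mono) auto
  then have "(L2_set (stay N M 0) (torus N))\<^sup>2 \<le> (real N)\<^sup>2"
    by (simp add: power2_L2_set card_torus)
  then have "L2_set (stay N M 0) (torus N) \<le> real N"
    by (rule power2_le_imp_le) simp
  then show ?case by (simp only: power_0 mult_1)
next
  case (Suc d)
  have "L2_set (stay N M (Suc d)) (torus N) \<le> L2_set (\<lambda>p. \<Sum>g<5. stay N M d (gen N g p)) (torus N)"
    by (rule L2_set_mono) (simp_all add: stay_nonneg sum_nonneg)
  also have "\<dots> \<le> (5 - 1 / 30000) * L2_set (stay N M d) (torus N)"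
    by (rule walk_contraction[OF assms]) (cases d; simp)
  also have "\<dots> \<le> (5 - 1 / 30000) * ((5 - 1 / 30000) ^ d * real N)"
    by (rule mult_left_mono[OF Suc]) simp
  also have "\<dots> = (5 - 1 / 30000) ^ Suc d * real N"
    by (simp only: power_Suc mult.assoc)
  finally show ?case .
qed

text \<open>Passing from the quadratic to the plain sum costs a factor \<open>N\<close> by
  Cauchy-Schwarz, and the initial norm costs another. Relative to all \<open>5 ^ d\<close> words,
  each step retains at most the fraction
  \<open>(5 - 1 / 30000) / 5 = 1 - 1 / 150000\<close>.\<close>

lemma sum_stay_less:
  assumes "M \<subseteq> torus N" "12 * card M \<le> 11 * N\<^sup>2" "(1 - 1 / 150000) ^ d * (real N)\<^sup>2 < 1"
  shows "(\<Sum>p\<in>torus N. stay N M d p) < 5 ^ d"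
proof -
  have "(\<Sum>p\<in>torus N. stay N M d p * 1)\<^sup>2 \<le> (\<Sum>p\<in>torus N. (stay N M d p)\<^sup>2) * (\<Sum>p\<in>torus N. 1\<^sup>2)"
    by (rule Cauchy_Schwarz_sum)
  then have "(\<Sum>p\<in>torus N. stay N M d p)\<^sup>2 \<le> (L2_set (stay N M d) (torus N) * real N)\<^sup>2"
    by (simp add: power2_L2_set[symmetric] card_torus power_mult_distrib)
  then have "(\<Sum>p\<in>torus N. stay N M d p) \<le> L2_set (stay N M d) (torus N) * real N"
    by (rule power2_le_imp_le) (simp add: L2_set_nonneg)
  also have "\<dots> \<le> (5 - 1 / 30000) ^ d * real N * real N"
    by (intro mult_right_mono L2_set_stay assms) simp
  also have "\<dots> = 5 ^ d * ((1 - 1 / 150000) ^ d * (real N)\<^sup>2)"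
    by (simp add: power2_eq_square power_mult_distrib[symmetric])
  also have "\<dots> < 5 ^ d"
    using mult_strict_left_mono[OF assms(3), of "5 ^ d"] by simp
  finally show ?thesis .
qed

text \<open>A union bound over the starting points: if every word failed at some start, there would
  be at least \<open>5 ^ d\<close> confined pairs of a word and a start, against
  \<open>sum_stay_less\<close>. Hence one word serves all starts simultaneously.\<close>

lemma ex_escaping_walk:
  assumes M: "M \<subseteq> torus N" "12 * card M \<le> 11 * N\<^sup>2" and L: "N\<^sup>2 < 2 ^ L"
  shows "\<exists>w\<in>set (words (150000 * L)). \<forall>p\<in>torus N. \<not> set (visits N w p) \<subseteq> M"
proof (rule ccontr)
  assume "\<not> ?thesis"
  then have stuck: "\<exists>p\<in>torus N. set (visits N w p) \<subseteq> M" if "w \<in> set (words (150000 * L))" for w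
    using that by blast
  define d where "d = 150000 * L"
  \<comment> \<open>By \<open>1 - 1 / n \<le> exp (- 1 / n)\<close> the power is at most
    \<open>exp (- 1)\<close>, and \<open>exp 1\<close> is at least 2.\<close>
  have half: "(1 - 1 / 150000 :: real) ^ 150000 \<le> 1 / 2"
  proof -
    have "(1 - 1 / 150000 :: real) ^ 150000 \<le> exp (- 1 / 150000) ^ 150000"
      using exp_ge_add_one_self[of "- 1 / 150000 :: real"] by (intro power_mono) auto
    also have "\<dots> = exp (- 1)"
      by (subst exp_of_nat_mult[symmetric]) simp
    also have "\<dots> \<le> (1 / 2 :: real)"
      using exp_ge_add_one_self[of "1 :: real"] by (simp add: exp_minus divide_simps)
    finally show ?thesis .
  qed
  have "(1 - 1 / 150000 :: real) ^ d * (real N)\<^sup>2 \<le> (1 / 2) ^ L * (real N)\<^sup>2"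
    unfolding d_def power_mult by (intro mult_right_mono power_mono half) auto
  also have "\<dots> < (1 / 2) ^ L * 2 ^ L"
  proof (rule mult_strict_left_mono)
    have "real (N\<^sup>2) < real (2 ^ L)"
      using L by (rule of_nat_less_iff[THEN iffD2])
    then show "(real N)\<^sup>2 < 2 ^ L" by simp
  qed simp
  also have "\<dots> = 1"
    by (simp add: power_one_over)
  finally have "(\<Sum>p\<in>torus N. stay N M d p) < 5 ^ d"
    by (intro sum_stay_less M)
  moreover have "(\<Sum>p\<in>torus N. stay N M d p)
      = (\<Sum>w\<leftarrow>words d. \<Sum>p\<in>torus N. of_bool (set (visits N w p) \<subseteq> M))"
  proof -
    have "(\<Sum>p\<in>V. \<Sum>w\<leftarrow>ws. \<phi> p w) = (\<Sum>w\<leftarrow>ws. \<Sum>p\<in>V. \<phi> p w)"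
      for V :: "(nat \<times> nat) set" and ws :: "nat list list" and \<phi> :: "_ \<Rightarrow> _ \<Rightarrow> real"
      by (induction ws) (auto simp: sum.distrib)
    then show ?thesis by (simp add: stay_eq)
  qed
  moreover have "(\<Sum>w\<leftarrow>words d. 1) \<le> (\<Sum>w\<leftarrow>words d. \<Sum>p\<in>torus N. of_bool (set (visits N w p) \<subseteq> M) :: real)"
  proof (rule sum_list_mono)
    fix w
    assume "w \<in> set (words d)"
    then obtain p where p: "p \<in> torus N" "set (visits N w p) \<subseteq> M"
      using stuck unfolding d_def by blast
    have "of_bool (set (visits N w p) \<subseteq> M) \<le> (\<Sum>p\<in>torus N. of_bool (set (visits N w p) \<subseteq> M) :: real)"
      using p(1) by (intro member_le_sum) auto
    then show "1 \<le> (\<Sum>p\<in>torus N. of_bool (set (visits N w p) \<subseteq> M) :: real)"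
      using p(2) by simp
  qed
  ultimately show False
    by (simp add: sum_list_triv length_words)
qed

lemma visits_in_torus: "p \<in> torus N \<Longrightarrow> set (visits N w p) \<subseteq> torus N"
  by (induction w arbitrary: p) (auto simp: gen_in_torus)

text \<open>Each generator is a bijection of the torus, so at any fixed time at most one start has
  its walk at \<open>y\<close>, and there are \<open>length w + 1\<close> times. This is what limits
  the blue elements of a set.\<close>

lemma card_visits_le: "card {p\<in>torus N. y \<in> set (visits N w p)} \<le> length w + 1"
proof (induction w)
  case Nil
  have "{p\<in>torus N. y \<in> set (visits N [] p)} \<subseteq> {y}"
    by auto
  then show ?case
    by (metis card.empty card_insert_disjoint card_mono empty_iff finite.emptyI finite_insert list.size(3)
        One_nat_def add_0)
next
  case (Cons g w)
  let ?S = "{p\<in>torus N. y \<in> set (visits N w p)}"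
  have "{p\<in>torus N. y \<in> set (visits N (g # w) p)} \<subseteq> insert y {p\<in>torus N. gen N g p \<in> ?S}"
    by (auto simp: gen_in_torus)
  then have "card {p\<in>torus N. y \<in> set (visits N (g # w) p)} \<le> card (insert y {p\<in>torus N. gen N g p \<in> ?S})"
    by (intro card_mono) auto
  also have "\<dots> \<le> Suc (card {p\<in>torus N. gen N g p \<in> ?S})"
    by (rule card_insert_le_m1) auto
  also have "card {p\<in>torus N. gen N g p \<in> ?S} \<le> card ?S"
  proof (rule card_inj_on_le)
    show "inj_on (gen N g) {p\<in>torus N. gen N g p \<in> ?S}"
      using bij_betw_gen by (rule bij_betw_imp_inj_on[THEN inj_on_subset]) auto
  qed auto
  finally show ?case
    using Cons by simp
qed

section \<open>Multiply-shift hashing\<close>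

text \<open>For \<open>q = 2 ^ l\<close> and \<open>P = 2 ^ w\<close> these are the top
  \<open>l\<close> of the \<open>w\<close> low bits of \<open>a * i\<close>, see
  \<open>mshift_power2\<close>. Multiplying by \<open>q\<close> before dividing by \<open>P\<close>
  needs only the powers themselves, not their exponents.\<close>

definition mshift :: "nat \<Rightarrow> nat \<Rightarrow> nat \<Rightarrow> nat \<Rightarrow> nat" where
  "mshift q P a i = (a * i) mod P * q div P"

lemma mshift_less: "0 < q \<Longrightarrow> 0 < P \<Longrightarrow> mshift q P a i < q"
  unfolding mshift_def by (simp add: div_less_iff_less_mult mult.commute)

lemma mshift_power2: "l \<le> w \<Longrightarrow> mshift (2 ^ l) (2 ^ w) a i = (a * i) mod 2 ^ w div 2 ^ (w - l)"
  using div_mult_mult2[of "2 ^ l :: nat" "(a * i) mod 2 ^ w" "2 ^ (w - l)"]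
  by (simp add: mshift_def flip: power_add)

text \<open>Write \<open>i - j = 2 ^ t * u\<close> with \<open>u\<close> odd. A collision puts the
  residue of \<open>a * (i - j)\<close> within \<open>s = 2 ^ (w - l)\<close> of 0 on the cycle, and
  this residue is \<open>2 ^ t\<close> times the odd number \<open>(a * u) mod 2 ^ (w - t)\<close>.
  As \<open>a\<close> varies, that number takes each value at most \<open>2 ^ t\<close> times, so it
  remains to count odd numbers close to 0. Against \<open>2 ^ (w - 1)\<close> odd multipliers the
  bound is a collision probability of \<open>2 / 2 ^ l\<close>.\<close>

lemma card_mshift_collision_aux:
  fixes w l i j :: nat
  assumes "l \<le> w" "j < i" "i < 2 ^ w"
  shows "card {a. a < 2 ^ w \<and> odd a \<and> mshift (2 ^ l) (2 ^ w) a i = mshift (2 ^ l) (2 ^ w) a j} \<le> 2 ^ (w - l)"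
    (is "card ?A \<le> _")
proof -
  define z where "z = i - j"
  have "z \<noteq> 0" "z < 2 ^ w"
    using assms by (auto simp: z_def)
  obtain t u where u: "z = 2 ^ t * u" "odd u"
  proof -
    obtain u where "z = 2 ^ multiplicity 2 z * u" "\<not> 2 dvd u"
      using \<open>z \<noteq> 0\<close> by (rule multiplicity_decompose'[where p = 2]) auto
    then show ?thesis by (intro that[of "multiplicity 2 z" u]) auto
  qed
  have "2 ^ t \<le> z"
    using \<open>z \<noteq> 0\<close> u(1) by (cases u) auto
  then have "(2::nat) ^ t < 2 ^ w"
    using \<open>z < 2 ^ w\<close> by (rule order_le_less_trans)
  then have t: "t < w" by simp
  define s where "s = (2::nat) ^ (w - l)"
  define P' where "P' = (2::nat) ^ (w - t)"
  have P: "2 ^ w = 2 ^ t * P'"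
    using t by (simp add: P'_def flip: power_add)
  have "even P'" using t by (simp add: P'_def)
  have near: "2 ^ t * ((a * u) mod P') < s \<or> 2 ^ w < 2 ^ t * ((a * u) mod P') + s" if "a \<in> ?A" for a
  proof -
    define r r' where "r = (a * i) mod 2 ^ w" and "r' = (a * j) mod 2 ^ w"
    have "r div s = r' div s"
      using that assms(1) by (simp add: mshift_power2 r_def r'_def s_def)
    then have "r = r' div s * s + r mod s" "r' = r' div s * s + r' mod s"
      using div_mult_mod_eq[of r s] div_mult_mod_eq[of r' s] by simp_all
    moreover have "r mod s < s" "r' mod s < s"
      by (simp_all add: s_def)
    ultimately have "\<bar>int r - int r'\<bar> < int s"
      by linarith
    moreover have lt: "int r < int (2 ^ w)" "int r' < int (2 ^ w)"
      unfolding of_nat_less_iff by (simp_all add: r_def r'_def)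
    moreover have "int (2 ^ t * ((a * u) mod P')) = (int r - int r') mod int (2 ^ w)"
    proof -
      have "a * z = 2 ^ t * (a * u)"
        using u(1) by simp
      then have "2 ^ t * ((a * u) mod P') = (a * z) mod 2 ^ w"
        by (simp only: P mod_mult_mult1)
      moreover have "int ((a * z) mod 2 ^ w) = (int (a * i) - int (a * j)) mod int (2 ^ w)"
        using assms(2) by (simp add: z_def zmod_int of_nat_diff right_diff_distrib')
      moreover have "\<dots> = (int r - int r') mod int (2 ^ w)"
        unfolding r_def r'_def zmod_int by (rule mod_diff_eq[symmetric])
      ultimately show ?thesis by (simp only:)
    qed
    moreover have "(int r - int r') mod int (2 ^ w)
        = (if r' \<le> r then int r - int r' else int r - int r' + int (2 ^ w))"
    proof (cases "r' \<le> r")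
      case True
      then show ?thesis using lt by (simp add: mod_pos_pos_trivial del: of_nat_power)
    next
      case False
      then have "(int r - int r' + int (2 ^ w)) mod int (2 ^ w) = int r - int r' + int (2 ^ w)"
        using lt by (intro mod_pos_pos_trivial) linarith+
      then show ?thesis using False by (simp del: of_nat_power)
    qed
    ultimately have "int (2 ^ t * ((a * u) mod P')) < int s
        \<or> int (2 ^ w) < int (2 ^ t * ((a * u) mod P')) + int s"
      by (cases "r' \<le> r") (simp_all only: if_True if_False, linarith+)
    then show ?thesis
      by (simp only: of_nat_less_iff flip: of_nat_add)
  qed
  have odd: "odd ((a * u) mod P')" if "a \<in> ?A" for a
    using that u(2) \<open>even P'\<close> by (simp add: dvd_mod_iff)
  show ?thesis
  proof (cases "s \<le> 2 ^ t")
    case True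
    \<comment> \<open>A nonzero multiple of \<open>2 ^ t\<close> keeps distance at least
      \<open>2 ^ t\<close> from 0 on the cycle, and this is at least \<open>s\<close>, so there is
      no collision at all.\<close>
    have False if "a \<in> ?A" for a
    proof -
      let ?e = "(a * u) mod P'"
      have "?e < P'" by (simp add: P'_def)
      then have "2 ^ t * (?e + 1) \<le> 2 ^ w"
        unfolding P by (intro mult_left_mono) auto
      moreover have "?e \<noteq> 0" using odd[OF that] by (metis even_zero)
      then have "(2::nat) ^ t \<le> 2 ^ t * ?e" by (cases ?e) auto
      ultimately show False
        using near[OF that] True by (simp only: distrib_left mult_1_right) linarith
    qed
    then have "?A = {}" by blast
    then show ?thesis by (simp only: card.empty le0)
  next
    case False
    then have lt: "t < w - l"
      by (simp add: s_def)
    define s' where "s' = (2::nat) ^ (w - l - t - 1)"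
    have s': "s = 2 ^ t * (2 * s')"
      using lt unfolding s_def s'_def by (simp flip: power_add power_Suc)
    obtain Q where Q: "P' = 2 * Q"
      using \<open>even P'\<close> by blast
    \<comment> \<open>Halving loses nothing because the residue is odd, and it leaves
      \<open>s'\<close> values at either end of the cycle; the second component records which of the
      \<open>2 ^ t\<close> lifts \<open>a\<close> is.\<close>
    define \<phi> where "\<phi> a = ((a * u) mod P' div 2, a div P')" for a
    have "card ?A \<le> card (({..<s'} \<union> {Q - s'..<Q}) \<times> {..<2 ^ t :: nat})"
    proof (rule card_inj_on_le)
      show "inj_on \<phi> ?A"
      proof (rule inj_onI)
        fix a b
        assume ab: "a \<in> ?A" "b \<in> ?A" "\<phi> a = \<phi> b"
        then have "(a * u) mod P' = (b * u) mod P'"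
          using odd[OF ab(1)] odd[OF ab(2)] by (metis \<phi>_def fst_conv odd_two_times_div_two_succ)
        then have "[a * u = b * u] (mod P')"
          by (simp add: cong_def)
        moreover have "coprime u P'"
          using u(2) by (simp add: P'_def)
        ultimately have "[a = b] (mod P')"
          using cong_mult_rcancel_nat by blast
        then have "a mod P' = b mod P'"
          by (simp add: cong_def)
        then show "a = b"
          using ab(3) by (metis \<phi>_def div_mult_mod_eq snd_conv)
      qed
      show "\<phi> ` ?A \<subseteq> ({..<s'} \<union> {Q - s'..<Q}) \<times> {..<2 ^ t}"
      proof
        fix y
        assume "y \<in> \<phi> ` ?A"
        then obtain a where a: "a \<in> ?A" "y = \<phi> a" by blast
        let ?e = "(a * u) mod P'"
        have e: "?e < P'" by (simp add: P'_def)
        have "2 ^ t * ?e < 2 ^ t * (2 * s') \<or> 2 ^ t * P' < 2 ^ t * (?e + 2 * s')"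
          using near[OF a(1)] unfolding s' P by (simp add: distrib_left)
        then have "?e < 2 * s' \<or> P' < ?e + 2 * s'"
          by simp
        then have "?e div 2 < s' \<or> Q - s' \<le> ?e div 2 \<and> ?e div 2 < Q"
          using e unfolding Q by linarith
        moreover have "a div P' < 2 ^ t"
          using a(1) by (simp add: div_less_iff_less_mult P P'_def)
        ultimately show "y \<in> ({..<s'} \<union> {Q - s'..<Q}) \<times> {..<2 ^ t}"
          by (auto simp: a(2) \<phi>_def)
      qed
    qed simp
    also have "\<dots> \<le> (s' + s') * 2 ^ t"
      unfolding card_cartesian_product
      by (intro mult_mono order_trans[OF card_Un_le] add_mono) auto
    also have "\<dots> = s"
      unfolding s' by simp
    finally show ?thesis
      by (simp add: s_def)
  qed
qed

lemma card_mshift_collision: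
  assumes "l \<le> w" "i \<noteq> j" "i < 2 ^ w" "j < 2 ^ w"
  shows "card {a. a < 2 ^ w \<and> odd a \<and> mshift (2 ^ l) (2 ^ w) a i = mshift (2 ^ l) (2 ^ w) a j} \<le> 2 ^ (w - l)"
proof (cases "j < i")
  case True
  then show ?thesis using card_mshift_collision_aux assms by blast
next
  case False
  then have "i < j" using assms by simp
  from card_mshift_collision_aux[OF assms(1) this assms(4)] show ?thesis
    by (simp add: eq_commute)
qed

text \<open>The squares of the fibre sizes add up to the number of pairs with equal values, at most
  \<open>3 * card I\<close> with the diagonal; Cauchy-Schwarz turns a small sum of squares into many
  fibres.\<close>

lemma card_image_collisions:
  fixes h :: "'a \<Rightarrow> 'b"
  assumes I: "finite I" and c: "card {(i, j)\<in>I \<times> I. i \<noteq> j \<and> h i = h j} \<le> 2 * card I"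
  shows "card I \<le> 3 * card (h ` I)"
proof -
  define n where "n b = card {i\<in>I. h i = b}" for b
  have n: "(\<Sum>b\<in>h ` I. n b) = card I"
    using sum.image_gen[OF I, of "\<lambda>_. 1 :: nat" h] by (simp add: n_def conj_commute)
  have "(\<Sum>b\<in>h ` I. n b * n b) = (\<Sum>i\<in>I. n (h i))"
    using sum.image_gen[OF I, of "\<lambda>i. n (h i)" h] by (simp add: n_def conj_commute cong: conj_cong)
  also have "\<dots> = card (SIGMA i:I. {j\<in>I. h j = h i})"
    unfolding n_def using I by simp
  also have "(SIGMA i:I. {j\<in>I. h j = h i}) = (\<lambda>i. (i, i)) ` I \<union> {(i, j)\<in>I \<times> I. i \<noteq> j \<and> h i = h j}"
    by auto
  also have "card \<dots> \<le> card I + 2 * card I"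
    using c by (intro order_trans[OF card_Un_le] add_mono card_image_le I)
  finally have sq: "(\<Sum>b\<in>h ` I. n b * n b) \<le> 3 * card I"
    by simp
  have "(\<Sum>b\<in>h ` I. real (n b) * 1)\<^sup>2 \<le> (\<Sum>b\<in>h ` I. (real (n b))\<^sup>2) * (\<Sum>b\<in>h ` I. 1\<^sup>2)"
    by (rule Cauchy_Schwarz_sum)
  then have "real ((\<Sum>b\<in>h ` I. n b) * (\<Sum>b\<in>h ` I. n b)) \<le> real ((\<Sum>b\<in>h ` I. n b * n b) * card (h ` I))"
    by (simp add: power2_eq_square)
  then have "card I * card I \<le> (\<Sum>b\<in>h ` I. n b * n b) * card (h ` I)"
    unfolding n by (simp only: of_nat_le_iff)
  also have "\<dots> \<le> 3 * card I * card (h ` I)"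
    using sq by (intro mult_right_mono) auto
  finally have "card I * card I \<le> card I * (3 * card (h ` I))"
    by simp
  then show ?thesis
    by (cases "card I = 0") auto
qed

text \<open>Averaging over the odd multipliers: there are at most \<open>card I * card I\<close>
  pairs, each colliding for at most a fraction \<open>2 / 2 ^ l\<close> of the multipliers, so some
  multiplier has at most \<open>2 * card I\<close> collisions.\<close>

lemma ex_good_mshift:
  assumes I: "I \<subseteq> {..<2 ^ w}" "card I \<le> 2 ^ l" and "l \<le> w"
  shows "\<exists>a<2 ^ w. card I \<le> 3 * card (mshift (2 ^ l) (2 ^ w) a ` I)"
proof (cases "w = 0")
  \<comment> \<open>For \<open>w = 0\<close> no odd multiplier lies below \<open>2 ^ w\<close>, but
    then \<open>I\<close> has at most one element and 0 will do.\<close>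
  case True
  have "mshift (2 ^ l) (2 ^ w) 0 ` I = {} \<longleftrightarrow> I = {}"
    by blast
  moreover have "card I \<le> 1"
    using I(1) True card_mono[of "{..<2 ^ w}" I] by simp
  moreover have fin: "finite I"
    using I(1) finite_subset by blast
  ultimately have "card I \<le> 3 * card (mshift (2 ^ l) (2 ^ w) 0 ` I)"
    by (cases "I = {}") (auto simp: card_gt_0_iff Suc_le_eq intro: order_trans)
  then show ?thesis by (intro exI[of _ 0]) auto
next
  case False
  have fin: "finite I"
    using I(1) finite_subset by blast
  let ?h = "mshift (2 ^ l) (2 ^ w)"
  define A where "A = {a. a < (2::nat) ^ w \<and> odd a}"
  define D where "D = {(i, j)\<in>I \<times> I. i \<noteq> j}"
  have D: "finite D" "card D \<le> card I * card I"
  proof -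
    have "D \<subseteq> I \<times> I" by (auto simp: D_def)
    then show "finite D" "card D \<le> card I * card I"
      using fin card_mono[of "I \<times> I" D] finite_subset by (auto simp: card_cartesian_product)
  qed
  have A: "finite A" "2 * card A = 2 ^ w"
  proof -
    have "A = (\<lambda>k. 2 * k + 1) ` {..<2 ^ (w - 1)}"
    proof (intro equalityI subsetI)
      fix a assume "a \<in> A"
      then obtain k where "a = 2 * k + 1" "2 * k + 1 < (2::nat) ^ w"
        by (auto simp: A_def elim: oddE)
      moreover have "(2::nat) ^ w = 2 * 2 ^ (w - 1)"
        using False by (cases w) auto
      ultimately show "a \<in> (\<lambda>k. 2 * k + 1) ` {..<2 ^ (w - 1)}" by auto
    next
      fix a assume "a \<in> (\<lambda>k. 2 * k + 1) ` {..<(2::nat) ^ (w - 1)}"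
      moreover have "(2::nat) ^ w = 2 * 2 ^ (w - 1)"
        using False by (cases w) auto
      ultimately show "a \<in> A" by (auto simp: A_def)
    qed
    then have "card A = 2 ^ (w - 1)" "finite A"
      by (simp_all add: card_image inj_on_def)
    then show "finite A" "2 * card A = 2 ^ w"
      using False by (cases w; simp)+
  qed
  have "\<exists>a\<in>A. card {(i, j)\<in>I \<times> I. i \<noteq> j \<and> ?h a i = ?h a j} \<le> 2 * card I"
  proof (rule ccontr)
    assume "\<not> ?thesis"
    then have many: "2 * card I + 1 \<le> card {(i, j)\<in>I \<times> I. i \<noteq> j \<and> ?h a i = ?h a j}" if "a \<in> A" for a
      using that by (simp add: not_le Suc_le_eq)
    have "2 ^ w * card I + card A = (\<Sum>a\<in>A. 2 * card I + 1)"
      using A(2) by (simp add: algebra_simps)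
    also have "\<dots> \<le> (\<Sum>a\<in>A. card {(i, j)\<in>I \<times> I. i \<noteq> j \<and> ?h a i = ?h a j})"
      by (intro sum_mono many)
    also have "\<dots> = (\<Sum>a\<in>A. \<Sum>p\<in>D. of_bool (?h a (fst p) = ?h a (snd p)))"
    proof (intro sum.cong refl)
      fix a
      have "{(i, j)\<in>I \<times> I. i \<noteq> j \<and> ?h a i = ?h a j} = D \<inter> {p. ?h a (fst p) = ?h a (snd p)}"
        by (auto simp: D_def)
      then show "card {(i, j)\<in>I \<times> I. i \<noteq> j \<and> ?h a i = ?h a j} = (\<Sum>p\<in>D. of_bool (?h a (fst p) = ?h a (snd p)))"
        using D(1) by simp
    qed
    also have "\<dots> = (\<Sum>p\<in>D. \<Sum>a\<in>A. of_bool (?h a (fst p) = ?h a (snd p)))"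
      by (rule sum.swap)
    also have "\<dots> \<le> (\<Sum>p\<in>D. 2 ^ (w - l))"
    proof (rule sum_mono)
      fix p
      assume "p \<in> D"
      then have "card {a. a < 2 ^ w \<and> odd a \<and> ?h a (fst p) = ?h a (snd p)} \<le> 2 ^ (w - l)"
        using I(1) by (intro card_mshift_collision assms) (auto simp: D_def)
      moreover have "{a. a < 2 ^ w \<and> odd a \<and> ?h a (fst p) = ?h a (snd p)} = A \<inter> {a. ?h a (fst p) = ?h a (snd p)}"
        by (auto simp: A_def)
      ultimately show "(\<Sum>a\<in>A. of_bool (?h a (fst p) = ?h a (snd p))) \<le> (2::nat) ^ (w - l)"
        using A(1) by simp
    qed
    also have "\<dots> \<le> card I * card I * 2 ^ (w - l)"
      using D(2) by simp
    also have "\<dots> \<le> card I * 2 ^ l * 2 ^ (w - l)"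
      using I(2) by (intro mult_right_mono mult_left_mono) auto
    also have "\<dots> = 2 ^ w * card I"
      using assms(3) by (simp add: mult.assoc mult.commute flip: power_add)
    finally have "card A = 0" by simp
    then show False using A(2) by simp
  qed
  then show ?thesis
    using card_image_collisions[OF fin] by (auto simp: A_def)
qed

section \<open>The algorithm\<close>

definition double_while :: "(nat \<Rightarrow> bool) \<Rightarrow> nat \<Rightarrow> nat \<times> nat" where
  "double_while Q t = ((\<lambda>s. if Q (fst s) then (2 * fst s, Suc (snd s)) else s) ^^ t) (1, 0)"

text \<open>\<open>double_while\<close> searches for the least power of two that refutes
  \<open>Q\<close>, together with its exponent. The guard matters: numbers are unary, so doubling
  blindly for \<open>t\<close> rounds would produce exponentially large trees. The part
  \<open>2 ^ j \<le> 2 * b\<close> is the size bound needed by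
  \<open>polytime_double_while\<close>.\<close>

lemma double_while_invariant:
  assumes "\<And>N. Q N \<Longrightarrow> N \<le> b"
  shows "\<exists>j\<le>t. double_while Q t = (2 ^ j, j) \<and> (j < t \<longrightarrow> \<not> Q (2 ^ j)) \<and> (j = 0 \<or> 2 ^ j \<le> 2 * b \<and> Q (2 ^ (j - 1)))"
proof (induction t)
  case 0
  then show ?case by (simp add: double_while_def)
next
  case (Suc t)
  then obtain j where j: "j \<le> t" "double_while Q t = (2 ^ j, j)" "j < t \<longrightarrow> \<not> Q (2 ^ j)"
    "j = 0 \<or> 2 ^ j \<le> 2 * b \<and> Q (2 ^ (j - 1))"
    by blast
  show ?case
  proof (cases "Q (2 ^ j)")
    case True
    then show ?thesis
      using j assms[OF True] by (intro exI[of _ "Suc j"]) (auto simp: double_while_def)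
  next
    case False
    then show ?thesis
      using j by (intro exI[of _ j]) (auto simp: double_while_def)
  qed
qed

lemma double_while_cases:
  assumes "\<And>N. Q N \<Longrightarrow> N \<le> t"
  obtains j where "double_while Q t = (2 ^ j, j)" "\<not> Q (2 ^ j)" "j = 0 \<or> Q (2 ^ (j - 1))"
proof -
  obtain j where j: "j \<le> t" "double_while Q t = (2 ^ j, j)" "j < t \<longrightarrow> \<not> Q (2 ^ j)"
    "j = 0 \<or> Q (2 ^ (j - 1))"
    using double_while_invariant[of Q t t] assms by blast
  moreover have "\<not> Q (2 ^ j)"
  proof (cases "j < t")
    case False
    then have "t < 2 ^ j"
      using j(1) by (simp add: le_antisym)
    then show ?thesis using assms[of "2 ^ j"] by auto
  qed (use j in blast)
  ultimately show ?thesis using that by blast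
qed

lemma polytime_double_while:
  assumes Q: "polytime (\<lambda>p. Q (fst p) (snd p))" and t: "polytime t" and b: "\<And>x N. Q x N \<Longrightarrow> N \<le> t x"
  shows "polytime (\<lambda>x. double_while (Q x) (t x))"
  unfolding double_while_def
proof (rule polytime_funpow[where B = "\<lambda>x. 10 + 8 * esize (t x)"])
  fix x i
  assume i: "i \<le> t x"
  obtain j where j: "j \<le> i" "double_while (Q x) i = (2 ^ j, j)" "j = 0 \<or> 2 ^ j \<le> 2 * t x"
    using double_while_invariant[of "Q x" "t x" i] b by blast
  have "esize ((2::nat) ^ j, j) \<le> 10 + 8 * esize (t x)"
    using j i by (auto simp: esize_nat)
  then show "esize (((\<lambda>s. if Q x (fst s) then (2 * fst s, Suc (snd s)) else s) ^^ i) (1, 0)) \<le> 10 + 8 * esize (t x)"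
    using j(2) unfolding double_while_def by simp
next
  have "polytime (\<lambda>p :: 'a \<times> nat \<times> nat. Q (fst p) (fst (snd p)))"
  proof -
    have "polytime (\<lambda>p :: 'a \<times> nat \<times> nat. (fst p, fst (snd p)))"
      by (intro polytime_intros)
    from polytime_comp[OF this Q] show ?thesis by simp
  qed
  then show "polytime (\<lambda>p :: 'a \<times> nat \<times> nat. if Q (fst p) (fst (snd p))
      then (2 * fst (snd p), Suc (snd (snd p))) else snd p)"
    by (intro polytime_intros)
qed (rule t polytime_const poly_bounded_add poly_bounded_mult poly_bounded_const poly_bounded_esize)+

lemma polytime_gen [polytime_intros]:
  assumes "polytime N" "polytime g" "polytime p"
  shows "polytime (\<lambda>x. gen (N x) (g x) (p x))"
  unfolding gen_def by (intro polytime_intros assms)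

lemma visits_foldl:
  "visits N w p = (let s = foldl (\<lambda>s g. (gen N g (fst s), snd s @ [fst s])) (p, []) w in snd s @ [fst s])"
proof -
  have "acc @ visits N w p = (let s = foldl (\<lambda>s g. (gen N g (fst s), snd s @ [fst s])) (p, acc) w in snd s @ [fst s])" for acc
  proof (induction w arbitrary: p acc)
    case (Cons g w)
    show ?case using Cons.IH[of "acc @ [p]" "gen N g p"] by simp
  qed simp
  from this[of "[]"] show ?thesis by simp
qed

text \<open>\<open>gen\<close> leaves a coordinate unchanged or makes it less than \<open>N\<close>,
  which keeps the accumulated list polynomial even for starts outside the torus.\<close>

lemma polytime_visits [polytime_intros]:
  assumes N: "polytime N" and w: "polytime w" and p: "polytime p"
  shows "polytime (\<lambda>x. visits (N x) (w x) (p x))"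
proof -
  define f where "f N = (\<lambda>(s :: (nat \<times> nat) \<times> (nat \<times> nat) list) g. (gen N g (fst s), snd s @ [fst s]))" for N
  define K where "K x = esize (p x) + 2 * esize (N x)" for x
  have K: "poly_bounded K"
    unfolding K_def by (intro poly_bounded_add poly_bounded_mult poly_bounded_const poly_bounded_esize N p)
  have "polytime (\<lambda>x. foldl (f (N x)) (p x, []) (w x))"
  proof (rule polytime_foldl[where B = "\<lambda>x. 2 + K x + esize (w x) * (1 + K x)"])
    fix x ys zs
    assume ys: "w x = ys @ zs"
    define ok where "ok q \<longleftrightarrow> fst q \<le> fst (p x) + N x \<and> snd q \<le> snd (p x) + N x" for q
    have ok: "esize q \<le> K x" if "ok q" for q
      using that unfolding ok_def K_def by (cases q; cases "p x") (simp add: esize_nat)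
    have "length (snd (foldl (f (N x)) (p x, []) ys)) = length ys
      \<and> (\<forall>q\<in>set (snd (foldl (f (N x)) (p x, []) ys)). ok q) \<and> ok (fst (foldl (f (N x)) (p x, []) ys))"
    proof (induction ys rule: rev_induct)
      case (snoc g ys)
      have "ok (gen (N x) g q)" if "ok q" for q
      proof -
        have "fst (gen (N x) g q) \<le> fst q \<or> fst (gen (N x) g q) \<le> N x"
          "snd (gen (N x) g q) \<le> snd q \<or> snd (gen (N x) g q) \<le> N x"
          by (auto simp: gen_def intro: less_imp_le)
        then show ?thesis using that unfolding ok_def by linarith
      qed
      then show ?case using snoc by (auto simp: f_def)
    qed (simp add: ok_def)
    moreover obtain a l where al: "foldl (f (N x)) (p x, []) ys = (a, l)"
      by fastforce
    ultimately have "length l = length ys" "\<And>q. q \<in> set l \<Longrightarrow> esize q \<le> K x" "esize a \<le> K x"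
      using ok by auto
    moreover have "length ys \<le> esize (w x)"
      using length_le_esize[of "w x"] ys by simp
    ultimately have "esize a + esize l \<le> K x + (1 + esize (w x) * (1 + K x))"
      by (intro add_mono order_trans[OF esize_list_le[of l "K x"]] add_left_mono mult_right_mono) auto
    then show "esize (foldl (f (N x)) (p x, []) ys) \<le> 2 + K x + esize (w x) * (1 + K x)"
      unfolding al by simp
  next
    show "polytime (\<lambda>q. f (N (fst q)) (fst (snd q)) (snd (snd q)))"
      unfolding f_def by (intro polytime_intros polytime_comp[OF _ N])
  qed (rule p w polytime_Pair polytime_const K poly_bounded_add poly_bounded_mult poly_bounded_const poly_bounded_esize)+
  then have "polytime (\<lambda>x. snd (foldl (f (N x)) (p x, []) (w x)) @ [fst (foldl (f (N x)) (p x, []) (w x))])"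
    by (intro polytime_intros)
  then show ?thesis
    unfolding visits_foldl f_def Let_def .
qed

lemma polytime_extend [polytime_intros]: "polytime ws \<Longrightarrow> polytime (\<lambda>x. extend (ws x))"
  unfolding extend_def by (intro polytime_intros)

lemma esize_words: "esize (words d) \<le> 1 + 5 ^ d * (2 + 10 * d)"
proof -
  have mem: "g < 5" if "w \<in> set (words d)" "g \<in> set w" for w g
    using that by (induction d arbitrary: w) (auto simp: words_0 words_Suc extend_def)
  have "esize w \<le> 1 + 10 * d" if "w \<in> set (words d)" for w
  proof -
    have "esize w \<le> 1 + length w * (1 + 9)"
      using mem[OF that] by (intro esize_list_le) (force simp: esize_nat)
    then show ?thesis using words_length[OF that] by simp
  qed
  then have "esize (words d) \<le> 1 + length (words d) * (1 + (1 + 10 * d))"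
    by (rule esize_list_le)
  then show ?thesis by (simp add: length_words)
qed

text \<open>There are \<open>5 ^ d\<close> words, so a polynomial bound on that number has to be
  supplied; it holds for words of logarithmic length, see \<open>walk_length_bound\<close>.\<close>

lemma polytime_words:
  assumes d: "polytime d" and B: "poly_bounded B" "\<And>x. 5 ^ d x \<le> B x"
  shows "polytime (\<lambda>x. words (d x))"
  unfolding words_def
proof (rule polytime_funpow[where B = "\<lambda>x. 1 + B x * (2 + 10 * esize (d x))"])
  fix x i
  assume i: "i \<le> d x"
  have "(5::nat) ^ i \<le> 5 ^ d x"
    using i by (intro power_increasing) auto
  then have "(5::nat) ^ i \<le> B x"
    using B(2) order_trans by blast
  then have "1 + 5 ^ i * (2 + 10 * i) \<le> 1 + B x * (2 + 10 * esize (d x))"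
    using i by (intro add_left_mono mult_mono) (auto simp: esize_nat)
  then show "esize ((extend ^^ i) [[]]) \<le> 1 + B x * (2 + 10 * esize (d x))"
    using esize_words[of i] unfolding words_def by linarith
qed (rule d B polytime_const polytime_extend polytime_snd polytime_id poly_bounded_add poly_bounded_mult poly_bounded_const poly_bounded_esize)+

text \<open>Along a walk the fraction of surviving words shrinks by \<open>1 - 1 / 150000\<close> per step, hence by
  \<open>1 / 2\<close> per 150000 steps; it has to fall below \<open>1 / N\<^sup>2\<close>, where \<open>N\<^sup>2 < 4 k\<close>.\<close>

definition walk_length :: "nat \<Rightarrow> nat" where
  "walk_length k = 150000 * (snd (double_while (\<lambda>N. N < k) k) + 2)"

lemma double_while_less:
  obtains j where "double_while (\<lambda>N. N < k) k = (2 ^ j, j)" "k \<le> 2 ^ j" "j = 0 \<or> 2 ^ (j - 1) < k"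
  by (rule double_while_cases[of "\<lambda>N. N < k" k]) auto

text \<open>From \<open>5 \<le> 8 = 2 ^ 3\<close> follows
  \<open>5 ^ (j + 2) \<le> (2 ^ (j + 2)) ^ 3\<close>, and this power of two is at most
  \<open>8 * (k + 1)\<close>. The resulting exponent is huge but constant.\<close>

lemma walk_length_bound: "5 ^ walk_length k \<le> ((8 * (k + 1)) ^ 3) ^ 150000"
proof -
  obtain j where j: "double_while (\<lambda>N. N < k) k = (2 ^ j, j)" "j = 0 \<or> 2 ^ (j - 1) < k"
    by (rule double_while_less)
  have "2 ^ j \<le> 2 * (k + 1)"
    using j(2) by (cases j) auto
  then have "2 ^ (j + 2) \<le> 8 * (k + 1)"
    by simp
  then have "(2 ^ (j + 2)) ^ 3 \<le> (8 * (k + 1)) ^ 3"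
    by (intro power_mono) auto
  moreover have "(5::nat) ^ (j + 2) \<le> 8 ^ (j + 2)"
    by (intro power_mono) auto
  moreover have "(2 ^ (j + 2)) ^ 3 = (8::nat) ^ (j + 2)"
  proof -
    have "(8::nat) = 2 ^ 3" by simp
    then show ?thesis by (simp only: power_mult[symmetric] mult.commute)
  qed
  ultimately have "(5::nat) ^ (j + 2) \<le> (8 * (k + 1)) ^ 3"
    by linarith
  then have "((5::nat) ^ (j + 2)) ^ 150000 \<le> ((8 * (k + 1)) ^ 3) ^ 150000"
    by (rule power_mono) (rule le0)
  then show ?thesis
    unfolding walk_length_def j(1) snd_conv by (subst mult.commute) (simp only: power_mult)
qed

lemma polytime_walk_length [polytime_intros]:
  assumes "polytime k"
  shows "polytime (\<lambda>x. walk_length (k x))"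
  unfolding walk_length_def
  by (intro polytime_intros polytime_double_while assms polytime_comp[OF _ assms]) auto

lemma polytime_words_walk_length [polytime_intros]:
  assumes k: "polytime k"
  shows "polytime (\<lambda>x. words (walk_length (k x)))"
proof (rule polytime_words)
  show "poly_bounded (\<lambda>x. ((8 * (esize (k x) + 1)) ^ 3) ^ 150000)"
    by (intro poly_bounded_power poly_bounded_mult poly_bounded_add poly_bounded_const poly_bounded_esize k)
  show "5 ^ walk_length (k x) \<le> ((8 * (esize (k x) + 1)) ^ 3) ^ 150000" for x
    by (rule order_trans[OF walk_length_bound], intro power_mono) (auto simp: esize_nat)
qed (intro polytime_intros k)

lemma polytime_mshift [polytime_intros]:
  assumes "polytime q" "polytime P" "polytime a" "polytime i"
  shows "polytime (\<lambda>x. mshift (q x) (P x) (a x) (i x))"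
  unfolding mshift_def by (intro polytime_intros assms)

text \<open>Red count, blue count, and a pair of bit vectors per set, arranged such that
  \<open>enc\<close> yields the very tree that encodes the corresponding instance, see
  \<open>encode_decode_rb\<close>.\<close>

type_synonym rb_code = "nat \<times> nat \<times> (bool list \<times> bool list) list"

text \<open>The torus point \<open>(x, y)\<close> bears the number \<open>x * N + y\<close>, which
  identifies the torus with the range of the hash function.\<close>

definition covers :: "nat \<Rightarrow> nat \<Rightarrow> nat \<Rightarrow> nat list \<Rightarrow> nat \<Rightarrow> nat \<times> nat \<Rightarrow> bool" where
  "covers N P a w i p \<longleftrightarrow> (\<exists>y\<in>set (visits N w p). fst y * N + snd y = mshift (N * N) P a i)"

text \<open>Keeping the selected sets, stripped of blue elements, leaves all indices aligned with
  those of \<open>rows\<close>, while the covering has to be done by unselected sets.\<close>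

definition residual :: "nat \<Rightarrow> nat \<Rightarrow> nat \<Rightarrow> bool list list \<Rightarrow> bool list \<Rightarrow> nat \<times> nat list \<Rightarrow> rb_code" where
  "residual n N P rows U aw = (n, N * N, map (\<lambda>i. (nth_default [] rows i,
     map (\<lambda>p. \<not> nth_default False U i \<and> covers N P (fst aw) (snd aw) i p) (List.product [0..<N] [0..<N])))
       [0..<length rows])"

definition union_cost :: "nat \<Rightarrow> bool list list \<Rightarrow> bool list \<Rightarrow> nat" where
  "union_cost n rows J = length (filter (\<lambda>e. \<exists>i\<in>set [0..<length rows].
     nth_default False J i \<and> nth_default False (nth_default [] rows i) e) [0..<n])"

definition argmin :: "('a \<Rightarrow> nat) \<Rightarrow> 'a \<Rightarrow> 'a list \<Rightarrow> 'a" where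
  "argmin f b xs = foldl (\<lambda>b x. if f x < f b then x else b) b xs"

definition count_true :: "bool list \<Rightarrow> nat" where
  "count_true U = length (filter (\<lambda>b. b) U)"

definition side :: "nat \<Rightarrow> nat" where
  "side r = fst (double_while (\<lambda>N. N * N < r) r)"

definition modulus :: "nat \<Rightarrow> nat" where
  "modulus r = fst (double_while (\<lambda>N. N < r) r)"

text \<open>The selection of all sets is an initial value that is always admissible. The word length
  depends on \<open>k\<close> rather than on the number of missing sets, so that one bound serves
  all rounds.\<close>

definition best ::
    "(rb_code \<Rightarrow> bool list) \<Rightarrow> nat \<Rightarrow> nat \<Rightarrow> bool list list \<Rightarrow> nat \<Rightarrow> nat \<Rightarrow> bool list \<Rightarrow> bool list" where
  "best solve n k rows N P U = argmin (union_cost n rows) (map (\<lambda>_. True) [0..<length rows])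
     (map (\<lambda>aw. solve (residual n N P rows U aw)) (List.product [0..<P] (words (walk_length k))))"

definition augment :: "(rb_code \<Rightarrow> bool list) \<Rightarrow> nat \<Rightarrow> nat \<Rightarrow> bool list list \<Rightarrow> bool list \<Rightarrow> bool list" where
  "augment solve n k rows U = (if k \<le> count_true U then U else
     map (\<lambda>i. nth_default False U i \<or> nth_default False
       (best solve n k rows (side (k - count_true U))
         (modulus (length rows + side (k - count_true U) * side (k - count_true U))) U) i) [0..<length rows])"

definition trim :: "nat \<Rightarrow> bool list \<Rightarrow> bool list" where
  "trim k U = map (\<lambda>i. nth_default False U i \<and> length (filter (nth_default False U) [0..<i]) < k) [0..<length U]"

text \<open>As many rounds as there are sets suffice, since every effective round adds a set and
  \<open>augment\<close> is idle afterwards. The much smaller number of effective rounds enters only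
  the cost, see \<open>rounds\<close>.\<close>

definition union_algorithm :: "(rb_code \<Rightarrow> bool list) \<Rightarrow> nat \<times> nat \<times> bool list list \<Rightarrow> bool list" where
  "union_algorithm solve x = trim (fst (snd x))
     ((augment solve (fst x) (fst (snd x)) (snd (snd x)) ^^ length (snd (snd x)))
       (map (\<lambda>_. False) [0..<length (snd (snd x))]))"

lemma polytime_covers [polytime_intros]:
  assumes "polytime N" "polytime P" "polytime a" "polytime w" "polytime i" "polytime p"
  shows "polytime (\<lambda>x. covers (N x) (P x) (a x) (w x) (i x) (p x))"
  unfolding covers_def
  by (intro polytime_intros assms polytime_comp[OF _ assms(1)] polytime_comp[OF _ assms(2)] polytime_comp[OF _ assms(3)]
      polytime_comp[OF _ assms(4)] polytime_comp[OF _ assms(5)] polytime_comp[OF _ assms(6)])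

lemma polytime_residual [polytime_intros]:
  assumes "polytime n" "polytime N" "polytime P" "polytime rows" "polytime U" "polytime aw"
  shows "polytime (\<lambda>x. residual (n x) (N x) (P x) (rows x) (U x) (aw x))"
  unfolding residual_def
  by (intro polytime_intros assms polytime_comp[OF _ assms(1)] polytime_comp[OF _ assms(2)] polytime_comp[OF _ assms(3)]
      polytime_comp[OF _ assms(4)] polytime_comp[OF _ assms(5)] polytime_comp[OF _ assms(6)])

lemma polytime_union_cost [polytime_intros]:
  assumes "polytime n" "polytime rows" "polytime J"
  shows "polytime (\<lambda>x. union_cost (n x) (rows x) (J x))"
  unfolding union_cost_def
  by (intro polytime_intros assms polytime_comp[OF _ assms(1)] polytime_comp[OF _ assms(2)] polytime_comp[OF _ assms(3)])

lemma argmin_in: "argmin f b xs \<in> set (b # xs)"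
  unfolding argmin_def by (induction xs arbitrary: b) auto

lemma argmin_le: "x \<in> set (b # xs) \<Longrightarrow> f (argmin f b xs) \<le> f x"
  unfolding argmin_def
proof (induction xs arbitrary: b x)
  case (Cons y ys)
  have *: "f (foldl (\<lambda>b x. if f x < f b then x else b) c ys) \<le> f c" for c
    using Cons.IH[of c c] by simp
  consider "x = b" | "x = y" | "x \<in> set ys"
    using Cons.prems by auto
  then show ?case
    using Cons.IH[of x "if f y < f b then y else b"] *[of "if f y < f b then y else b"]
    by cases (auto split: if_splits)
qed simp

lemma polytime_argmin:
  assumes f: "polytime (\<lambda>p. f (fst p) (snd p))" and b: "polytime b" and xs: "polytime xs"
  shows "polytime (\<lambda>x. argmin (f x) (b x) (xs x))"
  unfolding argmin_def
proof (rule polytime_foldl[where B = "\<lambda>x. esize (b x) + esize (xs x)"])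
  fix x ys zs
  assume "xs x = ys @ zs"
  then have "argmin (f x) (b x) ys \<in> set (b x # xs x)"
    using argmin_in[of "f x" "b x" ys] by auto
  then have "esize (argmin (f x) (b x) ys) \<le> esize (b x) + esize (xs x)"
    using esize_mem_le by force
  then show "esize (foldl (\<lambda>b y. if f x y < f x b then y else b) (b x) ys) \<le> esize (b x) + esize (xs x)"
    unfolding argmin_def .
next
  have "polytime (\<lambda>p :: 'a \<times> 'b \<times> 'b. f (fst p) (fst (snd p)))"
    "polytime (\<lambda>p :: 'a \<times> 'b \<times> 'b. f (fst p) (snd (snd p)))"
  proof -
    have "polytime (\<lambda>p :: 'a \<times> 'b \<times> 'b. (fst p, fst (snd p)))" "polytime (\<lambda>p :: 'a \<times> 'b \<times> 'b. (fst p, snd (snd p)))"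
      by (intro polytime_intros)+
    from this[THEN polytime_comp, OF f] show "polytime (\<lambda>p :: 'a \<times> 'b \<times> 'b. f (fst p) (fst (snd p)))"
      "polytime (\<lambda>p :: 'a \<times> 'b \<times> 'b. f (fst p) (snd (snd p)))"
      by simp_all
  qed
  then show "polytime (\<lambda>p :: 'a \<times> 'b \<times> 'b. if f (fst p) (snd (snd p)) < f (fst p) (fst (snd p))
      then snd (snd p) else fst (snd p))"
    by (intro polytime_intros)
qed (rule b xs poly_bounded_add poly_bounded_esize)+

lemma polytime_count_true [polytime_intros]: "polytime U \<Longrightarrow> polytime (\<lambda>x. count_true (U x))"
  unfolding count_true_def by (intro polytime_intros)

lemma polytime_side [polytime_intros]:
  assumes "polytime r"
  shows "polytime (\<lambda>x. side (r x))"
  unfolding side_def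
proof (intro polytime_fst polytime_double_while)
  show "N * N < r x \<Longrightarrow> N \<le> r x" for N x
    using le_square[of N] by linarith
qed (intro polytime_intros assms polytime_comp[OF _ assms])+

lemma polytime_modulus [polytime_intros]:
  assumes "polytime r"
  shows "polytime (\<lambda>x. modulus (r x))"
  unfolding modulus_def
  by (intro polytime_intros polytime_double_while assms polytime_comp[OF _ assms]) auto

lemma polytime_best [polytime_intros]:
  assumes "polytime solve" "polytime n" "polytime k" "polytime rows" "polytime N" "polytime P" "polytime U"
  shows "polytime (\<lambda>x. best solve (n x) (k x) (rows x) (N x) (P x) (U x))"
  unfolding best_def
  by (intro polytime_argmin polytime_intros assms polytime_comp[OF _ assms(1)] polytime_comp[OF _ assms(2)] polytime_comp[OF _ assms(4)]
      polytime_comp[OF _ assms(5)] polytime_comp[OF _ assms(6)] polytime_comp[OF _ assms(7)])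

lemma polytime_augment [polytime_intros]:
  assumes "polytime solve" "polytime n" "polytime k" "polytime rows" "polytime U"
  shows "polytime (\<lambda>x. augment solve (n x) (k x) (rows x) (U x))"
  unfolding augment_def
  by (intro polytime_intros assms polytime_comp[OF _ assms(2)] polytime_comp[OF _ assms(3)]
      polytime_comp[OF _ assms(4)] polytime_comp[OF _ assms(5)])

lemma polytime_trim [polytime_intros]:
  assumes "polytime k" "polytime U"
  shows "polytime (\<lambda>x. trim (k x) (U x))"
  unfolding trim_def
  by (intro polytime_intros assms polytime_comp[OF _ assms(1)] polytime_comp[OF _ assms(2)])

lemma length_augment: "length U = length rows \<Longrightarrow> length (augment solve n k rows U) = length rows"
  by (simp add: augment_def)

lemma length_funpow_augment:
  "length U = length rows \<Longrightarrow> length ((augment solve n k rows ^^ t) U) = length rows"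
  by (induction t) (auto simp: length_augment)

lemma polytime_union_algorithm:
  assumes "polytime solve"
  shows "polytime (union_algorithm solve)"
proof -
  have "polytime (\<lambda>x. union_algorithm solve x)"
    unfolding union_algorithm_def
  proof (intro polytime_trim polytime_funpow[where B = "\<lambda>x. 1 + esize (snd (snd x)) * 4"])
    fix x :: "nat \<times> nat \<times> bool list list" and i
    let ?U = "(augment solve (fst x) (fst (snd x)) (snd (snd x)) ^^ i) (map (\<lambda>_. False) [0..<length (snd (snd x))])"
    have "esize ?U \<le> 1 + length ?U * (1 + 3)"
      by (intro esize_list_le esize_bool)
    also have "length ?U = length (snd (snd x))"
      by (rule length_funpow_augment) simp
    finally show "esize ?U \<le> 1 + esize (snd (snd x)) * 4"
      using length_le_esize[of "snd (snd x)"] by simp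
  qed (rule polytime_intros assms poly_bounded_add poly_bounded_mult poly_bounded_const poly_bounded_esize)+
  then show ?thesis by simp
qed

section \<open>Correctness\<close>

definition bits :: "nat \<Rightarrow> nat set \<Rightarrow> bool list" where
  "bits n A = map (\<lambda>j. j \<in> A) [0..<n]"

definition selected :: "bool list \<Rightarrow> nat set" where
  "selected U = {i. nth_default False U i}"

lemma encode_subset_bits: "encode_subset n A = enc (bits n A)"
  by (simp add: encode_subset_def bits_def enc_list_def encode_list_map enc_bool_def)

lemma nth_default_map_upt: "nth_default d (map f [0..<n]) i = (if i < n then f i else d)"
  by (simp add: nth_default_def)

lemma selected_bits: "selected (bits n A) = A \<inter> {..<n}"
  by (auto simp: selected_def bits_def nth_default_map_upt)

lemma selected_map_upt: "selected (map P [0..<n]) = {i. i < n \<and> P i}"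
  by (auto simp: selected_def nth_default_map_upt)

lemma bits_selected: "length l = n \<Longrightarrow> bits n (selected l) = l"
  by (auto simp: bits_def selected_def nth_default_def intro!: nth_equalityI)

lemma selected_subset: "selected U \<subseteq> {..<length U}"
  by (auto simp: selected_def nth_default_def split: if_splits)

lemma finite_selected [simp]: "finite (selected U)"
  using selected_subset finite_subset by blast

lemma count_true_eq: "count_true U = card (selected U)"
  unfolding count_true_def length_filter_conv_card
  by (intro arg_cong[where f = card]) (auto simp: selected_def nth_default_def)

lemma length_filter_upt: "length (filter P [0..<n]) = card {i. i < n \<and> P i}"
  by (auto simp: length_filter_conv_card intro!: arg_cong[where f = card])

section \<open>Red-Blue Set Cover on codes\<close>

definition valid_rb :: "rb_code \<Rightarrow> bool" where
  "valid_rb I \<longleftrightarrow> (\<forall>r\<in>set (snd (snd I)). length (fst r) = fst I \<and> length (snd r) = fst (snd I))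
     \<and> (\<forall>b\<in>set [0..<fst (snd I)]. \<exists>r\<in>set (snd (snd I)). nth_default False (snd r) b)"

definition decode_rb :: "rb_code \<Rightarrow> rb_instance" where
  "decode_rb I = \<lparr>red = fst I, blue = fst (snd I),
     rb_sets = map (\<lambda>r. Inl ` selected (fst r) \<union> Inr ` selected (snd r)) (snd (snd I))\<rparr>"

definition rb_feasible :: "rb_code \<Rightarrow> nat set set" where
  "rb_feasible I = {S. S \<subseteq> {..<length (snd (snd I))} \<and>
     (\<forall>b<fst (snd I). \<exists>i\<in>S. b \<in> selected (snd (snd (snd I) ! i)))}"

definition rb_cost :: "rb_code \<Rightarrow> nat set \<Rightarrow> nat" where
  "rb_cost I S = card (\<Union>i\<in>S. selected (fst (snd (snd I) ! i)))"

lemma polytime_valid_rb: "polytime valid_rb"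
proof -
  have "polytime (\<lambda>I. valid_rb I)"
    unfolding valid_rb_def by (intro polytime_intros)
  then show ?thesis by simp
qed

lemma encode_list_cong: "(\<And>x. x \<in> set xs \<Longrightarrow> f x = g x) \<Longrightarrow> encode_list f xs = encode_list g xs"
  by (induction xs) auto

lemma encode_decode_rb:
  assumes "valid_rb I"
  shows "encode_instance red_blue_set_cover (decode_rb I) = enc I"
proof -
  obtain n q rows where I: "I = (n, q, rows)"
    by (metis prod.collapse)
  have "encode_list (\<lambda>r. Node (encode_subset n (Inl -` (Inl ` selected (fst r) \<union> Inr ` selected (snd r))))
      (encode_subset q (Inr -` (Inl ` selected (fst r) \<union> Inr ` selected (snd r))))) rows = encode_list enc rows"
  proof (rule encode_list_cong)
    fix r
    assume "r \<in> set rows"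
    then have "length (fst r) = n" "length (snd r) = q"
      using assms by (auto simp: valid_rb_def I)
    moreover have "Inl -` (Inl ` A \<union> Inr ` B) = A" "Inr -` (Inl ` A \<union> Inr ` B) = B" for A B :: "nat set"
      by auto
    ultimately show "Node (encode_subset n (Inl -` (Inl ` selected (fst r) \<union> Inr ` selected (snd r))))
        (encode_subset q (Inr -` (Inl ` selected (fst r) \<union> Inr ` selected (snd r)))) = enc r"
      by (simp add: encode_subset_bits bits_selected enc_prod_def)
  qed
  then show ?thesis
    by (simp add: I decode_rb_def red_blue_set_cover_def encode_list_map enc_nat_def enc_list_def)
qed

lemma decode_rb_instance:
  assumes "valid_rb I"
  shows "decode_rb I \<in> instances red_blue_set_cover"
proof -
  have "Inl ` selected (fst r) \<union> Inr ` selected (snd r) \<subseteq> {..<fst I} <+> {..<fst (snd I)}"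
    if "r \<in> set (snd (snd I))" for r
    using that assms selected_subset[of "fst r"] selected_subset[of "snd r"] by (fastforce simp: valid_rb_def)
  then show ?thesis
    by (auto simp: red_blue_set_cover_def decode_rb_def)
qed

lemma feasible_decode_rb: "feasible red_blue_set_cover (decode_rb I) = rb_feasible I"
proof -
  have "Inr ` {..<q} \<subseteq> (\<Union>i\<in>S. map (\<lambda>r. Inl ` selected (fst r) \<union> Inr ` selected (snd r)) rows ! i)
      \<longleftrightarrow> (\<forall>b<q. \<exists>i\<in>S. b \<in> selected (snd (rows ! i)))" if S: "S \<subseteq> {..<length rows}" for S q rows
  proof -
    have "(\<Union>i\<in>S. map (\<lambda>r. Inl ` selected (fst r) \<union> Inr ` selected (snd r)) rows ! i)
        = (\<Union>i\<in>S. Inl ` selected (fst (rows ! i)) \<union> Inr ` selected (snd (rows ! i)))"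
      using S by (intro SUP_cong) auto
    then show ?thesis
      by (simp only:) (auto simp: image_subset_iff image_iff)
  qed
  then show ?thesis
    by (simp add: red_blue_set_cover_def decode_rb_def rb_feasible_def cong: conj_cong)
qed

lemma cost_decode_rb:
  assumes "valid_rb I" "S \<subseteq> {..<length (snd (snd I))}"
  shows "cost red_blue_set_cover (decode_rb I) S = rb_cost I S"
proof -
  have "(\<Union>i\<in>S. rb_sets (decode_rb I) ! i) \<inter> Inl ` {..<fst I} = Inl ` (\<Union>i\<in>S. selected (fst (snd (snd I) ! i)))"
  proof -
    have "selected (fst (snd (snd I) ! i)) \<subseteq> {..<fst I}" if "i \<in> S" for i
    proof -
      have "snd (snd I) ! i \<in> set (snd (snd I))"
        using that assms(2) by auto
      then show ?thesis
        using assms(1) selected_subset unfolding valid_rb_def by metis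
    qed
    moreover have "(\<Union>i\<in>S. rb_sets (decode_rb I) ! i)
        = (\<Union>i\<in>S. Inl ` selected (fst (snd (snd I) ! i)) \<union> Inr ` selected (snd (snd (snd I) ! i)))"
      using assms(2) by (intro SUP_cong) (auto simp: decode_rb_def)
    ultimately show ?thesis by auto
  qed
  then show ?thesis
    by (simp add: red_blue_set_cover_def decode_rb_def rb_cost_def card_image)
qed

text \<open>Codes without a feasible solution must be filtered out, since nothing is known about the given
  algorithm on them, not even termination; all sets are returned for them.\<close>

definition rb_solver :: "(nat \<Rightarrow> nat \<Rightarrow> real) \<Rightarrow> (rb_code \<Rightarrow> bool list) \<Rightarrow> bool" where
  "rb_solver \<beta> solve \<longleftrightarrow> (\<forall>I. length (solve I) = length (snd (snd I))
     \<and> (if valid_rb I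
        then selected (solve I) \<in> rb_feasible I \<and> (\<forall>S\<in>rb_feasible I.
          real (rb_cost I (selected (solve I))) \<le> \<beta> (length (snd (snd I))) (fst I) * real (rb_cost I S))
        else selected (solve I) = {..<length (snd (snd I))}))"

lemma poly_bounded_poly: "poly_bounded s \<Longrightarrow> poly_bounded (\<lambda>x. poly q (s x))"
  by (induction q) (auto intro: poly_bounded_const poly_bounded_add poly_bounded_mult)

text \<open>Validity, which can be tested in polynomial time, includes that taking all sets is a
  solution; only then \<open>A\<close> is run. Its answers on valid codes are turned into a function
  by choice, while \<open>A\<close> remains the program that computes it. Cutting the factor off at
  0 allows replacing the optimum by the cost of any feasible solution, whatever the sign of
  \<alpha>.\<close>

lemma ex_rb_solver:
  assumes "approx_algorithm red_blue_set_cover (\<lambda>x. \<alpha> (length (rb_sets x)) (red x)) A"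
  shows "\<exists>solve. polytime solve \<and> rb_solver (\<lambda>m n. max 0 (\<alpha> m n)) solve"
proof -
  obtain q :: "nat poly" where q: "\<And>x. x \<in> instances red_blue_set_cover \<Longrightarrow> feasible red_blue_set_cover x \<noteq> {} \<Longrightarrow>
      \<exists>t s. run A (encode_instance red_blue_set_cover x) t (encode_solution red_blue_set_cover x s) \<and>
        t \<le> poly q (nodes (encode_instance red_blue_set_cover x)) \<and> s \<in> feasible red_blue_set_cover x \<and>
        real (cost red_blue_set_cover x s) \<le> \<alpha> (length (rb_sets x)) (red x) * real (opt red_blue_set_cover x)"
    using assms unfolding approx_algorithm_def by blast
  have "\<exists>s\<in>rb_feasible I. run_le A (enc I) (poly q (esize I)) (enc (bits (length (snd (snd I))) s)) \<and>
      (\<forall>S\<in>rb_feasible I. real (rb_cost I s) \<le> max 0 (\<alpha> (length (snd (snd I))) (fst I)) * real (rb_cost I S))"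
    if I: "valid_rb I" for I
  proof -
    have "{..<length (snd (snd I))} \<in> rb_feasible I"
    proof -
      have "\<exists>i<length (snd (snd I)). b \<in> selected (snd (snd (snd I) ! i))" if "b < fst (snd I)" for b
      proof -
        have "b \<in> set [0..<fst (snd I)]"
          using that by simp
        then obtain r where "r \<in> set (snd (snd I))" "b \<in> selected (snd r)"
          using I unfolding valid_rb_def selected_def by blast
        then show ?thesis
          by (metis in_set_conv_nth)
      qed
      then show ?thesis
        by (auto simp: rb_feasible_def)
    qed
    then have "feasible red_blue_set_cover (decode_rb I) \<noteq> {}"
      by (auto simp: feasible_decode_rb)
    from q[OF decode_rb_instance[OF I] this] obtain t s where s:
        "run A (enc I) t (encode_solution red_blue_set_cover (decode_rb I) s)"
        "t \<le> poly q (esize I)" "s \<in> rb_feasible I"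
        "real (cost red_blue_set_cover (decode_rb I) s)
          \<le> \<alpha> (length (snd (snd I))) (fst I) * real (opt red_blue_set_cover (decode_rb I))"
      unfolding encode_decode_rb[OF I] feasible_decode_rb by (auto simp: decode_rb_def)
    have "encode_solution red_blue_set_cover (decode_rb I) s = enc (bits (length (snd (snd I))) s)"
      by (simp add: red_blue_set_cover_def decode_rb_def encode_subset_bits)
    then have "run_le A (enc I) (poly q (esize I)) (enc (bits (length (snd (snd I))) s))"
      using s(1,2) by (auto simp: run_le_def)
    moreover have "real (rb_cost I s) \<le> max 0 (\<alpha> (length (snd (snd I))) (fst I)) * real (rb_cost I S)"
      if S: "S \<in> rb_feasible I" for S
    proof -
      have sub: "rb_feasible I \<subseteq> Pow {..<length (snd (snd I))}"
        by (auto simp: rb_feasible_def)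
      then have "finite (rb_feasible I)"
        by (rule finite_subset) simp
      then have "opt red_blue_set_cover (decode_rb I) \<le> cost red_blue_set_cover (decode_rb I) S"
        unfolding opt_def feasible_decode_rb using S by (intro Min_le) auto
      also have "\<dots> = rb_cost I S"
        using S sub by (intro cost_decode_rb I) auto
      finally have le: "opt red_blue_set_cover (decode_rb I) \<le> rb_cost I S" .
      have "real (rb_cost I s) = real (cost red_blue_set_cover (decode_rb I) s)"
        using s(3) sub by (subst cost_decode_rb[OF I]) auto
      also have "\<dots> \<le> max 0 (\<alpha> (length (snd (snd I))) (fst I)) * real (opt red_blue_set_cover (decode_rb I))"
        using s(4) by (rule order_trans) (intro mult_right_mono, auto)
      also have "\<dots> \<le> max 0 (\<alpha> (length (snd (snd I))) (fst I)) * real (rb_cost I S)"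
        using le by (intro mult_left_mono) auto
      finally show ?thesis .
    qed
    ultimately show ?thesis
      using s(3) by blast
  qed
  then obtain F where F: "\<And>I. valid_rb I \<Longrightarrow> F I \<in> rb_feasible I \<and>
      run_le A (enc I) (poly q (esize I)) (enc (bits (length (snd (snd I))) (F I))) \<and>
      (\<forall>S\<in>rb_feasible I. real (rb_cost I (F I)) \<le> max 0 (\<alpha> (length (snd (snd I))) (fst I)) * real (rb_cost I S))"
    by metis
  define solve where "solve I = (if valid_rb I then bits (length (snd (snd I))) (F I)
    else map (\<lambda>_. True) [0..<length (snd (snd I))])" for I
  have "polytime solve"
    unfolding solve_def
  proof (rule polytime_If_partial[where d = valid_rb and S = "\<lambda>I. poly q (esize I)" and p = A, OF polytime_valid_rb])
    show "polytime (\<lambda>I :: rb_code. map (\<lambda>_. True) [0..<length (snd (snd I))])"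
      by (intro polytime_intros)
    show "poly_bounded (\<lambda>I :: rb_code. poly q (esize I))"
      by (intro poly_bounded_poly poly_bounded_esize_self)
  qed (use F in simp_all)
  moreover have "rb_solver (\<lambda>m n. max 0 (\<alpha> m n)) solve"
  proof -
    have "selected (solve I) = F I" if "valid_rb I" for I
      using F[OF that] that by (auto simp: solve_def selected_bits rb_feasible_def)
    then show ?thesis
      using F by (auto simp: rb_solver_def solve_def bits_def selected_map_upt)
  qed
  ultimately show ?thesis by blast
qed

section \<open>Covers obtained in a single round\<close>

lemma side_cases:
  assumes "0 < r"
  obtains j where "side r = 2 ^ j" "r \<le> side r * side r" "side r * side r < 4 * r"
proof -
  obtain j where j: "double_while (\<lambda>N. N * N < r) r = (2 ^ j, j)" "\<not> 2 ^ j * 2 ^ j < r"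
      "j = 0 \<or> 2 ^ (j - 1) * 2 ^ (j - 1) < r"
    by (rule double_while_cases[of "\<lambda>N. N * N < r" r]) (use le_square order_trans less_imp_le in \<open>blast\<close>)+
  \<comment> \<open>The previous power of two has a square below \<open>r\<close>, and doubling it
    quadruples the square.\<close>
  have "(2::nat) ^ j * 2 ^ j < 4 * r"
    using j(3) assms by (cases j) auto
  then show ?thesis
    using j by (intro that[of j]) (auto simp: side_def)
qed

lemma modulus_cases:
  obtains w where "modulus r = 2 ^ w" "r \<le> modulus r"
proof -
  obtain j where "double_while (\<lambda>N. N < r) r = (2 ^ j, j)" "r \<le> 2 ^ j"
    by (rule double_while_less)
  then show ?thesis
    by (intro that[of j]) (auto simp: modulus_def)
qed

text \<open>The hash value is the number of at most one torus point, so
  \<open>card_visits_le\<close> bounds the blue elements of each set, for every multiplier and every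
  word.\<close>

lemma card_covers_le: "card {p\<in>torus N. covers N P a w i p} \<le> length w + 1"
proof -
  define z where "z = mshift (N * N) P a i"
  have "{p\<in>torus N. covers N P a w i p} \<subseteq> {p\<in>torus N. (z div N, z mod N) \<in> set (visits N w p)}"
  proof
    fix p
    assume "p \<in> {p\<in>torus N. covers N P a w i p}"
    then obtain y where y: "p \<in> torus N" "y \<in> set (visits N w p)" "fst y * N + snd y = z"
      by (auto simp: covers_def z_def)
    then have "y \<in> torus N"
      using visits_in_torus by blast
    then have "(z div N, z mod N) = y"
      using y(3) by (auto simp: torus_def)
    then show "p \<in> {p\<in>torus N. (z div N, z mod N) \<in> set (visits N w p)}"
      using y by simp
  qed
  then show ?thesis
    by (rule order_trans[OF card_mono card_visits_le, rotated]) simp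
qed

text \<open>The image \<open>H\<close> of \<open>S\<close> occupies more than 1/12 of the torus: the
  hash loses at most a factor 3 and the rounding of the side less than 4. Its complement
  \<open>M\<close> thus satisfies the density hypothesis of \<open>ex_escaping_walk\<close>, and a
  walk that leaves \<open>M\<close> meets the hash value of some member of \<open>S\<close>.\<close>

lemma ex_covering_walk:
  assumes S: "S \<subseteq> {..<m}" "card S = r" and N: "N = 2 ^ j" "r \<le> N * N" "N * N < 4 * r" "N\<^sup>2 < 2 ^ L"
    and P: "P = 2 ^ e" "m \<le> P" "N * N \<le> P"
  shows "\<exists>a<P. \<exists>w\<in>set (words (150000 * L)). \<forall>p\<in>torus N. \<exists>i\<in>S. covers N P a w i p"
proof -
  have q: "N * N = 2 ^ (2 * j)"
    by (simp add: N(1) mult_2 power_add)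
  have "2 * j \<le> e"
    using P(3) unfolding q P(1) by simp
  moreover have "S \<subseteq> {..<2 ^ e}"
    using S(1) P by auto
  ultimately obtain a where a: "a < P" "card S \<le> 3 * card (mshift (N * N) P a ` S)"
    using ex_good_mshift[of S e "2 * j"] S(2) N(2) unfolding q P(1) by auto
  define H where "H = mshift (N * N) P a ` S"
  define idx where "idx y = fst y * N + snd y" for y :: "nat \<times> nat"
  define M where "M = {p\<in>torus N. idx p \<notin> H}"
  have "0 < N" by (simp add: N(1))
  have "finite S" using S(1) finite_subset by blast
  have H: "z < N * N" if "z \<in> H" for z
    using that \<open>0 < N\<close> unfolding H_def by (auto intro!: mshift_less simp: P(1))
  have "card H \<le> card {p\<in>torus N. idx p \<in> H}"
  proof (rule surj_card_le)
    show "H \<subseteq> idx ` {p\<in>torus N. idx p \<in> H}"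
    proof
      fix z
      assume z: "z \<in> H"
      then have "z div N < N"
        using H by (simp add: less_mult_imp_div_less)
      then show "z \<in> idx ` {p\<in>torus N. idx p \<in> H}"
        using z \<open>0 < N\<close> by (intro image_eqI[of _ _ "(z div N, z mod N)"]) (auto simp: idx_def torus_def)
    qed
  qed simp
  moreover have "card {p\<in>torus N. idx p \<in> H} + card M = card (torus N)"
    unfolding M_def by (subst card_Un_disjoint[symmetric]) (auto intro: arg_cong[where f = card])
  ultimately have "card H + card M \<le> N\<^sup>2"
    by (simp add: card_torus)
  moreover have "N * N < 12 * card H"
    using a(2) N(3) S(2) unfolding H_def by linarith
  ultimately have "12 * card M \<le> 11 * N\<^sup>2"
    unfolding power2_eq_square by linarith
  then obtain w where w: "w \<in> set (words (150000 * L))" "\<And>p. p \<in> torus N \<Longrightarrow> \<not> set (visits N w p) \<subseteq> M"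
    using ex_escaping_walk[of M N L] N(4) by (auto simp: M_def)
  have "\<exists>i\<in>S. covers N P a w i p" if p: "p \<in> torus N" for p
  proof -
    obtain y where "y \<in> set (visits N w p)" "y \<in> torus N" "y \<notin> M"
      using w(2)[OF p] visits_in_torus[OF p] by blast
    then show ?thesis
      by (auto simp: M_def H_def idx_def covers_def)
  qed
  with a(1) w(1) show ?thesis by blast
qed

lemma nth_residual:
  assumes "i < length rows"
  shows "snd (snd (residual n N P rows U aw)) ! i = (rows ! i,
    map (\<lambda>p. i \<notin> selected U \<and> covers N P (fst aw) (snd aw) i p) (List.product [0..<N] [0..<N]))"
  using assms by (simp add: residual_def selected_def nth_default_nth)

lemma length_residual: "length (snd (snd (residual n N P rows U aw))) = length rows"
  by (simp add: residual_def)

lemma fst_residual: "fst (residual n N P rows U aw) = n" "fst (snd (residual n N P rows U aw)) = N * N"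
  by (simp_all add: residual_def)

lemma selected_map: "selected (map f xs) = {b. b < length xs \<and> f (xs ! b)}"
  by (auto simp: selected_def nth_default_def)

text \<open>Blue elements are positions in the list of all torus points; quantifying over the
  members of that list removes the numbering.\<close>

lemma rb_feasible_residual:
  "S \<in> rb_feasible (residual n N P rows U aw) \<longleftrightarrow> S \<subseteq> {..<length rows} \<and>
    (\<forall>p\<in>torus N. \<exists>i\<in>S - selected U. covers N P (fst aw) (snd aw) i p)"
proof -
  let ?ps = "List.product [0..<N] [0..<N]"
  have "(\<forall>b<N * N. \<exists>i\<in>S. b \<in> selected (snd (snd (snd (residual n N P rows U aw)) ! i)))
      \<longleftrightarrow> (\<forall>p\<in>torus N. \<exists>i\<in>S - selected U. covers N P (fst aw) (snd aw) i p)"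
    if S: "S \<subseteq> {..<length rows}"
  proof -
    have "b \<in> selected (snd (snd (snd (residual n N P rows U aw)) ! i))
        \<longleftrightarrow> i \<notin> selected U \<and> covers N P (fst aw) (snd aw) i (?ps ! b)" if "b < N * N" "i \<in> S" for b i
      using that S by (subst nth_residual) (auto simp: selected_map)
    then have "(\<forall>b<N * N. \<exists>i\<in>S. b \<in> selected (snd (snd (snd (residual n N P rows U aw)) ! i)))
      \<longleftrightarrow> (\<forall>b<length ?ps. \<exists>i\<in>S - selected U. covers N P (fst aw) (snd aw) i (?ps ! b))"
      by (auto simp: Bex_def)
    also have "\<dots> \<longleftrightarrow> (\<forall>p\<in>set ?ps. \<exists>i\<in>S - selected U. covers N P (fst aw) (snd aw) i p)"
      by (simp only: all_set_conv_all_nth)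
    also have "set ?ps = torus N"
      by (auto simp: torus_def)
    finally show ?thesis .
  qed
  then show ?thesis
    by (auto simp: rb_feasible_def length_residual fst_residual)
qed

context
  fixes \<beta> :: "nat \<Rightarrow> nat \<Rightarrow> real" and solve :: "rb_code \<Rightarrow> bool list" and n :: nat and rows :: "bool list list"
  assumes solver: "rb_solver \<beta> solve" and rows: "\<And>r. r \<in> set rows \<Longrightarrow> length r = n"
begin

lemma length_solve: "length (solve I) = length (snd (snd I))"
  and solve_valid: "valid_rb I \<Longrightarrow> selected (solve I) \<in> rb_feasible I"
  and solve_invalid: "\<not> valid_rb I \<Longrightarrow> selected (solve I) = {..<length (snd (snd I))}"
  and solve_cost: "valid_rb I \<Longrightarrow> S \<in> rb_feasible I \<Longrightarrow>
    real (rb_cost I (selected (solve I))) \<le> \<beta> (length (snd (snd I))) (fst I) * real (rb_cost I S)"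
  using solver unfolding rb_solver_def by meson+

abbreviation union_of :: "nat set \<Rightarrow> nat set" where
  "union_of S \<equiv> \<Union>i\<in>S. selected (rows ! i)"

lemma union_of_subset: "S \<subseteq> {..<length rows} \<Longrightarrow> union_of S \<subseteq> {..<n}"
  using rows selected_subset by (metis UN_least lessThan_iff nth_mem subsetD)

lemma union_cost_eq:
  assumes "selected J \<subseteq> {..<length rows}"
  shows "union_cost n rows J = card (union_of (selected J))"
proof -
  have "{e. e < n \<and> (\<exists>i\<in>set [0..<length rows]. nth_default False J i \<and> nth_default False (nth_default [] rows i) e)}
      = union_of (selected J)"
    using assms union_of_subset[OF assms] by (auto simp: selected_def nth_default_nth subset_iff)
  then show ?thesis
    unfolding union_cost_def length_filter_upt by simp
qed

lemma rb_cost_residual: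
  assumes "S \<subseteq> {..<length rows}"
  shows "rb_cost (residual n N P rows U aw) S = card (union_of S)"
  unfolding rb_cost_def using assms by (intro arg_cong[where f = card] SUP_cong) (auto simp: nth_residual)

lemma valid_residual:
  assumes "S \<in> rb_feasible (residual n N P rows U aw)"
  shows "valid_rb (residual n N P rows U aw)"
proof -
  have "\<exists>r\<in>set (snd (snd (residual n N P rows U aw))). nth_default False (snd r) b" if b: "b < N * N" for b
  proof -
    obtain i where "i \<in> S" "b \<in> selected (snd (snd (snd (residual n N P rows U aw)) ! i))" "i < length rows"
      using assms b unfolding rb_feasible_def length_residual fst_residual by blast
    then show ?thesis
      unfolding selected_def using nth_mem[of i "snd (snd (residual n N P rows U aw))"]
      by (auto simp: length_residual)
  qed
  moreover have "length (fst r) = n \<and> length (snd r) = N * N"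
    if "r \<in> set (snd (snd (residual n N P rows U aw)))" for r
    using that rows by (auto simp: residual_def nth_default_nth)
  ultimately show ?thesis
    by (simp add: valid_rb_def fst_residual)
qed

text \<open>Each of the \<open>N * N\<close> points needs a new set, and a set serves at most
  \<open>length (snd aw) + 1\<close> points. Good and bad candidates alike make this progress; on an
  instance without a cover the fallback of \<open>solve\<close> selects all sets.\<close>

lemma candidate:
  assumes U: "length U = length rows" and r: "r \<le> N * N" "r + count_true U \<le> length rows"
    and J: "J = solve (residual n N P rows U aw)"
  shows "selected J \<subseteq> {..<length rows}" "r \<le> card (selected J - selected U) * (length (snd aw) + 1)"
proof -
  have len: "length J = length rows"
    by (simp add: J length_solve length_residual)
  then show "selected J \<subseteq> {..<length rows}"
    using selected_subset[of J] by simp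
  show "r \<le> card (selected J - selected U) * (length (snd aw) + 1)"
  proof (cases "valid_rb (residual n N P rows U aw)")
    case True
    then have "selected J \<in> rb_feasible (residual n N P rows U aw)"
      unfolding J by (rule solve_valid)
    then have "torus N \<subseteq> (\<Union>i\<in>selected J - selected U. {p\<in>torus N. covers N P (fst aw) (snd aw) i p})"
      unfolding rb_feasible_residual by blast
    then have "card (torus N) \<le> card (\<Union>i\<in>selected J - selected U. {p\<in>torus N. covers N P (fst aw) (snd aw) i p})"
      by (intro card_mono) auto
    also have "\<dots> \<le> (\<Sum>i\<in>selected J - selected U. card {p\<in>torus N. covers N P (fst aw) (snd aw) i p})"
      by (intro card_UN_le) simp
    also have "\<dots> \<le> (\<Sum>i\<in>selected J - selected U. length (snd aw) + 1)"
      by (intro sum_mono card_covers_le)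
    finally show ?thesis
      using r(1) by (simp add: card_torus power2_eq_square)
  next
    case False
    then have "selected J = {..<length rows}"
      by (simp add: J solve_invalid length_residual)
    moreover have "selected U \<subseteq> {..<length rows}"
      using U selected_subset by metis
    ultimately have "card (selected J - selected U) = length rows - count_true U"
      by (simp add: card_Diff_subset count_true_eq)
    then have "r \<le> card (selected J - selected U) * 1"
      using r(2) by simp
    also have "\<dots> \<le> card (selected J - selected U) * (length (snd aw) + 1)"
      by (intro mult_left_mono) auto
    finally show ?thesis .
  qed
qed

text \<open>The progress of the winner is that of an arbitrary candidate. Its cost is at most that
  of one good candidate, whose instance admits part of \<open>Z\<close> as a cover.\<close>

lemma best_correct:
  assumes U: "length U = length rows" "count_true U < k" and Z: "Z \<subseteq> {..<length rows}" "card Z = k"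
  defines "N \<equiv> side (k - count_true U)"
  defines "J \<equiv> best solve n k rows N (modulus (length rows + N * N)) U"
  shows "selected J \<subseteq> {..<length rows}"
    and "k - count_true U \<le> card (selected J - selected U) * (walk_length k + 1)"
    and "0 \<le> \<beta> (length rows) n \<Longrightarrow>
      real (card (union_of (selected J))) \<le> \<beta> (length rows) n * real (card (union_of Z))"
proof -
  define r where "r = k - count_true U"
  define P where "P = modulus (length rows + N * N)"
  have "0 < r" using U(2) by (simp add: r_def)
  then obtain j where N: "N = 2 ^ j" "r \<le> N * N" "N * N < 4 * r"
    unfolding N_def r_def[symmetric] by (rule side_cases)
  obtain e where P: "P = 2 ^ e" "length rows + N * N \<le> P"
    unfolding P_def by (rule modulus_cases)
  have "k \<le> length rows"
    using card_mono[OF _ Z(1)] Z(2) by simp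
  then have r: "r + count_true U \<le> length rows"
    using U(2) by (simp add: r_def)
  define cands where "cands = map (\<lambda>aw. solve (residual n N P rows U aw)) (List.product [0..<P] (words (walk_length k)))"
  define all where "all = map (\<lambda>_. True) [0..<length rows]"
  have J: "J = argmin (union_cost n rows) all cands"
    by (simp add: J_def best_def cands_def all_def P_def)
  have all: "selected all = {..<length rows}"
    by (auto simp: all_def selected_map_upt)
  have props: "selected J' \<subseteq> {..<length rows} \<and> r \<le> card (selected J' - selected U) * (walk_length k + 1)"
    if "J' \<in> set (all # cands)" for J'
  proof -
    consider "J' = all" | a w where "w \<in> set (words (walk_length k))" "J' = solve (residual n N P rows U (a, w))"
      using \<open>J' \<in> set (all # cands)\<close> by (auto simp: cands_def)
    then show ?thesis
    proof cases
      case 1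
      moreover have "selected U \<subseteq> {..<length rows}"
        using U selected_subset by metis
      ultimately have "card (selected J' - selected U) = length rows - count_true U"
        by (simp add: all card_Diff_subset count_true_eq)
      then have "r \<le> card (selected J' - selected U) * 1"
        using r by simp
      also have "\<dots> \<le> card (selected J' - selected U) * (walk_length k + 1)"
        by (intro mult_left_mono) auto
      finally show ?thesis using 1 all by simp
    next
      case 2
      then show ?thesis
        using candidate[OF U(1) N(2) r 2(2)] words_length by simp
    qed
  qed
  then have "selected J \<subseteq> {..<length rows} \<and> r \<le> card (selected J - selected U) * (walk_length k + 1)"
    unfolding J by (intro props argmin_in)
  then show sub: "selected J \<subseteq> {..<length rows}"
    and "k - count_true U \<le> card (selected J - selected U) * (walk_length k + 1)"
    by (simp_all add: r_def)
  assume \<beta>: "0 \<le> \<beta> (length rows) n"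
  have "finite Z" using Z(1) finite_subset by blast
  \<comment> \<open>At least \<open>r\<close> of the \<open>k\<close> members of \<open>Z\<close>
    are unselected. The set \<open>S\<close> exists only in the analysis; trying all candidates
    makes up for not knowing it.\<close>
  then have "r \<le> card (Z - selected U)"
    using Z(2) diff_card_le_card_Diff[of "selected U" Z] by (simp add: r_def count_true_eq)
  then obtain S where S: "S \<subseteq> Z - selected U" "card S = r"
    by (meson obtain_subset_with_card_n)
  obtain i where i: "double_while (\<lambda>N. N < k) k = (2 ^ i, i)" "k \<le> 2 ^ i"
    by (rule double_while_less)
  \<comment> \<open>Since \<open>r \<le> k \<le> 2 ^ i\<close>, the exponent
    \<open>L = i + 2\<close> is large enough for the torus, and \<open>150000 * L\<close> is exactly
    \<open>walk_length k\<close>.\<close>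
  have "N * N < 4 * 2 ^ i"
    using N(3) i(2) by (auto simp: r_def)
  then have "N\<^sup>2 < 2 ^ (i + 2)"
    by (simp add: power2_eq_square)
  have "walk_length k = 150000 * (i + 2)"
    by (simp only: walk_length_def i(1) snd_conv)
  obtain a w where aw: "a < P" "w \<in> set (words (walk_length k))"
      "\<And>p. p \<in> torus N \<Longrightarrow> \<exists>i\<in>S. covers N P a w i p"
  proof -
    have "S \<subseteq> {..<length rows}" "length rows \<le> P" "N * N \<le> P"
      using S(1) Z(1) P(2) by auto
    from ex_covering_walk[OF this(1) S(2) N \<open>N\<^sup>2 < 2 ^ (i + 2)\<close> P(1) this(2,3)] show ?thesis
      using that unfolding \<open>walk_length k = 150000 * (i + 2)\<close> by blast
  qed
  let ?I = "residual n N P rows U (a, w)"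
  have S': "S \<subseteq> {..<length rows}"
    using S(1) Z(1) by blast
  have feas: "S \<in> rb_feasible ?I"
    using S(1) S' aw(3) by (auto simp: rb_feasible_residual) blast
  have valid: "valid_rb ?I"
    using feas by (rule valid_residual)
  have J': "solve ?I \<in> set (all # cands)"
    using aw(1,2) by (auto simp: cands_def)
  have "card (union_of (selected J)) = union_cost n rows J"
    using sub by (rule union_cost_eq[symmetric])
  also have "\<dots> \<le> union_cost n rows (solve ?I)"
    unfolding J by (rule argmin_le[OF J'])
  also have "\<dots> = card (union_of (selected (solve ?I)))"
    using props[OF J'] by (intro union_cost_eq) blast
  finally have "real (card (union_of (selected J))) \<le> real (rb_cost ?I (selected (solve ?I)))"
    using props[OF J'] by (subst rb_cost_residual) auto
  also have "\<dots> \<le> \<beta> (length rows) n * real (rb_cost ?I S)"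
    using solve_cost[OF valid feas] by (simp only: fst_residual length_residual)
  also have "\<dots> \<le> \<beta> (length rows) n * real (card (union_of Z))"
  proof (rule mult_left_mono[OF _ \<beta>])
    have "finite (union_of Z)"
      using \<open>finite Z\<close> by simp
    then have "card (union_of S) \<le> card (union_of Z)"
      using S(1) by (intro card_mono) auto
    then show "real (rb_cost ?I S) \<le> real (card (union_of Z))"
      by (simp add: rb_cost_residual[OF S'])
  qed
  finally show "real (card (union_of (selected J))) \<le> \<beta> (length rows) n * real (card (union_of Z))" .
qed

lemma selected_augment:
  assumes "length U = length rows" "count_true U < k" "Z \<subseteq> {..<length rows}" "card Z = k"
  shows "selected (augment solve n k rows U) = selected U \<union> selected (best solve n k rows (side (k - count_true U))
    (modulus (length rows + side (k - count_true U) * side (k - count_true U))) U)"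
proof -
  have "selected U \<subseteq> {..<length rows}"
    using assms(1) selected_subset by metis
  then show ?thesis
    using best_correct(1)[OF assms] assms(2) by (auto simp: augment_def selected_map_upt) (auto simp: selected_def)
qed

text \<open>The number \<open>T\<close> of rounds that change the selection is controlled by the geometric decay of
  the number of sets still missing.\<close>

lemma rounds:
  assumes Z: "Z \<subseteq> {..<length rows}" "card Z = k" and \<beta>: "0 \<le> \<beta> (length rows) n"
  defines "U \<equiv> \<lambda>t. (augment solve n k rows ^^ t) (map (\<lambda>_. False) [0..<length rows])"
  defines "\<rho> \<equiv> 1 - 1 / (real (walk_length k) + 1)"
  shows "\<exists>T. real (card (union_of (selected (U t)))) \<le> real T * (\<beta> (length rows) n * real (card (union_of Z)))
    \<and> (T = 0 \<or> 1 \<le> real k * \<rho> ^ (T - 1)) \<and> real (k - count_true (U t)) \<le> real k * \<rho> ^ T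
    \<and> (k \<le> count_true (U t) \<or> t \<le> count_true (U t))"
proof (induction t)
  case 0
  have "selected (U 0) = {}"
    by (simp add: U_def selected_map_upt)
  then show ?case by (intro exI[of _ 0]) auto
next
  case (Suc t)
  let ?D = "real (walk_length k) + 1"
  have \<rho>: "0 \<le> \<rho>" by (simp add: \<rho>_def)
  from Suc obtain T where T:
    "real (card (union_of (selected (U t)))) \<le> real T * (\<beta> (length rows) n * real (card (union_of Z)))"
    "T = 0 \<or> 1 \<le> real k * \<rho> ^ (T - 1)" "real (k - count_true (U t)) \<le> real k * \<rho> ^ T"
    "k \<le> count_true (U t) \<or> t \<le> count_true (U t)"
    by blast
  have Suc_U: "U (Suc t) = augment solve n k rows (U t)"
    by (simp add: U_def)
  have len: "length (U t) = length rows"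
    unfolding U_def by (rule length_funpow_augment) simp
  show ?case
  proof (cases "k \<le> count_true (U t)")
    case True
    then have "U (Suc t) = U t"
      by (simp add: Suc_U augment_def)
    then show ?thesis
      using T True by (intro exI[of _ T]) simp
  next
    case False
    then have lt: "count_true (U t) < k" by simp
    define J where "J = best solve n k rows (side (k - count_true (U t)))
      (modulus (length rows + side (k - count_true (U t)) * side (k - count_true (U t)))) (U t)"
    note J = best_correct[OF len lt Z, folded J_def]
    define c c' x where "c = k - count_true (U t)" and "c' = k - count_true (U (Suc t))"
      and "x = card (selected J - selected (U t))"
    have selected: "selected (U (Suc t)) = selected (U t) \<union> selected J"
      unfolding Suc_U J_def by (rule selected_augment[OF len lt Z])
    have "selected (U (Suc t)) = selected (U t) \<union> (selected J - selected (U t))"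
      unfolding selected by blast
    then have "count_true (U (Suc t)) = card (selected (U t) \<union> (selected J - selected (U t)))"
      by (simp only: count_true_eq)
    also have "\<dots> = card (selected (U t)) + card (selected J - selected (U t))"
      by (rule card_Un_disjoint) auto
    finally have count: "count_true (U (Suc t)) = count_true (U t) + x"
      by (simp only: count_true_eq x_def)
    have cx: "c \<le> x * (walk_length k + 1)"
      unfolding c_def x_def by (rule J(2))
    then have "0 < x"
      using lt by (cases x) (auto simp: c_def)
    have "real c \<le> real (x * (walk_length k + 1))"
      using cx by (simp only: of_nat_le_iff)
    then have "real c / ?D \<le> real x"
      by (simp add: field_simps)
    \<comment> \<open>At least the fraction \<open>1 / ?D\<close> of the missing sets is added; an
      overshoot leaves nothing missing, as subtraction is truncated.\<close>
    have "real c' \<le> \<rho> * real c"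
    proof (cases "x \<le> c")
      case True
      then have "real c' = real c - real x"
        unfolding c'_def count using lt by (simp add: c_def)
      also have "\<dots> \<le> real c - real c / ?D"
        using \<open>real c / ?D \<le> real x\<close> by simp
      also have "\<dots> = \<rho> * real c"
        by (simp add: \<rho>_def algebra_simps)
      finally show ?thesis .
    next
      case False
      then have "c' = 0"
        unfolding c'_def count by (simp add: c_def)
      then show ?thesis
        using \<rho> by simp
    qed
    also have "\<dots> \<le> \<rho> * (real k * \<rho> ^ T)"
      using T(3) \<rho> unfolding c_def by (intro mult_left_mono) auto
    finally have "real c' \<le> real k * \<rho> ^ Suc T"
      by (simp add: mult_ac)
    \<comment> \<open>Some set was still missing before this round. The exponent is one less than
      the new number of rounds because nothing need be missing afterwards.\<close>
    moreover have "1 \<le> real k * \<rho> ^ (Suc T - 1)"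
    proof -
      have "1 \<le> real c" using lt by (simp add: c_def)
      then show ?thesis using T(3) unfolding c_def by simp
    qed
    moreover have "real (card (union_of (selected (U (Suc t)))))
        \<le> real (Suc T) * (\<beta> (length rows) n * real (card (union_of Z)))"
    proof -
      have "card (union_of (selected (U (Suc t)))) \<le> card (union_of (selected (U t))) + card (union_of (selected J))"
        unfolding selected UN_Un by (rule card_Un_le)
      then have "real (card (union_of (selected (U (Suc t)))))
          \<le> real (card (union_of (selected (U t)))) + real (card (union_of (selected J)))"
        by linarith
      also have "\<dots> \<le> real T * (\<beta> (length rows) n * real (card (union_of Z)))
          + \<beta> (length rows) n * real (card (union_of Z))"
        by (intro add_mono T(1) J(3) \<beta>)
      finally show ?thesis
        by (simp add: distrib_right)
    qed
    moreover have "k \<le> count_true (U (Suc t)) \<or> Suc t \<le> count_true (U (Suc t))"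
      using T(4) False \<open>0 < x\<close> unfolding count by linarith
    ultimately show ?thesis
      unfolding c'_def by (intro exI[of _ "Suc T"]) blast
  qed
qed

text \<open>Taking logarithms with \<open>1 - 1 / D \<le> exp (- 1 / D)\<close> bounds
  \<open>T - 1\<close> by \<open>D * ln (real k)\<close>; the last round accounts for the additional
  1.\<close>

lemma rounds_le:
  assumes k: "1 \<le> k" and \<rho>: "\<rho> = 1 - 1 / D" "1 \<le> D" and T: "T = 0 \<or> 1 \<le> real k * \<rho> ^ (T - 1)"
  shows "real T \<le> 1 + D * ln (real k)"
proof (cases "T \<le> 1")
  case True
  then have "real T \<le> 1" by simp
  also have "1 \<le> 1 + D * ln (real k)"
    using k \<rho>(2) by simp
  finally show ?thesis .
next
  case False
  have "\<rho> ^ (T - 1) \<le> exp (- 1 / D) ^ (T - 1)"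
  proof (rule power_mono)
    show "\<rho> \<le> exp (- 1 / D)"
      using \<rho>(1) exp_ge_add_one_self[of "- 1 / D"] by simp
    show "0 \<le> \<rho>"
      using \<rho> by simp
  qed
  also have "\<dots> = exp (- (real (T - 1) / D))"
    by (simp flip: exp_of_nat_mult)
  finally have "real k * \<rho> ^ (T - 1) \<le> real k * exp (- (real (T - 1) / D))"
    by (rule mult_left_mono) simp
  with T False have "1 \<le> real k * exp (- (real (T - 1) / D))"
    by auto
  then have "exp (real (T - 1) / D) \<le> real k"
    by (simp add: exp_minus field_simps)
  then have "real (T - 1) / D \<le> ln (real k)"
    using k by (subst ln_ge_iff) auto
  then show ?thesis
    using False \<rho>(2) by (simp add: field_simps of_nat_diff)
qed

lemma selected_trim: "selected (trim k U) = {i \<in> selected U. card {j \<in> selected U. j < i} < k}"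
proof -
  have "length (filter (nth_default False U) [0..<i]) = card {j \<in> selected U. j < i}" for i
    unfolding length_filter_upt by (simp add: selected_def conj_commute)
  then show ?thesis
    using selected_subset[of U] by (auto simp: trim_def selected_map_upt) (auto simp: selected_def)
qed

text \<open>Ranking the selected indices is a bijection onto an initial segment, so exactly
  \<open>k\<close> of them have rank below \<open>k\<close>.\<close>

lemma card_selected_trim:
  assumes "k \<le> count_true U"
  shows "card (selected (trim k U)) = k"
proof -
  define S where "S = selected U"
  have fin: "finite S" by (simp add: S_def)
  define f where "f i = card {j \<in> S. j < i}" for i
  have less: "f i < f j" if "i \<in> S" "i < j" for i j
    unfolding f_def using that fin by (intro psubset_card_mono) auto
  have inj: "inj_on f S"
    by (rule inj_onI) (metis less linorder_less_linear order_less_irrefl)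
  have "f ` S \<subseteq> {..<card S}"
  proof
    fix y
    assume "y \<in> f ` S"
    then obtain i where "i \<in> S" "y = f i" by blast
    then show "y \<in> {..<card S}"
      unfolding f_def using fin by (auto intro!: psubset_card_mono)
  qed
  then have img: "f ` S = {..<card S}"
    using fin inj by (intro card_subset_eq) (auto simp: card_image)
  have "f ` {i \<in> S. f i < k} = {..<k}"
  proof -
    have "f ` {i \<in> S. f i < k} = f ` S \<inter> {..<k}"
      by auto
    then show ?thesis
      using img assms by (auto simp: count_true_eq S_def)
  qed
  moreover have "inj_on f {i \<in> S. f i < k}"
    using inj by (rule inj_on_subset) auto
  ultimately have "card {i \<in> S. f i < k} = k"
    by (metis card_image card_lessThan)
  then show ?thesis
    by (simp add: selected_trim S_def f_def)
qed

lemma union_algorithm_correct: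
  assumes k: "1 \<le> k" and Z: "Z \<subseteq> {..<length rows}" "card Z = k" and \<beta>: "0 \<le> \<beta> (length rows) n"
  defines "V \<equiv> union_algorithm solve (n, k, rows)"
  shows "length V = length rows" "card (selected V) = k"
    "real (card (union_of (selected V))) \<le> (1 + (real (walk_length k) + 1) * ln (real k))
      * (\<beta> (length rows) n * real (card (union_of Z)))"
proof -
  define U where "U = (augment solve n k rows ^^ length rows) (map (\<lambda>_. False) [0..<length rows])"
  have V: "V = trim k U"
    by (simp add: V_def union_algorithm_def U_def)
  have len: "length U = length rows"
    unfolding U_def by (rule length_funpow_augment) simp
  then show "length V = length rows"
    by (simp add: V trim_def)
  obtain T where T:
    "real (card (union_of (selected U))) \<le> real T * (\<beta> (length rows) n * real (card (union_of Z)))"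
    "T = 0 \<or> 1 \<le> real k * (1 - 1 / (real (walk_length k) + 1)) ^ (T - 1)"
    "k \<le> count_true U \<or> length rows \<le> count_true U"
    using rounds[OF Z \<beta>, of "length rows"] unfolding U_def by blast
  \<comment> \<open>After \<open>length rows\<close> rounds at least \<open>k\<close> or at least
    \<open>length rows\<close> sets are selected; the latter suffices too, because the existence of
    \<open>Z\<close> forces this inequality.\<close>
  have "k \<le> length rows"
    using card_mono[OF _ Z(1)] Z(2) by simp
  then have "k \<le> count_true U"
    using T(3) by auto
  then show "card (selected V) = k"
    unfolding V by (rule card_selected_trim)
  have "selected V \<subseteq> selected U"
    by (auto simp: V selected_trim)
  then have "card (union_of (selected V)) \<le> card (union_of (selected U))"
    by (intro card_mono) auto
  then have "real (card (union_of (selected V))) \<le> real (card (union_of (selected U)))"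
    by simp
  also note T(1)
  also have "real T * (\<beta> (length rows) n * real (card (union_of Z)))
      \<le> (1 + (real (walk_length k) + 1) * ln (real k)) * (\<beta> (length rows) n * real (card (union_of Z)))"
    using \<beta> by (intro mult_right_mono rounds_le[OF k refl _ T(2)]) auto
  finally show "real (card (union_of (selected V))) \<le> (1 + (real (walk_length k) + 1) * ln (real k))
      * (\<beta> (length rows) n * real (card (union_of Z)))" .
qed

end

text \<open>On \<open>m\<close> equal sets, each with all \<open>n\<close> red elements and the only
  blue one, every solution costs \<open>n\<close>, so a factor below 1 is impossible. This recovers
  \<alpha> from its cut-off at 0.\<close>

lemma rb_solver_factor_ge_1:
  assumes solver: "rb_solver \<beta> solve" and "0 < m" "0 < n"
  shows "1 \<le> \<beta> m n"
proof -
  define I :: rb_code where "I = (n, 1, replicate m (replicate n True, [True]))"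
  have selected: "selected (replicate n True) = {..<n}" for n
    by (auto simp: selected_def nth_default_def)
  have valid: "valid_rb I"
    using \<open>0 < m\<close> by (simp add: valid_rb_def I_def)
  have cost: "rb_cost I S = n" if "S \<in> rb_feasible I" for S
  proof -
    have "S \<noteq> {}" "S \<subseteq> {..<m}"
      using that by (auto simp: rb_feasible_def I_def)
    then have "(\<Union>i\<in>S. selected (fst (snd (snd I) ! i))) = {..<n}"
      by (auto simp: I_def selected subset_iff)
    then show ?thesis by (simp add: rb_cost_def)
  qed
  have "selected (solve I) \<in> rb_feasible I"
    using solver valid unfolding rb_solver_def by meson
  moreover have "real (rb_cost I (selected (solve I))) \<le> \<beta> (length (snd (snd I))) (fst I) * real (rb_cost I (selected (solve I)))"
    using solver valid calculation unfolding rb_solver_def by meson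
  ultimately have "real n \<le> \<beta> m n * real n"
    by (simp add: cost) (simp add: I_def)
  then show ?thesis
    using \<open>0 < n\<close> by simp
qed

definition union_factor :: "nat \<Rightarrow> real" where
  "union_factor k = 1 + (real (walk_length k) + 1) * ln (real k)"

text \<open>From \<open>k = 3\<close> on, \<open>x = ln (real k)\<close> is at least 1, so
  lower-order terms can be multiplied up to the square. With \<open>j \<le> 1 + x / ln 2\<close>,
  the length \<open>150000 * (j + 2)\<close> contributes 450000, and the two summands 1 complete the
  constant 450002.\<close>

lemma union_factor_bigo: "union_factor \<in> O(\<lambda>k. (ln (real k))\<^sup>2)"
proof (rule bigoI)
  define c where "c = 450002 + 150000 / ln (2 :: real)"
  show "\<forall>\<^sub>F k in sequentially. norm (union_factor k) \<le> c * norm ((ln (real k))\<^sup>2)"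
    using eventually_ge_at_top[of 3]
  proof eventually_elim
    case (elim k)
    define x where "x = ln (real k)"
    have "exp 1 \<le> real k"
      using exp_le elim by linarith
    then have x: "1 \<le> x"
      unfolding x_def using elim by (subst ln_ge_iff) auto
    obtain j where j: "double_while (\<lambda>N. N < k) k = (2 ^ j, j)" "j = 0 \<or> 2 ^ (j - 1) < k"
      by (rule double_while_less)
    have "real j \<le> 1 + x / ln 2"
    proof (cases "j = 0")
      case False
      then have "real (2 ^ (j - 1)) < real k"
        using j(2) by (simp only: of_nat_less_iff) simp
      then have "ln (2 ^ (j - 1)) < x"
        unfolding x_def using elim by (subst ln_less_cancel_iff) auto
      then have "real (j - 1) * ln 2 < x"
        by (simp add: ln_realpow)
      then show ?thesis
        using False by (simp add: field_simps of_nat_diff)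
    qed (use x in simp)
    then have "real (walk_length k) + 1 \<le> 450001 + 150000 * (x / ln 2)"
      by (simp add: walk_length_def j(1))
    also have "\<dots> \<le> 450001 * x + 150000 * (x / ln 2)"
      using x by simp
    finally have "(real (walk_length k) + 1) * x \<le> (450001 * x + 150000 * (x / ln 2)) * x"
      using x by (intro mult_right_mono) auto
    moreover have "1 \<le> x * x"
      using mult_mono[of 1 x 1 x] x by simp
    ultimately have "union_factor k \<le> c * x\<^sup>2"
      unfolding union_factor_def x_def[symmetric] c_def by (simp add: power2_eq_square algebra_simps)
    moreover have "0 \<le> union_factor k"
      unfolding union_factor_def x_def[symmetric] using x by simp
    ultimately show ?case
      by (simp add: x_def)
  qed
qed

theorem theorem5:
  fixes \<alpha> :: "nat \<Rightarrow> nat \<Rightarrow> real"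
  assumes mono: "\<And>m m' n n'. m \<le> m' \<Longrightarrow> n \<le> n' \<Longrightarrow> \<alpha> m n \<le> \<alpha> m' n'"
    and alg: "approx_algorithm red_blue_set_cover (\<lambda>x. \<alpha> (length (rb_sets x)) (red x)) A"
  shows "\<exists>g :: nat \<Rightarrow> real. g \<in> O(\<lambda>k. (ln (real k))\<^sup>2) \<and>
    (\<exists>A'. approx_algorithm min_k_union
       (\<lambda>x. g (param x) * \<alpha> (length (ku_sets x)) (ground x)) A')"
proof -
  obtain solve where "polytime solve" and solver: "rb_solver (\<lambda>m n. max 0 (\<alpha> m n)) solve"
    using ex_rb_solver[OF alg] by blast
  from polytime_union_algorithm[OF \<open>polytime solve\<close>] obtain T A' where T: "poly_bounded T"
    and A': "\<And>y. run_le A' (enc y) (T y) (enc (union_algorithm solve y))"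
    by (rule polytimeE) (rule that)
  from T obtain c where c: "\<And>y. T y \<le> (esize y + 1) ^ c"
    unfolding poly_bounded_def by blast
  have "approx_algorithm min_k_union
      (\<lambda>x. union_factor (param x) * \<alpha> (length (ku_sets x)) (ground x)) A'"
    unfolding approx_algorithm_def
  \<comment> \<open>The polynomial \<open>(1 + X) ^ c\<close> matches the form of the bounds in
    \<open>poly_bounded\<close>.\<close>
  proof (intro exI[of _ "[:1, 1:] ^ c"] ballI impI)
    fix x
    assume x: "x \<in> instances min_k_union" "feasible min_k_union x \<noteq> {}"
    define n k Ss m where "n = ground x" and "k = param x" and "Ss = ku_sets x" and "m = length Ss"
    define rows where "rows = map (bits n) Ss"
    define V where "V = union_algorithm solve (n, k, rows)"
    have inst: "\<And>S. S \<in> set Ss \<Longrightarrow> S \<subseteq> {..<n}" "1 \<le> k"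
      using x(1) by (auto simp: min_k_union_def n_def k_def Ss_def)
    have feas: "feasible min_k_union x = {I. I \<subseteq> {..<m} \<and> card I = k}"
      by (simp add: min_k_union_def m_def k_def Ss_def)
    have len: "length rows = m"
      by (simp add: rows_def m_def)
    have code: "encode_instance min_k_union x = enc (n, k, rows)"
      by (simp add: min_k_union_def n_def k_def rows_def Ss_def enc_nat_def enc_list_def encode_list_map
          encode_subset_bits[abs_def])
    have "selected (rows ! i) = Ss ! i" if "i < m" for i
      using inst(1)[of "Ss ! i"] that by (auto simp: rows_def m_def selected_bits)
    then have cost: "cost min_k_union x I = card (\<Union>i\<in>I. selected (rows ! i))" if "I \<subseteq> {..<m}" for I
      using that by (auto simp: min_k_union_def Ss_def intro!: arg_cong[where f = card] SUP_cong)
    have "feasible min_k_union x \<subseteq> Pow {..<m}"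
      by (auto simp: feas)
    then have "finite (feasible min_k_union x)"
      by (rule finite_subset) simp
    then have "opt min_k_union x \<in> cost min_k_union x ` feasible min_k_union x"
      unfolding opt_def using x(2) by (intro Min_in) auto
    then obtain Z where Z: "Z \<subseteq> {..<m}" "card Z = k" "opt min_k_union x = cost min_k_union x Z"
      by (auto simp: feas)
    have rows: "\<And>r. r \<in> set rows \<Longrightarrow> length r = n"
      by (auto simp: rows_def bits_def)
    note correct = union_algorithm_correct[OF solver rows inst(2) Z(1)[folded len] Z(2), folded V_def, unfolded len]
    have V: "length V = m" "card (selected V) = k"
      "real (card (\<Union>i\<in>selected V. selected (rows ! i)))
        \<le> union_factor k * (max 0 (\<alpha> m n) * real (card (\<Union>i\<in>Z. selected (rows ! i))))"
      using correct unfolding union_factor_def by simp_all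
    have "selected V \<subseteq> {..<m}"
      using selected_subset[of V] V(1) by simp
    have "run_le A' (enc (n, k, rows)) ((esize (n, k, rows) + 1) ^ c) (enc V)"
      using run_le_mono[OF A' c] unfolding V_def .
    then obtain t where t: "run A' (enc (n, k, rows)) t (enc V)" "t \<le> (esize (n, k, rows) + 1) ^ c"
      unfolding run_le_def by blast
    have sol: "encode_solution min_k_union x (selected V) = enc V"
      using bits_selected[OF V(1)] by (simp add: min_k_union_def encode_subset_bits m_def Ss_def)
    have bound: "t \<le> poly ([:1, 1:] ^ c) (nodes (encode_instance min_k_union x))"
      unfolding code using t(2) by (simp add: poly_power add.commute del: enc_Pair)
    \<comment> \<open>If the union of \<open>Z\<close> is empty, both sides vanish. Otherwise there
      are a set and a ground element, so the factor is at least 1 and the cut-off at 0 is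
      inactive.\<close>
    have "max 0 (\<alpha> m n) * real (card (\<Union>i\<in>Z. selected (rows ! i))) = \<alpha> m n * real (card (\<Union>i\<in>Z. selected (rows ! i)))"
    proof (cases "(\<Union>i\<in>Z. selected (rows ! i)) = {}")
      case False
      then obtain i e where "i \<in> Z" "e \<in> selected (rows ! i)" by blast
      then have "i < m" "e < n"
        using Z(1) selected_subset[of "rows ! i"] rows[of "rows ! i"] len by (auto simp: subset_iff)
      then have "1 \<le> max 0 (\<alpha> m n)"
        by (intro rb_solver_factor_ge_1[OF solver]) auto
      then show ?thesis by (simp add: max_def split: if_splits)
    qed simp
    with V(3) have "real (cost min_k_union x (selected V)) \<le> union_factor k * \<alpha> m n * real (opt min_k_union x)"
      by (simp only: Z(3) cost[OF Z(1)] cost[OF \<open>selected V \<subseteq> {..<m}\<close>] mult.assoc)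
    then show "\<exists>t s. run A' (encode_instance min_k_union x) t (encode_solution min_k_union x s) \<and>
        t \<le> poly ([:1, 1:] ^ c) (nodes (encode_instance min_k_union x)) \<and> s \<in> feasible min_k_union x \<and>
        real (cost min_k_union x s)
          \<le> union_factor (param x) * \<alpha> (length (ku_sets x)) (ground x) * real (opt min_k_union x)"
      using t(1) bound V(2) \<open>selected V \<subseteq> {..<m}\<close>
      by (intro exI[of _ t] exI[of _ "selected V"]) (simp add: sol code feas k_def m_def n_def Ss_def)
  qed
  with union_factor_bigo show ?thesis
    by blast
qed

end
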